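(* Under the setting and standing assumptions described in the context, the quadratic form $(\mathscr E,\mathscr F)$ is a Dirichlet form on $L^2(I_0,\mathfrak m)$ in the wide sense, i.e. it is a non-negative symmetric closed form on $L^2(I_0,\mathfrak m)$ satisfying the Markovian property (it is not required to be densely defined).
   Context: Let $-\infty\le l<0<r\le\infty$ and $I=[l,r]\subset[-\infty,\infty]$. Let $\mathbf s$ be a non-constant increasing (not necessarily strictly increasing, not necessarily left or right continuous) real-valued function on $(l,r)$ with $\mathbf s(0-)=\mathbf s(0)=\mathbf s(0+)=0$; set $\mathbf s(l):=\lim_{x\downarrow l}\mathbf s(x)$, $\mathbf s(r):=\lim_{x\uparrow r}\mathbf s(x)$ (possibly infinite) and $\mathbf s(l-):=\mathbf s(l)$, $\mathbf s(r+):=\mathbf s(r)$. Let $\mathfrak m$ be a positive measure on $I$ with $\mathfrak m([a,b])<\infty$ for every $[a,b]\subset(l,r)$ and $\mathfrak m(\{0\})=0$ ($\mathfrak m(\{l\}),\mathfrak m(\{r\})$ may be infinite). Let $U$ be the set of $x\in I$ such that $\mathbf s$ is constant on $(x-\varepsilon,x+\varepsilon)\cap I$ for some $\varepsilon>0$, and write $U\setminus\{l,r\}=\bigcup_{n\ge1}(c_n,d_n)$ as a disjoint union of open intervals. Let $D^\pm:=\{x\in I:\mathbf s(x)\neq\mathbf s(x\pm)\}$, $D^0:=D^+\cap D^-$, $D:=D^+\cup D^-$. The interval $(c_n,d_n)$ is called isolated if $c_n,d_n\in D\cup\{l,r\}$. The endpoint $r$ is approachable if $\mathbf s(r)<\infty$;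 an approachable $r$ is regular if $\mathfrak m((r-\varepsilon,r))<\infty$ for some $\varepsilon>0$; a regular $r$ is reflecting if $\mathfrak m(\{r\})<\infty$. Analogously $l$ is approachable if $\mathbf s(l)>-\infty$, regular if moreover $\mathfrak m((l,l+\varepsilon))<\infty$ for some $\varepsilon>0$, reflecting if moreover $\mathfrak m(\{l\})<\infty$. Standing assumptions: (DK) if $l$ or $r$ is an endpoint of an isolated interval $(c_n,d_n)$, then it is reflecting; (DM) $I\setminus U\subset\operatorname{supp}[\mathfrak m]$, $\mathfrak m(\{x\})>0$ for every $x\in D^0$, and for every isolated interval $(c_n,d_n)$, $\mathfrak m(I^{d_n}_{c_n})>0$, where $I^{d_n}_{c_n}$ is the interval with endpoints $c_n,d_n$ which contains $c_n$ whenever $c_n\notin D^+$ and contains $d_n$ whenever $d_n\notin D^-$. The form: let $\mu_d^+:=\sum_{x\in I}(\mathbf s(x+)-\mathbf s(x))\delta_x$, $\mu_d^-:=\sum_{x\in I}(\mathbf s(x)-\mathbf s(x-))\delta_x$; $\mathbf s_d^+(x):=\mu_d^+((0,x))$ for $x\ge0$ and $-\mu_d^+([x,0))$ for $x<0$; $\mathbf s_d^-(x):=\mu_d^-((0,x])$ for $x\ge0$ and $-\mu_d^-((x,0))$ for $x<0$; $\mathbf s_c:=\mathbf s-\mathbf s_d^+-\mathbf s_d^-$, which is continuous and increasing, with Lebesgue–Stieltjes measure $\mu_c$. With the conventions $\int_{(0,x)}:=-\int_{[x,0)}$ and $\int_{(0,x]}:=-\int_{(x,0)}$ for $x<0$,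 let $\mathscr S_d^+$ be the set of functions $f(x)=\int_{(0,x)}g\,d\mu_d^+$, $x\in(l,r)$, with $g\in L^2(I,\mu_d^+)$; $\mathscr S_d^-$ the set of $f(x)=\int_{(0,x]}g\,d\mu_d^-$ with $g\in L^2(I,\mu_d^-)$; $\mathscr S_c$ the set of $f(x)=c_0+\int_{(0,x)}g\,d\mu_c$ with $g\in L^2(I,\mu_c)$, $c_0\in\mathbb R$; in each case write $df/d\mu:=g$. Let $\mathscr S:=\mathscr S_c+\mathscr S_d^++\mathscr S_d^-$; each $f\in\mathscr S$ decomposes uniquely as $f=f^c+f^++f^-$. Each $f\in\mathscr S$ has finite one-sided limits on $(l,r)$, and a finite limit $f(r):=\lim_{x\uparrow r}f(x)$ (resp. $f(l):=\lim_{x\downarrow l}f(x)$) when $r$ (resp. $l$) is approachable. Let $I_0$ be the interval obtained from $I$ by removing the endpoints that are not reflecting, and regard $\mathfrak m$ as a measure on $I_0$. Define $\mathscr F:=\{f\in\mathscr S\cap L^2(I_0,\mathfrak m): f(j)=0 \text{ whenever } j\in\{l,r\},\ j\notin I_0 \text{ and } j \text{ is approachable}\}$ and for $f,g\in\mathscr F$, $\mathscr E(f,g):=\frac12\Big(\int_I\frac{df^c}{d\mu_c}\frac{dg^c}{d\mu_c}d\mu_c+\int_I\frac{df^+}{d\mu_d^+}\frac{dg^+}{d\mu_d^+}d\mu_d^++\int_I\frac{df^-}{d\mu_d^-}\frac{dg^-}{d\mu_d^-}d\mu_d^-\Big)$. *)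

theory Defs
  imports "HOL-Analysis.Analysis"
begin

definition intv :: "ereal \<Rightarrow> ereal \<Rightarrow> real set" where
  "intv l r = {x. l < ereal x \<and> ereal x < r}"

definition sR :: "(real \<Rightarrow> real) \<Rightarrow> real \<Rightarrow> real" where
  "sR s x = Lim (at_right x) s"

definition sL :: "(real \<Rightarrow> real) \<Rightarrow> real \<Rightarrow> real" where
  "sL s x = Lim (at_left x) s"

text \<open>s(r) and s(l) (possibly infinite), as monotone limits.\<close>
definition s_top :: "ereal \<Rightarrow> ereal \<Rightarrow> (real \<Rightarrow> real) \<Rightarrow> ereal" where
  "s_top l r s = (SUP x\<in>intv l r. ereal (s x))"

definition s_bot :: "ereal \<Rightarrow> ereal \<Rightarrow> (real \<Rightarrow> real) \<Rightarrow> ereal" where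
  "s_bot l r s = (INF x\<in>intv l r. ereal (s x))"

definition approachable_r :: "ereal \<Rightarrow> ereal \<Rightarrow> (real \<Rightarrow> real) \<Rightarrow> bool" where
  "approachable_r l r s \<longleftrightarrow> s_top l r s < \<infinity>"

definition approachable_l :: "ereal \<Rightarrow> ereal \<Rightarrow> (real \<Rightarrow> real) \<Rightarrow> bool" where
  "approachable_l l r s \<longleftrightarrow> s_bot l r s > -\<infinity>"

text \<open>"m((r-eps,r)) finite for some eps>0" is read as: m((a,r)) finite for some a in (l,r)
  (this is the same for finite r, and the intended meaning for r = +infinity).\<close>
definition regular_r :: "ereal \<Rightarrow> ereal \<Rightarrow> (real \<Rightarrow> real) \<Rightarrow> ereal measure \<Rightarrow> bool" where
  "regular_r l r s m \<longleftrightarrow> approachable_r l r s \<and> (\<exists>a. l < a \<and> a < r \<and> emeasure m {a<..<r} < \<infinity>)"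

definition regular_l :: "ereal \<Rightarrow> ereal \<Rightarrow> (real \<Rightarrow> real) \<Rightarrow> ereal measure \<Rightarrow> bool" where
  "regular_l l r s m \<longleftrightarrow> approachable_l l r s \<and> (\<exists>a. l < a \<and> a < r \<and> emeasure m {l<..<a} < \<infinity>)"

definition reflecting_r :: "ereal \<Rightarrow> ereal \<Rightarrow> (real \<Rightarrow> real) \<Rightarrow> ereal measure \<Rightarrow> bool" where
  "reflecting_r l r s m \<longleftrightarrow> regular_r l r s m \<and> emeasure m {r} < \<infinity>"

definition reflecting_l :: "ereal \<Rightarrow> ereal \<Rightarrow> (real \<Rightarrow> real) \<Rightarrow> ereal measure \<Rightarrow> bool" where
  "reflecting_l l r s m \<longleftrightarrow> regular_l l r s m \<and> emeasure m {l} < \<infinity>"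

definition I0 :: "ereal \<Rightarrow> ereal \<Rightarrow> (real \<Rightarrow> real) \<Rightarrow> ereal measure \<Rightarrow> ereal set" where
  "I0 l r s m = {l..r} - ({j. j = l \<and> \<not> reflecting_l l r s m} \<union> {j. j = r \<and> \<not> reflecting_r l r s m})"

text \<open>Jump sets. At the endpoints s(l-) = s(l) = s(l+), so D^+, D^- lie in (l,r).\<close>
definition Dp :: "ereal \<Rightarrow> ereal \<Rightarrow> (real \<Rightarrow> real) \<Rightarrow> real set" where
  "Dp l r s = {x \<in> intv l r. s x \<noteq> sR s x}"

definition Dm :: "ereal \<Rightarrow> ereal \<Rightarrow> (real \<Rightarrow> real) \<Rightarrow> real set" where
  "Dm l r s = {x \<in> intv l r. s x \<noteq> sL s x}"

definition D0 :: "ereal \<Rightarrow> ereal \<Rightarrow> (real \<Rightarrow> real) \<Rightarrow> real set" where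
  "D0 l r s = Dp l r s \<inter> Dm l r s"

definition Djump :: "ereal \<Rightarrow> ereal \<Rightarrow> (real \<Rightarrow> real) \<Rightarrow> real set" where
  "Djump l r s = Dp l r s \<union> Dm l r s"

definition Ucon :: "ereal \<Rightarrow> ereal \<Rightarrow> (real \<Rightarrow> real) \<Rightarrow> ereal set" where
  "Ucon l r s = {x \<in> {l..r}. \<exists>V. open V \<and> x \<in> V \<and>
      (\<forall>y\<in>intv l r. \<forall>z\<in>intv l r. ereal y \<in> V \<longrightarrow> ereal z \<in> V \<longrightarrow> s y = s z)}"

definition component :: "ereal \<Rightarrow> ereal \<Rightarrow> (real \<Rightarrow> real) \<Rightarrow> ereal \<Rightarrow> ereal \<Rightarrow> bool" where
  "component l r s c d \<longleftrightarrow> c < d \<and> {c<..<d} \<subseteq> Ucon l r s - {l, r}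
      \<and> c \<notin> Ucon l r s - {l, r} \<and> d \<notin> Ucon l r s - {l, r}"

definition isolated :: "ereal \<Rightarrow> ereal \<Rightarrow> (real \<Rightarrow> real) \<Rightarrow> ereal \<Rightarrow> ereal \<Rightarrow> bool" where
  "isolated l r s c d \<longleftrightarrow> component l r s c d
      \<and> c \<in> ereal ` Djump l r s \<union> {l, r} \<and> d \<in> ereal ` Djump l r s \<union> {l, r}"

definition Icd :: "ereal \<Rightarrow> ereal \<Rightarrow> (real \<Rightarrow> real) \<Rightarrow> ereal \<Rightarrow> ereal \<Rightarrow> ereal set" where
  "Icd l r s c d = {c<..<d} \<union> (if c \<notin> ereal ` Dp l r s then {c} else {})
                            \<union> (if d \<notin> ereal ` Dm l r s then {d} else {})"

definition msupp :: "ereal measure \<Rightarrow> ereal set" where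
  "msupp m = {x. \<forall>V. open V \<longrightarrow> x \<in> V \<longrightarrow> emeasure m V > 0}"

definition cond_DK :: "ereal \<Rightarrow> ereal \<Rightarrow> (real \<Rightarrow> real) \<Rightarrow> ereal measure \<Rightarrow> bool" where
  "cond_DK l r s m \<longleftrightarrow> (\<forall>c d. isolated l r s c d \<longrightarrow>
      ((c = l \<or> d = l) \<longrightarrow> reflecting_l l r s m) \<and> ((c = r \<or> d = r) \<longrightarrow> reflecting_r l r s m))"

definition cond_DM :: "ereal \<Rightarrow> ereal \<Rightarrow> (real \<Rightarrow> real) \<Rightarrow> ereal measure \<Rightarrow> bool" where
  "cond_DM l r s m \<longleftrightarrow> {l..r} - Ucon l r s \<subseteq> msupp m
      \<and> (\<forall>x\<in>D0 l r s. emeasure m {ereal x} > 0)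
      \<and> (\<forall>c d. isolated l r s c d \<longrightarrow> emeasure m (Icd l r s c d) > 0)"

definition mu_dp :: "ereal \<Rightarrow> ereal \<Rightarrow> (real \<Rightarrow> real) \<Rightarrow> real measure" where
  "mu_dp l r s = density (count_space UNIV)
      (\<lambda>x. if x \<in> intv l r then ennreal (sR s x - s x) else 0)"

definition mu_dm :: "ereal \<Rightarrow> ereal \<Rightarrow> (real \<Rightarrow> real) \<Rightarrow> real measure" where
  "mu_dm l r s = density (count_space UNIV)
      (\<lambda>x. if x \<in> intv l r then ennreal (s x - sL s x) else 0)"

definition s_dp :: "ereal \<Rightarrow> ereal \<Rightarrow> (real \<Rightarrow> real) \<Rightarrow> real \<Rightarrow> real" where
  "s_dp l r s x = (if 0 \<le> x then measure (mu_dp l r s) {0<..<x} else - measure (mu_dp l r s) {x..<0})"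

definition s_dm :: "ereal \<Rightarrow> ereal \<Rightarrow> (real \<Rightarrow> real) \<Rightarrow> real \<Rightarrow> real" where
  "s_dm l r s x = (if 0 \<le> x then measure (mu_dm l r s) {0<..x} else - measure (mu_dm l r s) {x<..<0})"

definition s_c :: "ereal \<Rightarrow> ereal \<Rightarrow> (real \<Rightarrow> real) \<Rightarrow> real \<Rightarrow> real" where
  "s_c l r s x = s x - s_dp l r s x - s_dm l r s x"

text \<open>Lebesgue--Stieltjes measure of s_c on (l,r) (the unique Borel measure on the reals,
  carried by (l,r), giving mass s_c(b) - s_c(a) to (a,b]).\<close>
definition mu_c :: "ereal \<Rightarrow> ereal \<Rightarrow> (real \<Rightarrow> real) \<Rightarrow> real measure" where
  "mu_c l r s = (THE \<mu>. sets \<mu> = sets borel \<and> emeasure \<mu> (- intv l r) = 0 \<and>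
      (\<forall>a\<in>intv l r. \<forall>b\<in>intv l r. a \<le> b \<longrightarrow>
          emeasure \<mu> {a<..b} = ennreal (s_c l r s b - s_c l r s a)))"

definition int_open :: "real measure \<Rightarrow> (real \<Rightarrow> real) \<Rightarrow> real \<Rightarrow> real" where
  "int_open \<mu> g x = (if 0 \<le> x then (LINT y:{0<..<x}|\<mu>. g y) else - (LINT y:{x..<0}|\<mu>. g y))"

definition int_closed :: "real measure \<Rightarrow> (real \<Rightarrow> real) \<Rightarrow> real \<Rightarrow> real" where
  "int_closed \<mu> g x = (if 0 \<le> x then (LINT y:{0<..x}|\<mu>. g y) else - (LINT y:{x<..<0}|\<mu>. g y))"

definition L2 :: "real measure \<Rightarrow> (real \<Rightarrow> real) \<Rightarrow> bool" where
  "L2 \<mu> g \<longleftrightarrow> g \<in> borel_measurable \<mu> \<and> integrable \<mu> (\<lambda>x. (g x)\<^sup>2)"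

definition has_repr :: "ereal \<Rightarrow> ereal \<Rightarrow> (real \<Rightarrow> real) \<Rightarrow> (real \<Rightarrow> real)
    \<Rightarrow> real \<times> (real \<Rightarrow> real) \<times> (real \<Rightarrow> real) \<times> (real \<Rightarrow> real) \<Rightarrow> bool" where
  "has_repr l r s f \<rho> \<longleftrightarrow> (case \<rho> of (c0, gc, gp, gm) \<Rightarrow>
      L2 (mu_c l r s) gc \<and> L2 (mu_dp l r s) gp \<and> L2 (mu_dm l r s) gm \<and>
      (\<forall>x\<in>intv l r. f x = c0 + int_open (mu_c l r s) gc x + int_open (mu_dp l r s) gp x
                               + int_closed (mu_dm l r s) gm x))"

definition S_space :: "ereal \<Rightarrow> ereal \<Rightarrow> (real \<Rightarrow> real) \<Rightarrow> (real \<Rightarrow> real) set" where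
  "S_space l r s = {f. \<exists>\<rho>. has_repr l r s f \<rho>}"

definition repr :: "ereal \<Rightarrow> ereal \<Rightarrow> (real \<Rightarrow> real) \<Rightarrow> (real \<Rightarrow> real)
    \<Rightarrow> real \<times> (real \<Rightarrow> real) \<times> (real \<Rightarrow> real) \<times> (real \<Rightarrow> real)" where
  "repr l r s f = (SOME \<rho>. has_repr l r s f \<rho>)"

definition ext :: "ereal \<Rightarrow> ereal \<Rightarrow> (real \<Rightarrow> real) \<Rightarrow> ereal \<Rightarrow> real" where
  "ext l r f y = (if y = l then Lim (filtercomap ereal (at_right l)) f
                  else if y = r then Lim (filtercomap ereal (at_left r)) f
                  else if l < y \<and> y < r then f (real_of_ereal y) else 0)"

definition m0 :: "ereal \<Rightarrow> ereal \<Rightarrow> (real \<Rightarrow> real) \<Rightarrow> ereal measure \<Rightarrow> ereal measure" where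
  "m0 l r s m = density m (indicator (I0 l r s m))"

definition F_space :: "ereal \<Rightarrow> ereal \<Rightarrow> (real \<Rightarrow> real) \<Rightarrow> ereal measure \<Rightarrow> (real \<Rightarrow> real) set" where
  "F_space l r s m = {f \<in> S_space l r s.
      ext l r f \<in> borel_measurable (m0 l r s m) \<and> integrable (m0 l r s m) (\<lambda>y. (ext l r f y)\<^sup>2) \<and>
      ((l \<notin> I0 l r s m \<and> approachable_l l r s) \<longrightarrow> ext l r f l = 0) \<and>
      ((r \<notin> I0 l r s m \<and> approachable_r l r s) \<longrightarrow> ext l r f r = 0)}"

definition E_form :: "ereal \<Rightarrow> ereal \<Rightarrow> (real \<Rightarrow> real) \<Rightarrow> (real \<Rightarrow> real) \<Rightarrow> (real \<Rightarrow> real) \<Rightarrow> real" where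
  "E_form l r s f g = (case repr l r s f of (_, fc, fp, fm) \<Rightarrow> case repr l r s g of (_, gc, gp, gm) \<Rightarrow>
      (1/2) * ((LINT x|mu_c l r s. fc x * gc x) + (LINT x|mu_dp l r s. fp x * gp x)
               + (LINT x|mu_dm l r s. fm x * gm x)))"

text \<open>A form (F,E) whose elements are functions f, each representing the element rep f of
  L^2(M). It is a Dirichlet form in the wide sense if: F is a linear space mapped linearly
  into L^2(M); E is well defined on L^2-classes, symmetric, bilinear, non-negative; closed
  (complete w.r.t. E_1); and Markovian (the unit contraction operates).\<close>
definition dirichlet_form_wide :: "'a measure \<Rightarrow> (('b \<Rightarrow> real) \<Rightarrow> 'a \<Rightarrow> real) \<Rightarrow> ('b \<Rightarrow> real) set
    \<Rightarrow> (('b \<Rightarrow> real) \<Rightarrow> ('b \<Rightarrow> real) \<Rightarrow> real) \<Rightarrow> bool" where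
  "dirichlet_form_wide M rep F E \<longleftrightarrow>
     (\<lambda>_. 0) \<in> F \<and>
     (\<forall>f\<in>F. \<forall>g\<in>F. (\<lambda>x. f x + g x) \<in> F) \<and>
     (\<forall>f\<in>F. \<forall>c. (\<lambda>x. c * f x) \<in> F) \<and>
     (\<forall>f\<in>F. rep f \<in> borel_measurable M \<and> integrable M (\<lambda>y. (rep f y)\<^sup>2)) \<and>
     (\<forall>f\<in>F. \<forall>g\<in>F. AE y in M. rep (\<lambda>x. f x + g x) y = rep f y + rep g y) \<and>
     (\<forall>f\<in>F. \<forall>c. AE y in M. rep (\<lambda>x. c * f x) y = c * rep f y) \<and>
     (\<forall>f\<in>F. (AE y in M. rep f y = 0) \<longrightarrow> E f f = 0) \<and>
     (\<forall>f\<in>F. \<forall>g\<in>F. E f g = E g f) \<and>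
     (\<forall>f\<in>F. \<forall>g\<in>F. \<forall>h\<in>F. E (\<lambda>x. f x + g x) h = E f h + E g h) \<and>
     (\<forall>f\<in>F. \<forall>g\<in>F. \<forall>c. E (\<lambda>x. c * f x) g = c * E f g) \<and>
     (\<forall>f\<in>F. E f f \<ge> 0) \<and>
     (\<forall>u. (\<forall>n. u n \<in> F) \<longrightarrow>
        (\<forall>e>0. \<exists>N. \<forall>n\<ge>N. \<forall>k\<ge>N.
            E (\<lambda>x. u n x - u k x) (\<lambda>x. u n x - u k x) + (\<integral>y. (rep (\<lambda>x. u n x - u k x) y)\<^sup>2 \<partial>M) < e) \<longrightarrow>
        (\<exists>f\<in>F. (\<lambda>n. E (\<lambda>x. u n x - f x) (\<lambda>x. u n x - f x) + (\<integral>y. (rep (\<lambda>x. u n x - f x) y)\<^sup>2 \<partial>M)) \<longlonglongrightarrow> 0)) \<and>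
     (\<forall>f\<in>F. (\<lambda>x. min 1 (max 0 (f x))) \<in> F \<and>
        (AE y in M. rep (\<lambda>x. min 1 (max 0 (f x))) y = min 1 (max 0 (rep f y))) \<and>
        E (\<lambda>x. min 1 (max 0 (f x))) (\<lambda>x. min 1 (max 0 (f x))) \<le> E f f)"

end

theory Submission
  imports Defs
begin

text \<open>
  The scale function is used as a change of time. Its generalised inverse \<open>phi\<close> carries Lebesgue
  measure on the interval \<open>J\<close> spanned by the values of \<open>s\<close>, split into the range of \<open>s\<close> and the
  parts of the gaps above and below \<open>s (phi y)\<close>, to the three measures \<open>mu_c\<close>, \<open>mu_dp\<close> and \<open>mu_dm\<close>.
  Hence a function belongs to \<open>S_space\<close> iff it has the form \<open>h \<circ> s\<close> with \<open>h\<close> an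
  absolutely continuous function with square integrable derivative; \<open>E_form f f\<close> is half the squared norm of
  the derivative that is constant in every gap, and this choice minimises the norm.

  The unit contraction does not enlarge increments of \<open>h\<close>, so by Radon--Nikodym it does not
  enlarge the derivative. For closedness, the derivatives converge in mean square and the additive
  constants converge because some compact interval inside \<open>(l,r)\<close> has positive mass. If \<open>f\<close> vanishes almost
  everywhere, then \<open>h\<close> vanishes at one-sided limits of \<open>s\<close> which are accumulated by the
  support, on the value of every component of the constancy set (for isolated components by the
  conditions DK and DM) and, on \<open>D0\<close>, by the atoms of \<open>m\<close>; so \<open>f = 0\<close>.
\<close>

section \<open>Mean square convergence\<close>

text \<open>\<open>E_form\<close> is computed from a representation picked by \<open>SOME\<close>,
  and \<open>mu_c\<close> is a definite description, so neither can be handled before uniqueness is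
  known. Transport to Lebesgue measure settles both: a triple of densities becomes one square
  integrable function, its three energies become one integral, and the represented function is the
  primitive read off at the values of \<open>s\<close>.

  The obstacle is that a function on \<open>(l,r)\<close> determines \<open>h\<close> only on the
  closure of the range of \<open>s\<close>. Truncation, or a derivative obtained from
  Radon--Nikodym, does not respect the rule that a derivative be constant on each half of a gap.
  Taking means over these halves is a conditional expectation: the increments between values of
  \<open>s\<close> stay the same, and the norm does not grow, by Jensen's inequality. So any
  derivative may be used in a construction, at the price of an inequality for the form that points
  in the wanted direction.

  Boundary values fit the same picture: at an approachable end they are values of \<open>h\<close>
  at a finite limit of \<open>s\<close>, hence linear, compatible with truncation and continuous
  along convergent sequences.\<close>

definition sq_integrable :: "'a measure \<Rightarrow> ('a \<Rightarrow> real) \<Rightarrow> bool" where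
  "sq_integrable M f \<longleftrightarrow> f \<in> borel_measurable M \<and> integrable M (\<lambda>x. (f x)\<^sup>2)"

text \<open>\<open>L2\<close> is fixed to measures on the reals; the polymorphic version serves
  \<open>m0\<close> as well, which lives on the extended reals.\<close>

lemma L2_iff_sq_integrable: "L2 \<mu> f \<longleftrightarrow> sq_integrable \<mu> f"
  by (simp add: L2_def sq_integrable_def)

lemma sq_integrable_mult:
  assumes "sq_integrable M f" "sq_integrable M g"
  shows "integrable M (\<lambda>x. f x * g x)"
proof (rule Bochner_Integration.integrable_bound)
  show "integrable M (\<lambda>x. (f x)\<^sup>2 + (g x)\<^sup>2)"
    using assms by (auto simp: sq_integrable_def)
  show "(\<lambda>x. f x * g x) \<in> borel_measurable M"
    using assms by (auto simp: sq_integrable_def)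
  have "\<bar>a * b\<bar> \<le> a\<^sup>2 + b\<^sup>2" for a b :: real
  proof -
    have "0 \<le> (\<bar>a\<bar> - \<bar>b\<bar>)\<^sup>2" by simp
    then have "2 * (\<bar>a\<bar> * \<bar>b\<bar>) \<le> a\<^sup>2 + b\<^sup>2" by (simp add: power2_diff)
    moreover have "0 \<le> \<bar>a\<bar> * \<bar>b\<bar>" by simp
    ultimately show ?thesis unfolding abs_mult by linarith
  qed
  then show "AE x in M. norm (f x * g x) \<le> norm ((f x)\<^sup>2 + (g x)\<^sup>2)"
    by (auto simp del: abs_mult)
qed

lemma sq_integrable_scale:
  "sq_integrable M f \<Longrightarrow> sq_integrable M (\<lambda>x. c * f x)"
  by (auto simp: sq_integrable_def power_mult_distrib)

lemma sq_integrable_add: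
  assumes "sq_integrable M f" "sq_integrable M g"
  shows "sq_integrable M (\<lambda>x. f x + g x)"
  using assms sq_integrable_mult[OF assms]
  by (auto simp: sq_integrable_def power2_sum mult.assoc)

lemma sq_integrable_diff:
  assumes "sq_integrable M f" "sq_integrable M g"
  shows "sq_integrable M (\<lambda>x. f x - g x)"
  using sq_integrable_add[OF assms(1) sq_integrable_scale[OF assms(2), of "-1"]] by simp

lemma sq_integrable_zero: "sq_integrable M (\<lambda>_. 0)"
  by (simp add: sq_integrable_def)

lemma sq_integrable_bound:
  assumes "sq_integrable M f" "g \<in> borel_measurable M" "AE x in M. \<bar>g x\<bar> \<le> \<bar>f x\<bar>"
  shows "sq_integrable M g" "(\<integral>x. (g x)\<^sup>2 \<partial>M) \<le> (\<integral>x. (f x)\<^sup>2 \<partial>M)"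
proof -
  have le: "AE x in M. (g x)\<^sup>2 \<le> (f x)\<^sup>2"
    using assms(3) by eventually_elim (simp add: abs_le_square_iff)
  have "integrable M (\<lambda>x. (g x)\<^sup>2)"
    by (rule Bochner_Integration.integrable_bound[where f="\<lambda>x. (f x)\<^sup>2"])
      (use assms le in \<open>auto simp: sq_integrable_def\<close>)
  with assms le show "sq_integrable M g" "(\<integral>x. (g x)\<^sup>2 \<partial>M) \<le> (\<integral>x. (f x)\<^sup>2 \<partial>M)"
    by (auto simp: sq_integrable_def intro!: integral_mono_AE)
qed

lemma sq_integrable_indicator:
  assumes "A \<in> sets M" "emeasure M A < \<infinity>"
  shows "sq_integrable M (indicator A)"
proof -
  have "(\<lambda>x. (indicator A x :: real)\<^sup>2) = indicator A" by (auto simp: indicator_def)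
  then show ?thesis using assms by (simp add: sq_integrable_def less_top)
qed

text \<open>Discriminant argument: \<open>q\<close> states that a quadratic form in
  \<open>(t,u)\<close> is non-negative, and its value at \<open>(-P, F)\<close> is
  \<open>F * (F * G - P^2)\<close>.\<close>

lemma integral_Cauchy_Schwarz:
  assumes "sq_integrable M f" "sq_integrable M g"
  shows "(\<integral>x. f x * g x \<partial>M)\<^sup>2 \<le> (\<integral>x. (f x)\<^sup>2 \<partial>M) * (\<integral>x. (g x)\<^sup>2 \<partial>M)"
proof -
  let ?F = "\<integral>x. (f x)\<^sup>2 \<partial>M" and ?G = "\<integral>x. (g x)\<^sup>2 \<partial>M" and ?P = "\<integral>x. f x * g x \<partial>M"
  have F: "integrable M (\<lambda>x. (f x)\<^sup>2)" "integrable M (\<lambda>x. (g x)\<^sup>2)"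
    and P: "integrable M (\<lambda>x. f x * g x)"
    using assms sq_integrable_mult by (auto simp: sq_integrable_def)
  have q: "0 \<le> t\<^sup>2 * ?F + u\<^sup>2 * ?G + 2 * t * u * ?P" for t u
  proof -
    have "0 \<le> (\<integral>x. (t * f x + u * g x)\<^sup>2 \<partial>M)" by simp
    also have "(\<lambda>x. (t * f x + u * g x)\<^sup>2)
        = (\<lambda>x. t\<^sup>2 * (f x)\<^sup>2 + u\<^sup>2 * (g x)\<^sup>2 + (2 * t * u) * (f x * g x))"
      by (auto simp: power2_sum power_mult_distrib algebra_simps)
    finally show ?thesis using F P by simp
  qed
  show ?thesis
  proof (cases "?F = 0")
    case True
    have "?P = 0"
    proof (rule ccontr)
      assume "?P \<noteq> 0"
      \<comment> \<open>For \<open>F = 0\<close> and \<open>u = 1\<close> the form is affine in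
        \<open>t\<close>; this \<open>t\<close> is chosen to give it the value -1.\<close>
      have "0 \<le> ?G + 2 * (- (?G + 1) / (2 * ?P)) * ?P"
        using q[of "- (?G + 1) / (2 * ?P)" 1] True by simp
      then show False using \<open>?P \<noteq> 0\<close> by (simp add: field_simps)
    qed
    with True show ?thesis by simp
  next
    case False
    moreover have "0 \<le> ?F" by simp
    ultimately have "0 < ?F" by linarith
    have "0 \<le> ?F * (?F * ?G - ?P\<^sup>2)"
      using q[of "- ?P" ?F] by (simp add: power2_eq_square algebra_simps)
    then show ?thesis using \<open>0 < ?F\<close> by (simp add: zero_le_mult_iff)
  qed
qed

text \<open>By Fatou's lemma, applied to \<open>F n - F (r k)\<close> as \<open>k\<close> grows.\<close>

lemma mean_square_limit:
  fixes F :: "nat \<Rightarrow> 'a \<Rightarrow> real"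
  assumes F: "\<And>n. sq_integrable M (F n)" and f: "f \<in> borel_measurable M"
    and cau: "\<And>e. e > 0 \<Longrightarrow> \<exists>N. \<forall>n\<ge>N. \<forall>k\<ge>N. (\<integral>x. (F n x - F k x)\<^sup>2 \<partial>M) < e"
    and r: "strict_mono (r :: nat \<Rightarrow> nat)"
    and lim: "AE x in M. (\<lambda>k. F (r k) x) \<longlonglongrightarrow> f x"
  shows "sq_integrable M f" "(\<lambda>n. \<integral>x. (F n x - f x)\<^sup>2 \<partial>M) \<longlonglongrightarrow> 0"
proof -
  have [measurable]: "\<And>n. F n \<in> borel_measurable M" "f \<in> borel_measurable M"
    using F f by (auto simp: sq_integrable_def)
  have bnd: "(\<integral>\<^sup>+x. ennreal ((F n x - f x)\<^sup>2) \<partial>M) \<le> ennreal e"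
    if e: "e > 0" and N: "\<forall>n\<ge>N. \<forall>k\<ge>N. (\<integral>x. (F n x - F k x)\<^sup>2 \<partial>M) < e" and n: "n \<ge> N" for e N n
  proof -
    have "(\<integral>\<^sup>+x. ennreal ((F n x - f x)\<^sup>2) \<partial>M)
        = (\<integral>\<^sup>+x. liminf (\<lambda>k. ennreal ((F n x - F (r k) x)\<^sup>2)) \<partial>M)"
    proof (rule nn_integral_cong_AE)
      show "AE x in M. ennreal ((F n x - f x)\<^sup>2) = liminf (\<lambda>k. ennreal ((F n x - F (r k) x)\<^sup>2))"
        using lim
      proof eventually_elim
        case (elim x)
        have "(\<lambda>k. ennreal ((F n x - F (r k) x)\<^sup>2)) \<longlonglongrightarrow> ennreal ((F n x - f x)\<^sup>2)"
          by (intro tendsto_ennrealI tendsto_power tendsto_diff elim) auto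
        then show ?case by (rule lim_imp_Liminf[symmetric, OF sequentially_bot])
      qed
    qed
    also have "\<dots> \<le> liminf (\<lambda>k. \<integral>\<^sup>+x. ennreal ((F n x - F (r k) x)\<^sup>2) \<partial>M)"
      by (rule nn_integral_liminf) auto
    also have "\<dots> \<le> ennreal e"
    proof (rule Liminf_le)
      show "\<forall>\<^sub>F k in sequentially. (\<integral>\<^sup>+x. ennreal ((F n x - F (r k) x)\<^sup>2) \<partial>M) \<le> ennreal e"
        using eventually_ge_at_top[of N]
      proof eventually_elim
        case (elim k)
        have "r k \<ge> N" using seq_suble[OF r, of k] elim by simp
        moreover have "integrable M (\<lambda>x. (F n x - F (r k) x)\<^sup>2)"
          using sq_integrable_diff[OF F F] by (auto simp: sq_integrable_def)
        ultimately show ?case using N n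
          by (subst nn_integral_eq_integral) (auto intro!: ennreal_leI order_less_imp_le[of "integral\<^sup>L M _"])
      qed
    qed auto
    finally show ?thesis .
  qed
  have int: "integrable M (\<lambda>x. (F n x - f x)\<^sup>2) \<and> (\<integral>x. (F n x - f x)\<^sup>2 \<partial>M) \<le> e"
    if "e > 0" and "\<forall>n\<ge>N. \<forall>k\<ge>N. (\<integral>x. (F n x - F k x)\<^sup>2 \<partial>M) < e" and "n \<ge> N" for e N n
  proof
    note b = bnd[OF that]
    show *: "integrable M (\<lambda>x. (F n x - f x)\<^sup>2)"
      by (rule integrableI_nonneg) (use le_less_trans[OF b] in auto)
    show "(\<integral>x. (F n x - f x)\<^sup>2 \<partial>M) \<le> e"
      using b \<open>e > 0\<close> by (subst (asm) nn_integral_eq_integral[OF *]) auto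
  qed
  show "(\<lambda>n. \<integral>x. (F n x - f x)\<^sup>2 \<partial>M) \<longlonglongrightarrow> 0"
  proof (rule LIMSEQ_I)
    fix e :: real assume "e > 0"
    then have "e/2 > 0" by simp
    from cau[OF this] obtain N
      where N: "\<forall>n\<ge>N. \<forall>k\<ge>N. (\<integral>x. (F n x - F k x)\<^sup>2 \<partial>M) < e/2" by auto
    have "norm ((\<integral>x. (F n x - f x)\<^sup>2 \<partial>M) - 0) < e" if "n \<ge> N" for n
      using int[OF \<open>e/2 > 0\<close> N that] \<open>e > 0\<close> by simp
    then show "\<exists>N. \<forall>n\<ge>N. norm ((\<integral>x. (F n x - f x)\<^sup>2 \<partial>M) - 0) < e" by auto
  qed
  from cau[of 1] obtain N where "\<forall>n\<ge>N. \<forall>k\<ge>N. (\<integral>x. (F n x - F k x)\<^sup>2 \<partial>M) < 1" by auto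
  from int[OF _ this, of N] have "sq_integrable M (\<lambda>x. F N x - f x)" by (simp add: sq_integrable_def)
  from sq_integrable_diff[OF F[of N] this] show "sq_integrable M f" by simp
qed

text \<open>Riesz--Fischer: a fast subsequence converges almost everywhere, and
  \<open>mean_square_limit\<close> carries the convergence back to the whole sequence.\<close>

lemma mean_square_complete:
  fixes F :: "nat \<Rightarrow> 'a \<Rightarrow> real"
  assumes F: "\<And>n. sq_integrable M (F n)"
    and cau: "\<And>e. e > 0 \<Longrightarrow> \<exists>N. \<forall>n\<ge>N. \<forall>k\<ge>N. (\<integral>x. (F n x - F k x)\<^sup>2 \<partial>M) < e"
  obtains f where "sq_integrable M f" "(\<lambda>n. \<integral>x. (F n x - f x)\<^sup>2 \<partial>M) \<longlonglongrightarrow> 0"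
proof -
  have [measurable]: "\<And>n. F n \<in> borel_measurable M"
    using F by (auto simp: sq_integrable_def)
  \<comment> \<open>The rate 1/8 leaves room for the weight \<open>4^j\<close>: the weighted squared
    increments still have integrals below \<open>(1/2)^j\<close>, which are summable, while the
    weight makes the increments themselves smaller than \<open>(1/2)^j\<close> eventually.\<close>
  have "\<exists>N. \<forall>n\<ge>N. \<forall>k\<ge>N. (\<integral>x. (F n x - F k x)\<^sup>2 \<partial>M) < (1/8)^j" for j :: nat
    by (rule cau) simp
  then obtain N where N: "\<And>j n k. n \<ge> N j \<Longrightarrow> k \<ge> N j \<Longrightarrow> (\<integral>x. (F n x - F k x)\<^sup>2 \<partial>M) < (1/8)^j"
    by metis
  \<comment> \<open>The maximum with the successor makes \<open>r\<close> strictly increasing, the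
    one with \<open>N\<close> keeps the rate.\<close>
  define r where "r = rec_nat (N 0) (\<lambda>j m. max (Suc m) (N (Suc j)))"
  have r_Suc: "r (Suc j) = max (Suc (r j)) (N (Suc j))" for j by (simp add: r_def)
  have rN: "r j \<ge> N j" for j by (cases j) (simp_all add: r_def)
  have "r j < r (Suc j)" for j by (simp add: r_Suc less_max_iff_disj)
  then have r: "strict_mono r" by (simp add: strict_mono_Suc_iff)
  define d where "d j x = (F (r (Suc j)) x - F (r j) x)\<^sup>2" for j x
  have [measurable]: "\<And>j. d j \<in> borel_measurable M" unfolding d_def by measurable
  have dint: "(\<integral>\<^sup>+x. ennreal (4^j * d j x) \<partial>M) \<le> ennreal ((1/2)^j)" for j
  proof -
    have i: "integrable M (d j)"
      using sq_integrable_diff[OF F F] unfolding d_def sq_integrable_def by auto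
    have "r (Suc j) \<ge> N j" using rN[of j] r_Suc[of j] by simp
    then have "(\<integral>x. d j x \<partial>M) \<le> (1/8)^j"
      unfolding d_def using N[OF _ rN] by (intro less_imp_le)
    then have "(\<integral>x. 4^j * d j x \<partial>M) \<le> 4^j * (1/8)^j" by simp
    also have "\<dots> = (1/2)^j" unfolding power_mult_distrib[symmetric] by simp
    finally show ?thesis
      using i by (subst nn_integral_eq_integral) (auto simp: d_def[abs_def] intro!: ennreal_leI)
  qed
  have "(\<integral>\<^sup>+x. (\<Sum>j. ennreal (4^j * d j x)) \<partial>M) = (\<Sum>j. \<integral>\<^sup>+x. ennreal (4^j * d j x) \<partial>M)"
    by (rule nn_integral_suminf) auto
  also have "\<dots> \<le> (\<Sum>j. ennreal ((1/2)^j))"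
    by (rule suminf_le[OF dint]) auto
  also have "\<dots> = ennreal (\<Sum>j. (1/2)^j)"
    by (rule suminf_ennreal_eq) (auto intro!: summable_sums summable_geometric)
  finally have "(\<integral>\<^sup>+x. (\<Sum>j. ennreal (4^j * d j x)) \<partial>M) \<noteq> \<infinity>"
    by (auto simp: top_unique)
  then have "AE x in M. (\<Sum>j. ennreal (4^j * d j x)) \<noteq> \<infinity>"
    by (intro nn_integral_PInf_AE) auto
  then have conv: "AE x in M. convergent (\<lambda>j. F (r j) x)"
  proof eventually_elim
    case (elim x)
    then have "summable (\<lambda>j. 4^j * d j x)"
      by (intro summable_suminf_not_top) (auto simp: d_def)
    then have "(\<lambda>j. 4^j * d j x) \<longlonglongrightarrow> 0" by (rule summable_LIMSEQ_zero)
    then have "\<forall>\<^sub>F j in sequentially. 4^j * d j x < 1" by (rule order_tendstoD) simp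
    then have "\<forall>\<^sub>F j in sequentially. norm (F (r (Suc j)) x - F (r j) x) \<le> (1/2)^j"
    proof eventually_elim
      case (elim j)
      then have "(2^j * (F (r (Suc j)) x - F (r j) x))\<^sup>2 \<le> 1\<^sup>2"
        by (simp add: d_def power_mult_distrib power_even_eq[symmetric] mult.commute[of j] power_mult)
      then have "\<bar>2^j * (F (r (Suc j)) x - F (r j) x)\<bar> \<le> 1"
        by (simp add: abs_square_le_1)
      then have "2^j * \<bar>F (r (Suc j)) x - F (r j) x\<bar> \<le> 1" by (simp only: abs_mult) simp
      then show ?case by (simp add: field_simps power_divide)
    qed
    then have "summable (\<lambda>j. F (r (Suc j)) x - F (r j) x)"
      by (rule summable_comparison_test_ev) (simp add: summable_geometric)
    then have "convergent (\<lambda>n. \<Sum>j<n. F (r (Suc j)) x - F (r j) x)"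
      by (simp add: summable_iff_convergent)
    then have "convergent (\<lambda>n. F (r n) x - F (r 0) x)"
      by (subst (asm) sum_lessThan_telescope)
    from convergent_add[OF this convergent_const[of "F (r 0) x"]] show ?case by simp
  qed
  define f where "f x = lim (\<lambda>j. F (r j) x)" for x
  have fm: "f \<in> borel_measurable M" unfolding f_def by measurable
  have "AE x in M. (\<lambda>j. F (r j) x) \<longlonglongrightarrow> f x"
    using conv by eventually_elim (simp add: f_def convergent_LIMSEQ_iff)
  from mean_square_limit[OF F fm cau r this] show thesis by (intro that) 
qed

section \<open>Primitives of square integrable functions\<close>

text \<open>Signed kernel of the oriented integral from 0 to \<open>z\<close>. One formula for both
  signs of \<open>z\<close> makes primitives plain integrals against a square integrable kernel, and
  the half-open convention turns differences of kernels into indicators of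
  \<open>(a,b]\<close>.\<close>

definition ker :: "real \<Rightarrow> real \<Rightarrow> real" where
  "ker z y = (if 0 < y \<and> y \<le> z then 1 else if z < y \<and> y \<le> 0 then -1 else 0)"

definition prim :: "(real \<Rightarrow> real) \<Rightarrow> real \<Rightarrow> real" where
  "prim G z = (\<integral>y. ker z y * G y \<partial>lborel)"

lemma ker_eq: "ker z y = indicator {0<..z} y - indicator {z<..0} y"
  by (auto simp: ker_def indicator_def)

lemma ker_diff: "a \<le> b \<Longrightarrow> ker b y - ker a y = indicator {a<..b} y"
  by (auto simp: ker_def indicator_def)

lemma ker_measurable [measurable]: "ker z \<in> borel_measurable borel"
  unfolding ker_eq[abs_def] by measurable

lemma sq_integrable_interval: "sq_integrable lborel (indicator {a<..b::real})"
  by (rule sq_integrable_indicator) (cases "a \<le> b"; simp)+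

lemma ker_sq_integrable: "sq_integrable lborel (ker z)"
  unfolding ker_eq[abs_def] by (intro sq_integrable_diff sq_integrable_interval)

lemma ker_integrable: "sq_integrable lborel G \<Longrightarrow> integrable lborel (\<lambda>y. ker z y * G y)"
  by (rule sq_integrable_mult[OF ker_sq_integrable])

lemma prim_0 [simp]: "prim G 0 = 0"
proof -
  have "ker 0 = (\<lambda>_. 0)" by (auto simp: ker_def)
  then show ?thesis by (simp add: prim_def)
qed

lemma prim_diff:
  assumes "sq_integrable lborel G" "a \<le> b"
  shows "prim G b - prim G a = (\<integral>y. indicator {a<..b} y * G y \<partial>lborel)"
  unfolding prim_def ker_diff[OF assms(2), symmetric]
  by (simp add: left_diff_distrib ker_integrable[OF assms(1)])

text \<open>Cauchy--Schwarz against the indicator of the interval. This estimate gives continuity of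
  primitives, control of the additive constants and pointwise convergence of boundary
  values.\<close>

lemma prim_diff_bound:
  assumes "sq_integrable lborel G"
  shows "(prim G b - prim G a)\<^sup>2 \<le> \<bar>b - a\<bar> * (\<integral>y. (G y)\<^sup>2 \<partial>lborel)"
proof -
  have *: "(prim G b - prim G a)\<^sup>2 \<le> \<bar>b - a\<bar> * (\<integral>y. (G y)\<^sup>2 \<partial>lborel)" if "a \<le> b" for a b
  proof -
    have "(\<lambda>y. (indicator {a<..b} y :: real)\<^sup>2) = indicator {a<..b}" by (auto simp: indicator_def)
    then have "(\<integral>y. (indicator {a<..b} y :: real)\<^sup>2 \<partial>lborel) = b - a" using that by simp
    then show ?thesis
      using integral_Cauchy_Schwarz[OF sq_integrable_interval[of a b] assms] that
      unfolding prim_diff[OF assms that] by simp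
  qed
  show ?thesis using *[of a b] *[of b a] by (cases "a \<le> b") (auto simp: power2_commute abs_minus_commute)
qed

lemma prim_continuous:
  assumes "sq_integrable lborel G"
  shows "continuous_on UNIV (prim G)"
proof -
  let ?C = "\<integral>y. (G y)\<^sup>2 \<partial>lborel"
  have "isCont (prim G) a" for a
    unfolding isCont_def
  proof (rule LIM_imp_LIM[where l=0 and f = "\<lambda>b. sqrt (\<bar>b - a\<bar> * ?C)"])
    show "(\<lambda>b. sqrt (\<bar>b - a\<bar> * ?C)) \<midarrow>a\<rightarrow> 0"
      by (rule tendsto_eq_intros | simp)+
    fix b 
    have "\<bar>prim G b - prim G a\<bar> \<le> sqrt (\<bar>b - a\<bar> * ?C)"
      using prim_diff_bound[OF assms, of b a] by (intro real_le_rsqrt) simp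
    then show "norm (prim G b - prim G a) \<le> norm (sqrt (\<bar>b - a\<bar> * ?C) - 0)" by simp
  qed
  then show ?thesis by (simp add: continuous_on_eq_continuous_at)
qed

lemma prim_add:
  assumes "sq_integrable lborel G" "sq_integrable lborel H"
  shows "prim (\<lambda>y. G y + H y) z = prim G z + prim H z"
  unfolding prim_def using assms by (simp add: distrib_left ker_integrable)

lemma prim_diff_fun:
  assumes "sq_integrable lborel G" "sq_integrable lborel H"
  shows "prim (\<lambda>y. G y - H y) z = prim G z - prim H z"
  unfolding prim_def using assms by (simp add: right_diff_distrib ker_integrable)

lemma prim_scale: "prim (\<lambda>y. c * G y) z = c * prim G z"
  unfolding prim_def by (simp add: mult.left_commute)

section \<open>Functions with dominated increments\<close>

lemma intv_eq_einterval: "intv l r = einterval l r"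
  by (simp add: intv_def einterval_def)

text \<open>The measures may be infinite near the ends of the interval, so they are compared on an
  exhausting sequence \<open>(v i, u i]\<close>, where they are finite and determined by
  half-lines.\<close>

lemma measure_eqI_intv:
  assumes M: "sets M = sets borel" and N: "sets N = sets borel"
    and l: "l < r"
    and M0: "emeasure M (- intv l r) = 0" and N0: "emeasure N (- intv l r) = 0"
    and fin: "\<And>a b. a \<in> intv l r \<Longrightarrow> b \<in> intv l r \<Longrightarrow> a \<le> b \<Longrightarrow> emeasure M {a<..b} < \<infinity>"
    and eq: "\<And>a b. a \<in> intv l r \<Longrightarrow> b \<in> intv l r \<Longrightarrow> a \<le> b \<Longrightarrow> emeasure M {a<..b} = emeasure N {a<..b}"
  shows "M = N"
proof -
  obtain u v :: "nat \<Rightarrow> real" where uv: "incseq u" "decseq v" "\<And>i. v i < u i" "\<And>i. l < v i" "\<And>i. u i < r"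
      "(\<lambda>i. ereal (v i)) \<longlonglongrightarrow> l" "(\<lambda>i. ereal (u i)) \<longlonglongrightarrow> r"
    by (rule einterval_Icc_approximation[OF l]) blast
  have mem: "v i \<in> intv l r" "u i \<in> intv l r" for i
    using uv(3)[of i] uv(4)[of i] uv(5)[of i] unfolding intv_def
    by (auto intro: less_trans[of l "ereal (v i)"] less_trans[of "ereal (v i)" "ereal (u i)"])
  have Un: "(\<Union>i. {v i<..u i}) = intv l r"
  proof (intro set_eqI iffI)
    fix x assume "x \<in> (\<Union>i. {v i<..u i})"
    then obtain i where "v i < x" "x \<le> u i" by auto
    then have "ereal (v i) < ereal x" "ereal x \<le> ereal (u i)" by auto
    with uv(4)[of i] uv(5)[of i] show "x \<in> intv l r"
      unfolding intv_def using less_trans le_less_trans by blast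
  next
    fix x assume x: "x \<in> intv l r"
    then have "\<forall>\<^sub>F i in sequentially. ereal (v i) < ereal x \<and> ereal x < ereal (u i)"
      using uv(6,7) by (auto simp: intv_def intro!: eventually_conj dest: order_tendstoD)
    then obtain i where "v i < x \<and> x < u i" by (auto simp: eventually_sequentially)
    then show "x \<in> (\<Union>i. {v i<..u i})" by (auto intro!: exI[of _ i])
  qed
  have open_intv: "open (intv l r)" by (simp add: intv_eq_einterval)
  have inc: "incseq (\<lambda>i. {v i<..u i})"
    using uv(1,2) unfolding incseq_def decseq_def by (fastforce intro: le_less_trans order_trans)
  have dens: "emeasure (density K (indicator B)) A = emeasure K (A \<inter> B)"
    if "sets K = sets borel" "A \<in> sets borel" "B \<in> sets borel" for K :: "real measure" and A B
  proof -
    have [measurable_cong]: "sets K = sets borel" by fact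
    have "emeasure (density K (indicator B)) A = (\<integral>\<^sup>+x. indicator B x * indicator A x \<partial>K)"
      using that by (subst emeasure_density) auto
    also have "\<dots> = (\<integral>\<^sup>+x. indicator (A \<inter> B) x \<partial>K)"
      by (rule nn_integral_cong) (auto simp: indicator_def)
    also have "\<dots> = emeasure K (A \<inter> B)"
      using that by (intro nn_integral_indicator) auto
    finally show ?thesis .
  qed
  have eq_i: "emeasure M (A \<inter> {v i<..u i}) = emeasure N (A \<inter> {v i<..u i})"
    if A: "A \<in> sets borel" for A i
  proof -
    have "density M (indicator {v i<..u i}) = density N (indicator {v i<..u i})"
    proof (rule measure_eqI_lessThan)
      show "sets (density M (indicator {v i<..u i})) = sets borel" using M by simp
      show "sets (density N (indicator {v i<..u i})) = sets borel" using N by simp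
    next
      fix x
      have I: "{x<..} \<inter> {v i<..u i} = {max (v i) x<..u i}" by auto
      have e: "emeasure (density K (indicator {v i<..u i})) {x<..} = emeasure K {max (v i) x<..u i}"
        if "sets K = sets borel" for K :: "real measure"
        using that by (simp add: dens I)
      have "emeasure M {max (v i) x<..u i} = emeasure N {max (v i) x<..u i} \<and>
          emeasure M {max (v i) x<..u i} < \<infinity>"
      proof (cases "max (v i) x \<le> u i")
        case True
        have "max (v i) x \<in> intv l r"
        proof -
          have "ereal (v i) \<le> ereal (max (v i) x)" "ereal (max (v i) x) \<le> ereal (u i)"
            using True by auto
          then show ?thesis using uv(4)[of i] uv(5)[of i]
            unfolding intv_def using less_le_trans le_less_trans by blast
        qed
        then show ?thesis using eq fin mem True by simp
      next
        case False
        then have "{max (v i) x<..u i} = {}" by auto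
        then show ?thesis by (simp only: emeasure_empty) simp
      qed
      then show "emeasure (density M (indicator {v i<..u i})) {x<..} < \<infinity>"
        "emeasure (density M (indicator {v i<..u i})) {x<..} =
          emeasure (density N (indicator {v i<..u i})) {x<..}"
        unfolding e[OF M] e[OF N] by auto
    qed
    then have "emeasure (density M (indicator {v i<..u i})) A = emeasure (density N (indicator {v i<..u i})) A"
      by simp
    then show ?thesis using A by (simp add: dens M N)
  qed
  have full: "emeasure K A = (SUP i. emeasure K (A \<inter> {v i<..u i}))"
    if K: "sets K = sets borel" and K0: "emeasure K (- intv l r) = 0" and A: "A \<in> sets borel"
    for K :: "real measure" and A
  proof -
    have "emeasure K A = emeasure K (A - (- intv l r))"
      using K K0 A open_intv by (intro emeasure_Diff_null_set[symmetric]) (auto simp: null_sets_def)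
    also have "A - (- intv l r) = (\<Union>i. A \<inter> {v i<..u i})" using Un by blast
    also have "emeasure K \<dots> = (SUP i. emeasure K (A \<inter> {v i<..u i}))"
      using A K inc by (intro SUP_emeasure_incseq[symmetric]) (auto simp: incseq_def subset_eq)
    finally show ?thesis .
  qed
  show ?thesis
    using M N full[OF M M0] full[OF N N0] eq_i by (intro measure_eqI) auto
qed

text \<open>The two increasing functions \<open>prim \<bar>G\<bar> \<plusminus> u\<close> have Stieltjes measures that add up to
  \<open>2 \<bar>G\<bar>\<close> times Lebesgue measure, so both have densities, and half the difference of the
  densities is a derivative of \<open>u\<close>.\<close>

lemma primitive_of_dominated_increments:
  assumes G: "sq_integrable lborel G"
    and dom: "\<And>a b. \<bar>u b - u a\<bar> \<le> \<bar>prim G b - prim G a\<bar>"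
  obtains K where "sq_integrable lborel K" "AE y in lborel. \<bar>K y\<bar> \<le> \<bar>G y\<bar>"
    "\<And>z. u z = u 0 + prim K z"
proof -
  have [measurable]: "G \<in> borel_measurable borel" using G by (simp add: sq_integrable_def)
  have absG: "sq_integrable lborel (\<lambda>y. \<bar>G y\<bar>)" using G by (simp add: sq_integrable_def)
  define v where "v = prim (\<lambda>y. \<bar>G y\<bar>)"
  have v_diff: "v b - v a = (\<integral>y. indicator {a<..b} y * \<bar>G y\<bar> \<partial>lborel)" if "a \<le> b" for a b
    unfolding v_def by (rule prim_diff[OF absG that])
  have int_G: "integrable lborel (\<lambda>y. indicator {a<..b} y * \<bar>G y\<bar>)" for a b
    by (rule sq_integrable_mult[OF sq_integrable_interval absG])
  have u_le: "\<bar>u b - u a\<bar> \<le> v b - v a" if "a \<le> b" for a b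
  proof -
    have "\<bar>u b - u a\<bar> \<le> \<bar>\<integral>y. indicator {a<..b} y * G y \<partial>lborel\<bar>"
      using dom[of b a] prim_diff[OF G that] by simp
    also have "\<dots> \<le> (\<integral>y. \<bar>indicator {a<..b} y * G y\<bar> \<partial>lborel)"
      by (rule integral_abs_bound)
    finally show ?thesis by (simp add: v_diff[OF that] abs_mult)
  qed
  have v_cont: "isCont v a" for a
    using prim_continuous[OF absG] by (simp add: v_def continuous_on_eq_continuous_at)
  have u_cont: "isCont u a" for a
    unfolding isCont_def
  proof (rule LIM_imp_LIM)
    show "prim G \<midarrow>a\<rightarrow> prim G a"
      using prim_continuous[OF G] by (simp add: continuous_on_eq_continuous_at isCont_def)
  qed (use dom in auto)
  have mono: "v a + u a \<le> v b + u b" "v a - u a \<le> v b - u b" if "a \<le> b" for a b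
    using u_le[OF that] by linarith+
  have cont: "continuous (at_right a) (\<lambda>x. v x + u x)" "continuous (at_right a) (\<lambda>x. v x - u x)" for a
    by (rule continuous_add continuous_diff continuous_at_imp_continuous_at_within[OF u_cont]
        continuous_at_imp_continuous_at_within[OF v_cont])+
  define N where "N = interval_measure (\<lambda>x. v x + u x)"
  define N' where "N' = interval_measure (\<lambda>x. v x - u x)"
  have [measurable_cong, simp]: "sets N = sets borel" "sets N' = sets borel"
    by (simp_all add: N_def N'_def)
  have N: "emeasure N {a<..b} = ennreal ((v b + u b) - (v a + u a))"
    and N': "emeasure N' {a<..b} = ennreal ((v b - u b) - (v a - u a))" if "a \<le> b" for a b
    unfolding N_def N'_def
    by (rule emeasure_interval_measure_Ioc[OF that mono(1) cont(1)] emeasure_interval_measure_Ioc[OF that mono(2) cont(2)]; assumption)+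
  define P where "P = measure_of (space borel) (sets borel) (\<lambda>A. emeasure N A + emeasure N' A)"
  have sP [simp]: "sets P = sets borel"
    unfolding P_def by (rule sets.sets_measure_of_eq)
  have P: "emeasure P A = emeasure N A + emeasure N' A" if "A \<in> sets borel" for A :: "real set"
  proof (rule emeasure_measure_of[OF P_def])
    show "positive (sets P) (\<lambda>A. emeasure N A + emeasure N' A)" by (simp add: positive_def)
    show "countably_additive (sets P) (\<lambda>A. emeasure N A + emeasure N' A)"
    proof (rule countably_additiveI)
      fix A :: "nat \<Rightarrow> real set"
      assume A: "range A \<subseteq> sets P" "disjoint_family A"
      have "(\<Sum>i. emeasure N (A i) + emeasure N' (A i)) = (\<Sum>i. emeasure N (A i)) + (\<Sum>i. emeasure N' (A i))"
        by (rule suminf_add[symmetric]) auto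
      then show "(\<Sum>i. emeasure N (A i) + emeasure N' (A i)) = emeasure N (\<Union>i. A i) + emeasure N' (\<Union>i. A i)"
        using A by (simp add: suminf_emeasure)
    qed
    show "sets borel \<subseteq> Pow (space borel)" by (rule sets.space_closed)
    show "A \<in> sets P" using that by simp
  qed
  define g where "g y = ennreal (2 * \<bar>G y\<bar>)" for y
  have [measurable]: "g \<in> borel_measurable borel" unfolding g_def by measurable
  have "P = density lborel g"
  proof (rule measure_eqI_intv[of _ _ "-\<infinity>" \<infinity>])
    fix a b :: real assume "a \<le> b"
    have "emeasure P {a<..b} = ennreal (2 * (v b - v a))"
      using mono[OF \<open>a \<le> b\<close>] by (subst P) (auto simp: N N' \<open>a \<le> b\<close> ennreal_plus[symmetric] simp del: ennreal_plus)
    moreover have "emeasure (density lborel g) {a<..b} = (\<integral>\<^sup>+y. ennreal (2 * (indicator {a<..b} y * \<bar>G y\<bar>)) \<partial>lborel)"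
      by (subst emeasure_density) (auto simp: g_def indicator_def intro!: nn_integral_cong)
    moreover have "\<dots> = ennreal (2 * (v b - v a))"
    proof (subst nn_integral_eq_integral)
      show "integrable lborel (\<lambda>y. 2 * (indicator {a<..b} y * \<bar>G y\<bar>))" using int_G[of a b] by simp
      show "ennreal (\<integral>y. 2 * (indicator {a<..b} y * \<bar>G y\<bar>) \<partial>lborel) = ennreal (2 * (v b - v a))"
        by (simp add: v_diff[OF \<open>a \<le> b\<close>])
    qed simp
    ultimately show "emeasure P {a<..b} < \<infinity>" "emeasure P {a<..b} = emeasure (density lborel g) {a<..b}"
      by auto
  qed (auto simp: intv_def)
  \<comment> \<open>Each summand is below the sum, and the sum has a density; so Lebesgue null sets
    are null for both.\<close>
  have ac: "absolutely_continuous lborel K"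
    if "\<And>A :: real set. A \<in> sets borel \<Longrightarrow> emeasure K A \<le> emeasure P A" "sets K = sets borel" for K :: "real measure"
    unfolding absolutely_continuous_def
  proof
    fix A :: "real set" assume A: "A \<in> null_sets lborel"
    then have "emeasure P A = 0"
      unfolding \<open>P = density lborel g\<close> by (subst emeasure_density) (auto intro!: nn_integral_null_set)
    with that(1)[of A] that(2) A show "A \<in> null_sets K" by (auto simp: null_sets_def)
  qed
  have "absolutely_continuous lborel N" "absolutely_continuous lborel N'"
    by (auto intro!: ac simp: P add_increasing add_increasing2)
  then obtain k k' where [measurable]: "k \<in> borel_measurable borel" "k' \<in> borel_measurable borel"
      and k: "density lborel k = N" "density lborel k' = N'"
    using sigma_finite_measure.Radon_Nikodym[OF sigma_finite_lborel, of N] sigma_finite_measure.Radon_Nikodym[OF sigma_finite_lborel, of N'] by auto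
  have "density lborel (\<lambda>y. k y + k' y) = P"
    by (intro measure_eqI)
      (auto simp: P k(1)[symmetric] k(2)[symmetric] emeasure_density distrib_right nn_integral_add)
  then have "AE y in lborel. k y + k' y = g y"
    unfolding \<open>P = density lborel g\<close> by (subst (asm) sigma_finite_measure.density_unique_iff[OF sigma_finite_lborel]) auto
  then have kg: "AE y in lborel. k y \<le> ennreal (2 * \<bar>G y\<bar>)"
    by eventually_elim (metis g_def le_add1 add.commute le_iff_add)
  \<comment> \<open>Since the densities add up to \<open>2 |G|\<close>, half their difference is
    \<open>k - |G|\<close>. The bounds \<open>0\<close> and \<open>2 |G|\<close> for
    \<open>k\<close> give \<open>|K| \<le> |G|\<close>, and they make \<open>k\<close> finite almost
    everywhere, so that \<open>enn2real\<close> loses nothing.\<close>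
  define K where "K y = enn2real (k y) - \<bar>G y\<bar>" for y
  have [measurable]: "K \<in> borel_measurable borel" unfolding K_def by measurable
  have KG: "AE y in lborel. \<bar>K y\<bar> \<le> \<bar>G y\<bar>"
    using kg
  proof eventually_elim
    case (elim y)
    have "enn2real (k y) \<le> 2 * \<bar>G y\<bar>" using enn2real_mono[OF elim] by simp
    moreover have "0 \<le> enn2real (k y)" by simp
    ultimately show ?case unfolding K_def by linarith
  qed
  have Ksq: "sq_integrable lborel K" by (rule sq_integrable_bound[OF G _ KG]) simp
  have inc: "prim K b - prim K a = u b - u a" if ab: "a \<le> b" for a b
  proof -
    have "emeasure N {a<..b} = (\<integral>\<^sup>+y. ennreal (indicator {a<..b} y * enn2real (k y)) \<partial>lborel)"
    proof -
      have "AE y in lborel. k y = ennreal (enn2real (k y))"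
        using kg by eventually_elim (metis ennreal_enn2real ennreal_less_top le_less_trans)
      then show ?thesis
        unfolding k(1)[symmetric]
        by (subst emeasure_density) (auto intro!: nn_integral_cong_AE elim!: eventually_mono simp: indicator_def)
    qed
    then have e: "(\<integral>\<^sup>+y. ennreal (indicator {a<..b} y * enn2real (k y)) \<partial>lborel)
        = ennreal ((v b + u b) - (v a + u a))" using N[OF ab] by simp
    have "has_bochner_integral lborel (\<lambda>y. indicator {a<..b} y * enn2real (k y)) ((v b + u b) - (v a + u a))"
      by (rule has_bochner_integral_nn_integral[OF _ _ _ e]) (use mono[OF ab] in auto)
    then have "(\<integral>y. indicator {a<..b} y * enn2real (k y) - indicator {a<..b} y * \<bar>G y\<bar> \<partial>lborel)
        = ((v b + u b) - (v a + u a)) - (v b - v a)"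
      using int_G[of a b] v_diff[OF ab] by (subst Bochner_Integration.integral_diff)
        (auto simp: has_bochner_integral_iff)
    then show ?thesis
      unfolding prim_diff[OF Ksq ab] by (simp add: K_def right_diff_distrib)
  qed
  have "u z = u 0 + prim K z" for z
    using inc[of 0 z] inc[of z 0] by (cases "0 \<le> z") auto
  then show thesis by (rule that[OF Ksq KG])
qed

section \<open>The time change\<close>

text \<open>Integration against an image measure, with the restriction to \<open>A\<close> written
  as an indicator. In this way the integrals over different pieces live on one space and can be
  added.\<close>

lemma transport:
  fixes \<phi> :: "real \<Rightarrow> 'b" and g :: "'b \<Rightarrow> real"
  assumes A: "A \<in> sets borel" and \<phi>: "\<phi> \<in> restrict_space lborel A \<rightarrow>\<^sub>M N"
    and \<mu>: "\<mu> = distr (restrict_space lborel A) N \<phi>" and g: "g \<in> borel_measurable \<mu>"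
  shows "(\<lambda>y. indicator A y * g (\<phi> y)) \<in> borel_measurable borel"
    and "(\<integral>x. g x \<partial>\<mu>) = (\<integral>y. indicator A y * g (\<phi> y) \<partial>lborel)"
    and "integrable \<mu> g \<longleftrightarrow> integrable lborel (\<lambda>y. indicator A y * g (\<phi> y))"
proof -
  have g': "g \<in> borel_measurable N" using g by (simp add: \<mu>)
  have "(\<lambda>y. g (\<phi> y)) \<in> borel_measurable (restrict_space lborel A)"
    by (rule measurable_compose[OF \<phi> g'])
  then show "(\<lambda>y. indicator A y * g (\<phi> y)) \<in> borel_measurable borel"
    using A by (subst (asm) borel_measurable_restrict_space_iff) (auto simp: ac_simps)
  show "(\<integral>x. g x \<partial>\<mu>) = (\<integral>y. indicator A y * g (\<phi> y) \<partial>lborel)"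
    unfolding \<mu> using A by (subst integral_distr[OF \<phi> g'], subst integral_restrict_space) auto
  show "integrable \<mu> g \<longleftrightarrow> integrable lborel (\<lambda>y. indicator A y * g (\<phi> y))"
    unfolding \<mu> using A by (subst integrable_distr_eq[OF \<phi> g'], subst integrable_restrict_space) auto
qed

text \<open>Both orientations in a single kernel, the shape in which the integral can be matched
  with \<open>ker (s x)\<close> after the change of variables.\<close>

lemma int_open_eq:
  "int_open \<mu> g x = (\<integral>y. (if 0 < y \<and> y < x then 1 else if x \<le> y \<and> y < 0 then -1 else 0) * g y \<partial>\<mu>)"
proof (cases "0 \<le> x")
  case False
  have "- (\<integral>y. indicator {x..<0} y * g y \<partial>\<mu>) = (\<integral>y. - (indicator {x..<0} y * g y) \<partial>\<mu>)" by simp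
  also have "\<dots> = (\<integral>y. (if 0 < y \<and> y < x then 1 else if x \<le> y \<and> y < 0 then -1 else 0) * g y \<partial>\<mu>)"
    using False by (intro Bochner_Integration.integral_cong) (auto simp: indicator_def)
  finally show ?thesis using False by (simp add: int_open_def set_lebesgue_integral_def)
qed (auto simp: int_open_def set_lebesgue_integral_def indicator_def intro!: Bochner_Integration.integral_cong)

lemma int_closed_eq:
  "int_closed \<mu> g x = (\<integral>y. (if 0 < y \<and> y \<le> x then 1 else if x < y \<and> y < 0 then -1 else 0) * g y \<partial>\<mu>)"
proof (cases "0 \<le> x")
  case False
  have "- (\<integral>y. indicator {x<..<0} y * g y \<partial>\<mu>) = (\<integral>y. - (indicator {x<..<0} y * g y) \<partial>\<mu>)" by simp
  also have "\<dots> = (\<integral>y. (if 0 < y \<and> y \<le> x then 1 else if x < y \<and> y < 0 then -1 else 0) * g y \<partial>\<mu>)"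
    using False by (intro Bochner_Integration.integral_cong) (auto simp: indicator_def)
  finally show ?thesis using False by (simp add: int_closed_def set_lebesgue_integral_def)
qed (auto simp: int_closed_def set_lebesgue_integral_def indicator_def intro!: Bochner_Integration.integral_cong)

text \<open>Abstracts \<open>phi\<close> on the gaps above and below the values of \<open>s\<close>:
  a map with countably many values and Borel fibres, hence measurable even into the discrete
  space.\<close>

locale countable_fibres =
  fixes Q C :: "real set" and \<phi> :: "real \<Rightarrow> real"
  assumes countable: "countable C" and image: "\<phi> ` Q \<subseteq> C"
    and fibre [measurable]: "\<And>x. {y \<in> Q. \<phi> y = x} \<in> sets borel"
begin

lemma preimage_eq: "{y \<in> Q. \<phi> y \<in> A} = (\<Union>x\<in>C \<inter> A. {y \<in> Q. \<phi> y = x})"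
  using image by auto

lemma preimage [measurable]: "{y \<in> Q. \<phi> y \<in> A} \<in> sets borel"
  unfolding preimage_eq using countable by (intro sets.countable_UN') auto

lemma domain [measurable]: "Q \<in> sets borel"
  using preimage[of UNIV] by simp

lemma measurable: "\<phi> \<in> restrict_space lborel Q \<rightarrow>\<^sub>M count_space UNIV"
proof (rule measurableI)
  fix A :: "real set"
  have "\<phi> -` A \<inter> space (restrict_space lborel Q) = {y \<in> Q. \<phi> y \<in> A}"
    by (auto simp: space_restrict_space)
  then show "\<phi> -` A \<inter> space (restrict_space lborel Q) \<in> sets (restrict_space lborel Q)"
    by (auto simp: sets_restrict_space_iff)
qed simp

text \<open>Stated for any Borel measure: Lebesgue measure identifies the images, and densities with
  respect to it are used for summing an estimate over all fibres.\<close>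

lemma emeasure_preimage:
  assumes "sets \<nu> = sets borel"
  shows "emeasure \<nu> {y \<in> Q. \<phi> y \<in> A}
    = (\<integral>\<^sup>+x. emeasure \<nu> {y \<in> Q. \<phi> y = x} * indicator A x \<partial>count_space UNIV)"
proof -
  have "emeasure \<nu> {y \<in> Q. \<phi> y \<in> A} = (\<integral>\<^sup>+x. emeasure \<nu> {y \<in> Q. \<phi> y = x} \<partial>count_space (C \<inter> A))"
    unfolding preimage_eq using countable assms
    by (intro emeasure_UN_countable) (auto simp: disjoint_family_on_def)
  also have "\<dots> = (\<integral>\<^sup>+x. emeasure \<nu> {y \<in> Q. \<phi> y = x} * indicator (C \<inter> A) x \<partial>count_space UNIV)"
    by (rule nn_integral_count_space_indicator) simp
  also have "\<dots> = (\<integral>\<^sup>+x. emeasure \<nu> {y \<in> Q. \<phi> y = x} * indicator A x \<partial>count_space UNIV)"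
  proof (rule nn_integral_cong)
    fix x
    have "{y \<in> Q. \<phi> y = x} = {}" if "x \<notin> C" using that image by auto
    then show "emeasure \<nu> {y \<in> Q. \<phi> y = x} * indicator (C \<inter> A) x
        = emeasure \<nu> {y \<in> Q. \<phi> y = x} * indicator A x"
      by (cases "x \<in> C") (auto simp: indicator_def simp del: Collect_empty_eq)
  qed
  finally show ?thesis .
qed

lemma integral_zero_on_fibres:
  assumes F: "integrable lborel F"
    and z: "\<And>x. (\<integral>y. indicator {y \<in> Q. \<phi> y = x} y * F y \<partial>lborel) = 0"
  shows "(\<integral>y. indicator Q y * F y \<partial>lborel) = (0::real)"
proof -
  define A where "A i = {y \<in> Q. to_nat_on C (\<phi> y) = i}" for i
  have A: "A i = {y \<in> Q. \<phi> y = from_nat_into C i} \<or> A i = {}" for i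
  proof (cases "\<exists>y\<in>Q. to_nat_on C (\<phi> y) = i")
    case True
    then obtain y where "y \<in> Q" "to_nat_on C (\<phi> y) = i" by auto
    then have i: "i = to_nat_on C (\<phi> y)" "\<phi> y \<in> C" using image by auto
    have "to_nat_on C (\<phi> w) = i \<longleftrightarrow> \<phi> w = from_nat_into C i" if "w \<in> Q" for w
      using that image countable i by (auto simp: to_nat_on_inj)
    then show ?thesis unfolding A_def by auto
  qed (auto simp: A_def)
  have [measurable]: "A i \<in> sets borel" for i using A[of i] by auto
  have Q: "Q = (\<Union>i. A i)" by (auto simp: A_def)
  have "(LINT y:(\<Union>i. A i)|lborel. F y) = (\<Sum>i. LINT y:A i|lborel. F y)"
  proof (rule lebesgue_integral_countable_add)
    show "set_integrable lborel (\<Union>i. A i) F"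
      unfolding Q[symmetric] set_integrable_def using F by (intro integrable_mult_indicator) auto
    show "A i \<inter> A j = {}" if "i \<noteq> j" for i j using that by (auto simp: A_def)
  qed auto
  also have "\<dots> = 0"
  proof -
    have "(LINT y:A i|lborel. F y) = 0" for i
      using A[of i] z by (auto simp: set_lebesgue_integral_def)
    then show ?thesis by simp
  qed
  finally show ?thesis by (simp add: Q[symmetric] set_lebesgue_integral_def)
qed

end

section \<open>One-sided limits and jumps of the scale function\<close>

locale scale_function =
  fixes l r :: ereal and s :: "real \<Rightarrow> real"
  assumes lr: "l < 0" "0 < r"
    and s_mono: "mono_on (intv l r) s"
    and s0: "s 0 = 0" and s_cont0: "(s \<longlongrightarrow> 0) (at 0)"
begin

abbreviation "I \<equiv> intv l r"

lemma zero_in_I [simp]: "0 \<in> I"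
  using lr by (simp add: intv_def zero_ereal_def)

lemma open_I: "open I"
  by (simp add: intv_eq_einterval)

lemma I_between: "a \<in> I \<Longrightarrow> b \<in> I \<Longrightarrow> a \<le> x \<Longrightarrow> x \<le> b \<Longrightarrow> x \<in> I"
  unfolding intv_def by (auto intro: less_le_trans le_less_trans simp flip: ereal_less_eq(3))

lemma mono: "a \<in> I \<Longrightarrow> b \<in> I \<Longrightarrow> a \<le> b \<Longrightarrow> s a \<le> s b"
  using s_mono by (auto simp: mono_on_def)

lemma I_right: assumes "x \<in> I" obtains b where "b \<in> I" "x < b"
proof -
  have "ereal x < r" using assms by (simp add: intv_def)
  then obtain b where "ereal x < ereal b" "ereal b < r" using ereal_dense2 by blast
  then show thesis using assms by (intro that[of b]) (auto simp: intv_def intro: less_trans)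
qed

lemma I_left: assumes "x \<in> I" obtains b where "b \<in> I" "b < x"
proof -
  have "l < ereal x" using assms by (simp add: intv_def)
  then obtain b where "l < ereal b" "ereal b < ereal x" using ereal_dense2 by blast
  then show thesis using assms less_trans[of "ereal b" "ereal x" r]
    by (intro that[of b]) (auto simp: intv_def)
qed

text \<open>As a \<open>Lim\<close>, \<open>sR\<close> is meaningful only once a limit exists; by
  monotonicity it is the infimum of the values on the right. The last two parts state this as a
  greatest lower bound, the form in which it is compared with levels later.\<close>

lemma tendsto_sR:
  assumes x: "x \<in> I"
  shows "(s \<longlongrightarrow> sR s x) (at_right x)"
    and "s x \<le> sR s x"
    and "\<And>b. b \<in> I \<Longrightarrow> x < b \<Longrightarrow> sR s x \<le> s b"
    and "\<And>y. (\<And>b. b \<in> I \<Longrightarrow> x < b \<Longrightarrow> y \<le> s b) \<Longrightarrow> y \<le> sR s x"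
proof -
  let ?S = "s ` {b \<in> I. x < b}"
  obtain b0 where b0: "b0 \<in> I" "x < b0" using I_right[OF x] .
  have ne: "?S \<noteq> {}" using b0 by auto
  have bdd: "bdd_below ?S" using mono x by (intro bdd_belowI[of _ "s x"]) auto
  have lim: "(s \<longlongrightarrow> Inf ?S) (at_right x)"
  proof (rule order_tendstoI)
    fix a assume "a < Inf ?S"
    then have "a < s b" if "x < b" "b < b0" for b
      using that I_between[OF x b0(1), of b] cInf_lower[OF _ bdd, of "s b"] by fastforce
    then show "eventually (\<lambda>b. a < s b) (at_right x)"
      using b0 by (auto simp: eventually_at_right[OF b0(2)])
  next
    fix a assume "Inf ?S < a"
    then obtain b where b: "b \<in> I" "x < b" "s b < a" using cInf_lessD[OF ne] by auto
    have "s w < a" if "x < w" "w < b" for w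
      using mono[of w b] I_between[OF x b(1), of w] that b by auto
    then show "eventually (\<lambda>w. s w < a) (at_right x)"
      using b by (auto simp: eventually_at_right[OF b(2)])
  qed
  then have eq: "sR s x = Inf ?S" unfolding sR_def by (intro tendsto_Lim) auto
  show "(s \<longlongrightarrow> sR s x) (at_right x)" using lim eq by simp
  show "s x \<le> sR s x" unfolding eq using ne mono x by (intro cInf_greatest) auto
  show "\<And>b. b \<in> I \<Longrightarrow> x < b \<Longrightarrow> sR s x \<le> s b" unfolding eq using bdd by (intro cInf_lower) auto
  show "\<And>y. (\<And>b. b \<in> I \<Longrightarrow> x < b \<Longrightarrow> y \<le> s b) \<Longrightarrow> y \<le> sR s x"
    unfolding eq using ne by (intro cInf_greatest) auto
qed

lemma tendsto_sL:
  assumes x: "x \<in> I"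
  shows "(s \<longlongrightarrow> sL s x) (at_left x)"
    and "sL s x \<le> s x"
    and "\<And>b. b \<in> I \<Longrightarrow> b < x \<Longrightarrow> s b \<le> sL s x"
    and "\<And>y. (\<And>b. b \<in> I \<Longrightarrow> b < x \<Longrightarrow> s b \<le> y) \<Longrightarrow> sL s x \<le> y"
proof -
  let ?S = "s ` {b \<in> I. b < x}"
  obtain b0 where b0: "b0 \<in> I" "b0 < x" using I_left[OF x] .
  have ne: "?S \<noteq> {}" using b0 by auto
  have bdd: "bdd_above ?S" using mono x by (intro bdd_aboveI[of _ "s x"]) auto
  have lim: "(s \<longlongrightarrow> Sup ?S) (at_left x)"
  proof (rule order_tendstoI)
    fix a assume "Sup ?S < a"
    then have "s b < a" if "b0 < b" "b < x" for b
      using that I_between[OF b0(1) x, of b] cSup_upper[OF _ bdd, of "s b"] by fastforce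
    then show "eventually (\<lambda>b. s b < a) (at_left x)"
      using b0 by (auto simp: eventually_at_left[OF b0(2)])
  next
    fix a assume "a < Sup ?S"
    then obtain b where b: "b \<in> I" "b < x" "a < s b" using less_cSupD[OF ne] by auto
    have "a < s w" if "b < w" "w < x" for w
      using mono[of b w] I_between[OF b(1) x, of w] that b by auto
    then show "eventually (\<lambda>w. a < s w) (at_left x)"
      using b by (auto simp: eventually_at_left[OF b(2)])
  qed
  then have eq: "sL s x = Sup ?S" unfolding sL_def by (intro tendsto_Lim) auto
  show "(s \<longlongrightarrow> sL s x) (at_left x)" using lim eq by simp
  show "sL s x \<le> s x" unfolding eq using ne mono x by (intro cSup_least) auto
  show "\<And>b. b \<in> I \<Longrightarrow> b < x \<Longrightarrow> s b \<le> sL s x" unfolding eq using bdd by (intro cSup_upper) auto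
  show "\<And>y. (\<And>b. b \<in> I \<Longrightarrow> b < x \<Longrightarrow> s b \<le> y) \<Longrightarrow> sL s x \<le> y"
    unfolding eq using ne by (intro cSup_least) auto
qed

text \<open>Together with \<open>sL_0\<close>: no gap of the range lies over the origin, which
  excludes \<open>phi y = 0\<close> in the kernel identities for the jump parts.\<close>

lemma sR_0: "sR s 0 = 0"
  unfolding sR_def by (rule tendsto_Lim) (use s_cont0 in \<open>auto intro: tendsto_within_subset\<close>)

lemma sL_0: "sL s 0 = 0"
  unfolding sL_def by (rule tendsto_Lim) (use s_cont0 in \<open>auto intro: tendsto_within_subset\<close>)

lemma countable_Dp: "countable (Dp l r s)"
proof -
  have "sR s x = s x" if "isCont s x" for x
    unfolding sR_def using that by (intro tendsto_Lim) (auto simp: isCont_def intro: tendsto_within_subset)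
  then have "Dp l r s \<subseteq> {x \<in> I. \<not> isCont s x}" by (auto simp: Dp_def)
  then show ?thesis using mono_on_ctble_discont_open[OF open_I s_mono] countable_subset by blast
qed

lemma countable_Dm: "countable (Dm l r s)"
proof -
  have "sL s x = s x" if "isCont s x" for x
    unfolding sL_def using that by (intro tendsto_Lim) (auto simp: isCont_def intro: tendsto_within_subset)
  then have "Dm l r s \<subseteq> {x \<in> I. \<not> isCont s x}" by (auto simp: Dm_def)
  then show ?thesis using mono_on_ctble_discont_open[OF open_I s_mono] countable_subset by blast
qed

section \<open>The generalised inverse of the scale function and its fibres\<close>

definition J :: "real set" where
  "J = {y. \<exists>a\<in>I. \<exists>b\<in>I. s a < y \<and> y \<le> s b}"

text \<open>The left-continuous inverse. For \<open>y\<close> in \<open>J\<close> the infimum is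
  over a non-empty set bounded below by a point of \<open>I\<close>, so it is again in
  \<open>I\<close>; this is why \<open>J\<close> asks for a value strictly below \<open>y\<close>,
  at the cost of at most one level, the least value of \<open>s\<close>.\<close>

definition phi :: "real \<Rightarrow> real" where
  "phi y = Inf {x \<in> I. y \<le> s x}"

text \<open>Nearly a Galois connection with \<open>s\<close>. What it leaves open is how
  \<open>y\<close> compares with \<open>s x\<close> at \<open>x = phi y\<close>, because
  \<open>s\<close> need not be continuous from either side; \<open>Jc\<close>, \<open>Jp\<close> and
  \<open>Jm\<close> record the three answers.\<close>

lemma phi:
  assumes "y \<in> J"
  shows phi_in: "phi y \<in> I"
    and phi_le: "\<And>x. x \<in> I \<Longrightarrow> y \<le> s x \<Longrightarrow> phi y \<le> x"
    and phi_lessD: "\<And>x. x \<in> I \<Longrightarrow> phi y < x \<Longrightarrow> y \<le> s x"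
proof -
  let ?S = "{x \<in> I. y \<le> s x}"
  obtain a b where ab: "a \<in> I" "b \<in> I" "s a < y" "y \<le> s b" using assms by (auto simp: J_def)
  have lb: "a \<le> x" if "x \<in> ?S" for x
    using that ab mono[of x a] by (cases "a \<le> x") auto
  have ne: "?S \<noteq> {}" and bdd: "bdd_below ?S" using ab lb by (blast, intro bdd_belowI)
  show le: "\<And>x. x \<in> I \<Longrightarrow> y \<le> s x \<Longrightarrow> phi y \<le> x"
    unfolding phi_def using bdd by (intro cInf_lower) auto
  have "a \<le> phi y" unfolding phi_def using ne lb by (intro cInf_greatest) auto
  then show "phi y \<in> I" by (rule I_between[OF ab(1,2) _ le[OF ab(2,4)]])
  fix x assume "x \<in> I" "phi y < x"
  then obtain w where "w \<in> I" "y \<le> s w" "w < x"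
    unfolding phi_def using cInf_lessD[OF ne] by auto
  with \<open>x \<in> I\<close> show "y \<le> s x" using mono[of w x] by auto
qed

lemma phi_bounds:
  assumes "y \<in> J"
  shows "sL s (phi y) \<le> y" "y \<le> sR s (phi y)"
proof -
  show "y \<le> sR s (phi y)"
    using phi_lessD[OF assms] by (intro tendsto_sR(4) phi_in assms) auto
  show "sL s (phi y) \<le> y"
    using phi_le[OF assms] by (intro tendsto_sL(4) phi_in assms) (meson linorder_not_le nle_le)
qed

lemma phi_mono: "mono_on J phi"
proof (rule mono_onI, rule ccontr)
  fix y y' assume y: "y \<in> J" "y' \<in> J" "y \<le> y'" "\<not> phi y \<le> phi y'"
  then obtain x where x: "phi y' < x" "x < phi y" using dense[of "phi y'" "phi y"] by auto
  then have "x \<in> I" using I_between[OF phi_in[OF y(2)] phi_in[OF y(1)]] by auto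
  with x y phi_lessD[of y' x] phi_le[of y x] show False by auto
qed

lemma J_borel [measurable]: "J \<in> sets borel"
proof (rule real_interval_borel_measurable)
  show "is_interval J"
    unfolding is_interval_1 J_def by (blast intro: order_trans less_le_trans)
qed

lemma s_phi_measurable: "(\<lambda>y. s (phi y)) \<in> borel_measurable (restrict_space borel J)"
proof (rule borel_measurable_mono_on_fnc)
  show "mono_on J (\<lambda>y. s (phi y))"
    using phi_mono by (auto intro!: mono_onI mono phi_in dest: mono_onD)
qed

text \<open>\<open>Jc\<close> is the range of \<open>s\<close> only up to countably many levels: if
  \<open>s\<close> jumps on the right of \<open>x\<close> and is flat afterwards, the flat value is
  \<open>sR s x\<close> and belongs to \<open>Jp\<close>.\<close>

definition "Jc = {y \<in> J. s (phi y) = y}"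
definition "Jp = {y \<in> J. s (phi y) < y}"
definition "Jm = {y \<in> J. y < s (phi y)}"

lemma Jc_borel [measurable]: "Jc \<in> sets borel"
proof -
  have "(\<lambda>y. s (phi y) - y) \<in> borel_measurable (restrict_space borel J)"
    by (intro borel_measurable_diff s_phi_measurable measurable_restrict_space1) simp
  then have "(\<lambda>y. s (phi y) - y) -` {0} \<inter> space (restrict_space borel J) \<in> sets (restrict_space borel J)"
    by (rule measurable_sets) simp
  also have "(\<lambda>y. s (phi y) - y) -` {0} \<inter> space (restrict_space borel J) = Jc"
    by (auto simp: Jc_def space_restrict_space)
  finally show ?thesis by (simp add: sets_restrict_space_iff)
qed

lemma Jp_fibre: "{y \<in> Jp. phi y = x} = (if x \<in> I then {s x<..sR s x} else {})"
proof (cases "x \<in> I")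
  case True
  have "y \<in> Jp \<and> phi y = x" if "s x < y" "y \<le> sR s x" for y
  proof -
    obtain b where "b \<in> I" "x < b" using I_right[OF True] .
    then have yJ: "y \<in> J" using that tendsto_sR(3)[OF True] True by (force simp: J_def)

    have "\<not> x < phi y"
    proof
      assume "x < phi y"
      then obtain w where w: "x < w" "w < phi y" using dense by blast
      then have "w \<in> I" using I_between[OF True phi_in[OF yJ]] by auto
      then show False using phi_le[OF yJ] tendsto_sR(3)[OF True] w \<open>y \<le> sR s x\<close> by force
    qed
    moreover have "\<not> phi y < x" using phi_lessD[OF yJ True] that by auto
    ultimately have "phi y = x" by simp
    with yJ that show ?thesis by (simp add: Jp_def)
  qed
  moreover have "s x < y" "y \<le> sR s x" if "y \<in> Jp" "phi y = x" for y
    using that phi_bounds[of y] by (auto simp: Jp_def)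
  ultimately have "{y \<in> Jp. phi y = x} = {s x<..sR s x}"
    by (intro set_eqI) (unfold mem_Collect_eq greaterThanAtMost_iff, blast)
  then show ?thesis using True by (simp only: if_True)
qed (use phi_in in \<open>auto simp: Jp_def\<close>)

text \<open>For a non-empty gap the lower end \<open>sL s x\<close> is in the fibre exactly if
  \<open>s\<close> does not take this value before \<open>x\<close>. Hence only two inclusions,
  which differ by one null point.\<close>

lemma Jm_fibre:
  assumes "x \<in> I"
  shows "{sL s x<..<s x} \<subseteq> {y \<in> Jm. phi y = x}" "{y \<in> Jm. phi y = x} \<subseteq> {sL s x..<s x}"
proof
  fix y assume y: "y \<in> {sL s x<..<s x}"
  obtain a where "a \<in> I" "a < x" using I_left[OF assms] .
  then have yJ: "y \<in> J" using y tendsto_sL(3)[OF assms] assms by (force simp: J_def)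
  have "\<not> phi y < x"
  proof
    assume "phi y < x"
    then obtain w where w: "phi y < w" "w < x" using dense by blast
    then have "w \<in> I" using I_between[OF phi_in[OF yJ] assms] by auto
    then show False using phi_lessD[OF yJ _ w(1)] tendsto_sL(3)[OF assms _ w(2)] y by auto
  qed
  moreover have "phi y \<le> x" using phi_le[OF yJ assms] y by auto
  ultimately show "y \<in> {y \<in> Jm. phi y = x}" using yJ y by (auto simp: Jm_def)
next
  show "{y \<in> Jm. phi y = x} \<subseteq> {sL s x..<s x}" using phi_bounds by (auto simp: Jm_def)
qed

sublocale p: countable_fibres Jp "Dp l r s" phi
proof
  show "countable (Dp l r s)" by (rule countable_Dp)
  show "phi ` Jp \<subseteq> Dp l r s"
    using phi_bounds phi_in by (force simp: Jp_def Dp_def)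
  show "{y \<in> Jp. phi y = x} \<in> sets borel" for x
    by (simp add: Jp_fibre)
qed

sublocale m: countable_fibres Jm "Dm l r s" phi
proof
  show "countable (Dm l r s)" by (rule countable_Dm)
  show "phi ` Jm \<subseteq> Dm l r s"
    using phi_bounds phi_in by (force simp: Jm_def Dm_def)
  fix x
  show "{y \<in> Jm. phi y = x} \<in> sets borel"
  proof (cases "x \<in> I")
    case True
    from Jm_fibre[OF True]
    have "{y \<in> Jm. phi y = x} = {sL s x<..<s x} \<or> {y \<in> Jm. phi y = x} = insert (sL s x) {sL s x<..<s x}"
      by force
    moreover have "{sL s x<..<s x} \<in> sets borel" "insert (sL s x) {sL s x<..<s x} \<in> sets borel"
      by simp_all
    ultimately show ?thesis by (elim disjE) (simp_all only:)
  next
    case False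
    then have "{y \<in> Jm. phi y = x} = {}" using phi_in by (auto simp: Jm_def)
    then show ?thesis by (simp only: sets.empty_sets)
  qed
qed

section \<open>The jump measures as images of Lebesgue measure\<close>

lemma mu_dp_eq: "mu_dp l r s = distr (restrict_space lborel Jp) (count_space UNIV) phi"
proof (rule measure_eqI)
  fix A
  have "emeasure lborel {y \<in> Jp. phi y = x} = (if x \<in> I then ennreal (sR s x - s x) else 0)" for x
    unfolding Jp_fibre using tendsto_sR(2)[of x] by simp
  then have *: "emeasure lborel {y \<in> Jp. phi y \<in> A} = emeasure (mu_dp l r s) A"
    by (subst p.emeasure_preimage) (simp_all add: mu_dp_def emeasure_density)
  have "phi -` A \<inter> space (restrict_space lborel Jp) = {y \<in> Jp. phi y \<in> A}"
    by (auto simp: space_restrict_space)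
  with * show "emeasure (mu_dp l r s) A = emeasure (distr (restrict_space lborel Jp) (count_space UNIV) phi) A"
    by (subst emeasure_distr) (auto simp: p.measurable emeasure_restrict_space)
qed (simp add: mu_dp_def)

text \<open>A level in the gap above \<open>s (phi y)\<close> is passed on the way to
  \<open>s x\<close> only if \<open>x\<close> is strictly to the right of \<open>phi y\<close>,
  whereas for a level below \<open>s (phi y)\<close> equality is enough. This is the origin of the
  open convention for \<open>mu_dp\<close> and of the closed one for \<open>mu_dm\<close>.\<close>

lemma ker_phi_Jp:
  assumes "x \<in> I" "y \<in> Jp"
  shows "ker (s x) y = (if 0 < phi y \<and> phi y < x then 1 else if x \<le> phi y \<and> phi y < 0 then -1 else 0)"
proof -
  have J: "y \<in> J" using assms by (simp add: Jp_def)
  have iff: "phi y < w \<longleftrightarrow> y \<le> s w" if "w \<in> I" for w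
    using phi_le[OF J that] phi_lessD[OF J that] assms(2) by (auto simp: Jp_def less_le)
  have "phi y \<noteq> 0"
  proof
    assume "phi y = 0"
    then have "0 < y" "y \<le> 0" using assms(2) phi_bounds[OF J] by (auto simp: Jp_def s0 sR_0)
    then show False by simp
  qed
  moreover have "phi y < 0 \<longleftrightarrow> y \<le> 0" using iff[of 0] by (simp add: s0)
  ultimately show ?thesis using iff[OF assms(1)] by (auto simp: ker_def)
qed

lemma ker_phi_Jm:
  assumes "x \<in> I" "y \<in> Jm"
  shows "ker (s x) y = (if 0 < phi y \<and> phi y \<le> x then 1 else if x < phi y \<and> phi y < 0 then -1 else 0)"
proof -
  have J: "y \<in> J" using assms by (simp add: Jm_def)
  have iff: "phi y \<le> w \<longleftrightarrow> y \<le> s w" if "w \<in> I" for w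
    using phi_le[OF J that] mono[OF phi_in[OF J] that] assms(2) by (auto simp: Jm_def)
  have "phi y \<noteq> 0"
  proof
    assume "phi y = 0"
    then have "y < 0" "0 \<le> y" using assms(2) phi_bounds[OF J] by (auto simp: Jm_def s0 sL_0)
    then show False by simp
  qed
  moreover have "phi y \<le> 0 \<longleftrightarrow> y \<le> 0" using iff[of 0] by (simp add: s0)
  ultimately show ?thesis using iff[OF assms(1)] by (auto simp: ker_def)
qed

lemma Jc_iff:
  assumes "x \<in> I" "y \<in> Jc"
  shows "phi y \<le> x \<longleftrightarrow> y \<le> s x"
proof -
  have J: "y \<in> J" using assms by (simp add: Jc_def)
  show ?thesis
    using phi_le[OF J assms(1)] mono[OF phi_in[OF J] assms(1)] assms(2) by (auto simp: Jc_def)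
qed

text \<open>For levels in \<open>Jc\<close> strict and weak comparison of \<open>phi y\<close> with
  \<open>x\<close> or \<open>0\<close> differ only at the levels \<open>s x\<close> and
  \<open>0\<close>; these form a null set and are left out.\<close>

lemma ker_phi_Jc:
  assumes "x \<in> I" "y \<in> Jc" "y \<noteq> 0" "y \<noteq> s x"
  shows "ker (s x) y = (if 0 < phi y \<and> phi y < x then 1 else if x \<le> phi y \<and> phi y < 0 then -1 else 0)"
proof -
  have "phi y \<noteq> 0" "phi y \<noteq> x" using assms s0 by (auto simp: Jc_def)
  then show ?thesis
    using Jc_iff[OF assms(1,2)] Jc_iff[OF zero_in_I assms(2)] s0 by (auto simp: ker_def)
qed

lemma ker_support:
  assumes "x \<in> I" "ker (s x) y \<noteq> 0"
  shows "y \<in> J"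
proof -
  have "0 < y \<and> y \<le> s x \<or> s x < y \<and> y \<le> 0" using assms(2) by (auto simp: ker_def split: if_splits)
  then show ?thesis
  proof
    assume "0 < y \<and> y \<le> s x"
    then show ?thesis unfolding J_def using assms(1) s0 by (intro CollectI bexI[of _ 0] bexI[of _ x]) auto
  next
    assume "s x < y \<and> y \<le> 0"
    then show ?thesis unfolding J_def using assms(1) s0 by (intro CollectI bexI[of _ x] bexI[of _ 0]) auto
  qed
qed

lemma J_partition: "indicator J y = (indicator Jc y + indicator Jp y + indicator Jm y :: real)"
  by (auto simp: indicator_def Jc_def Jp_def Jm_def)

lemma mu_dm_eq: "mu_dm l r s = distr (restrict_space lborel Jm) (count_space UNIV) phi"
proof (rule measure_eqI)
  fix A
  have "emeasure lborel {y \<in> Jm. phi y = x} = (if x \<in> I then ennreal (s x - sL s x) else 0)" for x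
  proof (cases "x \<in> I")
    case True
    have "emeasure lborel {y \<in> Jm. phi y = x} \<le> emeasure lborel {sL s x..<s x}"
      by (rule emeasure_mono[OF Jm_fibre(2)[OF True]]) simp
    moreover have "emeasure lborel {sL s x<..<s x} \<le> emeasure lborel {y \<in> Jm. phi y = x}"
      by (rule emeasure_mono[OF Jm_fibre(1)[OF True]]) (simp only: sets_lborel m.fibre)
    ultimately have "emeasure lborel {y \<in> Jm. phi y = x} = ennreal (s x - sL s x)"
      using tendsto_sL(2)[OF True] by (intro antisym) simp_all
    then show ?thesis using True by (simp only: if_True)
  next
    case False
    then have "{y \<in> Jm. phi y = x} = {}" using phi_in by (auto simp: Jm_def)
    then show ?thesis using False by (simp only: emeasure_empty) simp
  qed
  then have *: "emeasure lborel {y \<in> Jm. phi y \<in> A} = emeasure (mu_dm l r s) A"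
    by (subst m.emeasure_preimage) (simp_all add: mu_dm_def emeasure_density)
  have "phi -` A \<inter> space (restrict_space lborel Jm) = {y \<in> Jm. phi y \<in> A}"
    by (auto simp: space_restrict_space)
  with * show "emeasure (mu_dm l r s) A = emeasure (distr (restrict_space lborel Jm) (count_space UNIV) phi) A"
    by (subst emeasure_distr) (auto simp: m.measurable emeasure_restrict_space)
qed (simp add: mu_dm_def)

lemma int_open_dp: "x \<in> I \<Longrightarrow> int_open (mu_dp l r s) g x = prim (\<lambda>y. indicator Jp y * g (phi y)) (s x)"
  unfolding int_open_eq prim_def
  by (subst transport(2)[OF p.domain p.measurable mu_dp_eq])
    (auto simp: mu_dp_def indicator_def ker_phi_Jp intro!: Bochner_Integration.integral_cong)

lemma int_closed_dm: "x \<in> I \<Longrightarrow> int_closed (mu_dm l r s) g x = prim (\<lambda>y. indicator Jm y * g (phi y)) (s x)"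
  unfolding int_closed_eq prim_def
  by (subst transport(2)[OF m.domain m.measurable mu_dm_eq])
    (auto simp: mu_dm_def indicator_def ker_phi_Jm intro!: Bochner_Integration.integral_cong)

section \<open>The measure of the continuous part\<close>

lemma phi_measurable_Jc: "phi \<in> restrict_space lborel Jc \<rightarrow>\<^sub>M borel"
proof -
  have "mono_on Jc phi" using phi_mono by (rule monotone_on_subset) (auto simp: Jc_def)
  then have "phi \<in> borel_measurable (restrict_space borel Jc)" by (rule borel_measurable_mono_on_fnc)
  then show ?thesis
    using measurable_cong_sets[OF sets_restrict_space_cong[OF sets_lborel] refl] by blast
qed

lemma integrable_ker_indicator:
  "A \<in> sets borel \<Longrightarrow> integrable lborel (\<lambda>y. ker z y * indicator A y)"
proof (rule Bochner_Integration.integrable_bound)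
  show "integrable lborel (ker z)"
    unfolding ker_eq[abs_def] by (intro Bochner_Integration.integrable_diff integrable_real_indicator) 
       (cases "0 \<le> z"; simp)+
qed (auto simp: indicator_def)

text \<open>\<open>s x\<close> is the signed length of the way from 0 to \<open>s x\<close>, which
  stays in \<open>J\<close>. The jump functions are the lengths spent in \<open>Jp\<close> and
  \<open>Jm\<close>, so \<open>s_c\<close> is the length spent in \<open>Jc\<close>.\<close>

lemma s_c_eq:
  assumes "x \<in> I"
  shows "s_c l r s x = prim (indicator Jc) (s x)"
proof -
  have "s_dp l r s x = int_open (mu_dp l r s) (\<lambda>_. 1) x"
    by (simp add: s_dp_def int_open_def set_lebesgue_integral_def mu_dp_def)
  then have p: "s_dp l r s x = prim (indicator Jp) (s x)"
    using assms by (simp add: int_open_dp)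
  have "s_dm l r s x = int_closed (mu_dm l r s) (\<lambda>_. 1) x"
    by (simp add: s_dm_def int_closed_def set_lebesgue_integral_def mu_dm_def)
  then have m: "s_dm l r s x = prim (indicator Jm) (s x)"
    using assms by (simp add: int_closed_dm)
  have "s x = (\<integral>y. ker (s x) y \<partial>lborel)"
    unfolding ker_eq[abs_def]
    by (subst Bochner_Integration.integral_diff) (cases "0 \<le> s x"; simp)+
  also have "\<dots> = (\<integral>y. ker (s x) y * indicator Jc y + ker (s x) y * indicator Jp y + ker (s x) y * indicator Jm y \<partial>lborel)"
  proof (rule Bochner_Integration.integral_cong[OF refl])
    fix y
    show "ker (s x) y = ker (s x) y * indicator Jc y + ker (s x) y * indicator Jp y + ker (s x) y * indicator Jm y"
      using ker_support[OF assms, of y] J_partition[of y]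
      by (cases "ker (s x) y = 0") (auto simp: distrib_left[symmetric])
  qed
  also have "\<dots> = prim (indicator Jc) (s x) + prim (indicator Jp) (s x) + prim (indicator Jm) (s x)"
    unfolding prim_def using integrable_ker_indicator by simp
  finally show ?thesis using p m by (simp add: s_c_def)
qed

text \<open>The image measure is the witness that makes the definite description meaningful, with no
  separate proof that \<open>s_c\<close> is continuous; uniqueness is
  \<open>measure_eqI_intv\<close>.\<close>

lemma mu_c_eq: "mu_c l r s = distr (restrict_space lborel Jc) borel phi"
  unfolding mu_c_def
proof (rule the_equality)
  let ?\<nu> = "distr (restrict_space lborel Jc) borel phi"
  have em: "emeasure ?\<nu> A = emeasure lborel {y \<in> Jc. phi y \<in> A}" if "A \<in> sets borel" for A
  proof -
    have "phi -` A \<inter> space (restrict_space lborel Jc) = {y \<in> Jc. phi y \<in> A}"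
      by (auto simp: space_restrict_space)
    then show ?thesis
      using that by (subst emeasure_distr[OF phi_measurable_Jc]) (auto simp: emeasure_restrict_space)
  qed
  have "{y \<in> Jc. phi y \<in> - I} = {}" using phi_in by (auto simp: Jc_def)
  then have "emeasure ?\<nu> (- I) = emeasure lborel ({} :: real set)"
    using open_I by (subst em) (simp_all only: borel_open borel_comp)
  then have "emeasure ?\<nu> (- I) = 0" by simp
  moreover have "emeasure ?\<nu> {a<..b} = ennreal (s_c l r s b - s_c l r s a)"
    if ab: "a \<in> I" "b \<in> I" "a \<le> b" for a b
  proof -
    have "{y \<in> Jc. phi y \<in> {a<..b}} = {s a<..s b} \<inter> Jc"
      using Jc_iff[OF ab(1)] Jc_iff[OF ab(2)] by (auto simp: not_le[symmetric])
    then have "emeasure ?\<nu> {a<..b} = emeasure lborel ({s a<..s b} \<inter> Jc)" by (simp add: em)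
    also have "\<dots> = ennreal (measure lborel ({s a<..s b} \<inter> Jc))"
      by (rule emeasure_eq_ennreal_measure, rule order.strict_implies_not_eq, 
          rule le_less_trans[OF emeasure_mono[of _ "{s a<..s b}"]]) (use mono[OF ab] in auto)
    also have "measure lborel ({s a<..s b} \<inter> Jc)
        = (\<integral>y. (ker (s b) y - ker (s a) y) * indicator Jc y \<partial>lborel)"
      unfolding ker_diff[OF mono[OF ab]] indicator_inter_arith[symmetric] by simp
    also have "\<dots> = s_c l r s b - s_c l r s a"
      unfolding s_c_eq[OF ab(1)] s_c_eq[OF ab(2)] prim_def
      using integrable_ker_indicator by (simp add: left_diff_distrib)
    finally show ?thesis .
  qed
  ultimately show *: "sets ?\<nu> = sets borel \<and> emeasure ?\<nu> (- I) = 0 \<and>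
      (\<forall>a\<in>I. \<forall>b\<in>I. a \<le> b \<longrightarrow> emeasure ?\<nu> {a<..b} = ennreal (s_c l r s b - s_c l r s a))"
    by simp
  fix \<mu> :: "real measure"
  assume \<mu>: "sets \<mu> = sets borel \<and> emeasure \<mu> (- I) = 0 \<and>
      (\<forall>a\<in>I. \<forall>b\<in>I. a \<le> b \<longrightarrow> emeasure \<mu> {a<..b} = ennreal (s_c l r s b - s_c l r s a))"
  show "\<mu> = ?\<nu>"
    by (rule measure_eqI_intv[where l=l and r=r]) (use \<mu> * lr in \<open>auto intro: less_trans\<close>)
qed

lemma sets_mu_c [simp, measurable_cong]: "sets (mu_c l r s) = sets borel"
  by (simp add: mu_c_eq)

lemma int_open_c:
  assumes x: "x \<in> I" and g: "g \<in> borel_measurable borel"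
  shows "int_open (mu_c l r s) g x = prim (\<lambda>y. indicator Jc y * g (phi y)) (s x)"
proof -
  note [measurable] = g
  have m1: "(\<lambda>y. indicator Jc y * ((if 0 < phi y \<and> phi y < x then 1 else if x \<le> phi y \<and> phi y < 0 then -1 else 0) * g (phi y)))
      \<in> borel_measurable borel"
    by (rule transport(1)[OF Jc_borel phi_measurable_Jc mu_c_eq]) measurable
  have m2: "(\<lambda>y. indicator Jc y * g (phi y)) \<in> borel_measurable borel"
    by (rule transport(1)[OF Jc_borel phi_measurable_Jc mu_c_eq]) measurable
  have ae: "AE y in lborel. y \<noteq> 0 \<and> y \<noteq> s x"
    using AE_lborel_singleton[of 0] AE_lborel_singleton[of "s x"] by eventually_elim auto
  have "int_open (mu_c l r s) g x = (\<integral>y. indicator Jc y * ((if 0 < phi y \<and> phi y < x then 1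
      else if x \<le> phi y \<and> phi y < 0 then -1 else 0) * g (phi y)) \<partial>lborel)"
    unfolding int_open_eq by (rule transport(2)[OF Jc_borel phi_measurable_Jc mu_c_eq]) measurable
  also have "\<dots> = prim (\<lambda>y. indicator Jc y * g (phi y)) (s x)"
    unfolding prim_def
  proof (rule integral_cong_AE)
    show "AE y in lborel. indicator Jc y * ((if 0 < phi y \<and> phi y < x then 1
      else if x \<le> phi y \<and> phi y < 0 then -1 else 0) * g (phi y)) = ker (s x) y * (indicator Jc y * g (phi y))"
      using ae
    proof eventually_elim
      case (elim y)
      then show ?case using ker_phi_Jc[OF x, of y] by (cases "y \<in> Jc") (simp_all only: indicator_simps, auto)
    qed
  qed (use m1 m2 in measurable)
  finally show ?thesis .
qed

section \<open>One derivative in place of three densities\<close>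

definition glue :: "(real \<Rightarrow> real) \<Rightarrow> (real \<Rightarrow> real) \<Rightarrow> (real \<Rightarrow> real) \<Rightarrow> real \<Rightarrow> real" where
  "glue gc gp gm y = indicator Jc y * gc (phi y) + indicator Jp y * gp (phi y) + indicator Jm y * gm (phi y)"

lemma L2_transport:
  shows "L2 (mu_c l r s) gc \<Longrightarrow> sq_integrable lborel (\<lambda>y. indicator Jc y * gc (phi y))"
    and "L2 (mu_dp l r s) gp \<Longrightarrow> sq_integrable lborel (\<lambda>y. indicator Jp y * gp (phi y))"
    and "L2 (mu_dm l r s) gm \<Longrightarrow> sq_integrable lborel (\<lambda>y. indicator Jm y * gm (phi y))"
proof -
  have [simp]: "(indicator A y * c)\<^sup>2 = indicator A y * c\<^sup>2" for A and y c :: real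
    by (auto simp: indicator_def)
  show "L2 (mu_c l r s) gc \<Longrightarrow> sq_integrable lborel (\<lambda>y. indicator Jc y * gc (phi y))"
    unfolding sq_integrable_def L2_def
    using transport(1)[OF Jc_borel phi_measurable_Jc mu_c_eq, of gc]
      transport(3)[OF Jc_borel phi_measurable_Jc mu_c_eq, of "\<lambda>x. (gc x)\<^sup>2"] by (auto intro: borel_measurable_power)
  show "L2 (mu_dp l r s) gp \<Longrightarrow> sq_integrable lborel (\<lambda>y. indicator Jp y * gp (phi y))"
    unfolding sq_integrable_def L2_def
    using transport(1)[OF p.domain p.measurable mu_dp_eq, of gp]
      transport(3)[OF p.domain p.measurable mu_dp_eq, of "\<lambda>x. (gp x)\<^sup>2"] by (auto intro: borel_measurable_power)
  show "L2 (mu_dm l r s) gm \<Longrightarrow> sq_integrable lborel (\<lambda>y. indicator Jm y * gm (phi y))"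
    unfolding sq_integrable_def L2_def
    using transport(1)[OF m.domain m.measurable mu_dm_eq, of gm]
      transport(3)[OF m.domain m.measurable mu_dm_eq, of "\<lambda>x. (gm x)\<^sup>2"] by (auto intro: borel_measurable_power)
qed

lemma glue_sq_integrable:
  "L2 (mu_c l r s) gc \<Longrightarrow> L2 (mu_dp l r s) gp \<Longrightarrow> L2 (mu_dm l r s) gm \<Longrightarrow> sq_integrable lborel (glue gc gp gm)"
  unfolding glue_def[abs_def] by (intro sq_integrable_add L2_transport)

text \<open>After the change of variables the three integrals are one primitive at
  \<open>s x\<close>. Among all derivatives with this primitive on the range of \<open>s\<close>,
  the glued ones vanish off \<open>J\<close> and are constant on each half of a gap, which makes
  them unique almost everywhere.\<close>

lemma has_repr_iff:
  "has_repr l r s f (c, gc, gp, gm) \<longleftrightarrow>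
    L2 (mu_c l r s) gc \<and> L2 (mu_dp l r s) gp \<and> L2 (mu_dm l r s) gm \<and>
    (\<forall>x\<in>I. f x = c + prim (glue gc gp gm) (s x))"
proof -
  have "prim (glue gc gp gm) (s x) = int_open (mu_c l r s) gc x + int_open (mu_dp l r s) gp x + int_closed (mu_dm l r s) gm x"
    if "L2 (mu_c l r s) gc" "L2 (mu_dp l r s) gp" "L2 (mu_dm l r s) gm" "x \<in> I" for x
  proof -
    have "gc \<in> borel_measurable borel" using that(1) by (simp add: L2_def cong: measurable_cong_sets)
    then show ?thesis
      unfolding glue_def[abs_def] using that L2_transport
      by (simp add: prim_add sq_integrable_add int_open_c int_open_dp int_closed_dm)
  qed
  then show ?thesis unfolding has_repr_def by auto
qed

text \<open>\<open>Jc\<close>, \<open>Jp\<close> and \<open>Jm\<close> are disjoint, so mixed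
  products vanish: gluing is an isometry, and the form becomes half an inner product for Lebesgue
  measure.\<close>

lemma integral_glue:
  assumes f: "L2 (mu_c l r s) fc" "L2 (mu_dp l r s) fp" "L2 (mu_dm l r s) fm"
    and g: "L2 (mu_c l r s) gc" "L2 (mu_dp l r s) gp" "L2 (mu_dm l r s) gm"
  shows "(\<integral>x. fc x * gc x \<partial>mu_c l r s) + (\<integral>x. fp x * gp x \<partial>mu_dp l r s) + (\<integral>x. fm x * gm x \<partial>mu_dm l r s)
    = (\<integral>y. glue fc fp fm y * glue gc gp gm y \<partial>lborel)"
proof -
  have mult: "glue fc fp fm y * glue gc gp gm y = indicator Jc y * (fc (phi y) * gc (phi y))
      + indicator Jp y * (fp (phi y) * gp (phi y)) + indicator Jm y * (fm (phi y) * gm (phi y))" for y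
    by (auto simp: glue_def indicator_def Jc_def Jp_def Jm_def)
  have meas: "(\<lambda>x. fc x * gc x) \<in> borel_measurable (mu_c l r s)"
    "(\<lambda>x. fp x * gp x) \<in> borel_measurable (mu_dp l r s)"
    "(\<lambda>x. fm x * gm x) \<in> borel_measurable (mu_dm l r s)"
    using f g by (auto simp: L2_def)
  note t = transport[OF Jc_borel phi_measurable_Jc mu_c_eq meas(1)]
    transport[OF p.domain p.measurable mu_dp_eq meas(2)]
    transport[OF m.domain m.measurable mu_dm_eq meas(3)]
  have "integrable (mu_c l r s) (\<lambda>x. fc x * gc x)" "integrable (mu_dp l r s) (\<lambda>x. fp x * gp x)"
    "integrable (mu_dm l r s) (\<lambda>x. fm x * gm x)"
    using f g by (auto simp: L2_iff_sq_integrable intro: sq_integrable_mult)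
  then show ?thesis unfolding mult t by simp
qed

end

section \<open>Uniqueness and averaging of representations\<close>

context countable_fibres
begin

text \<open>Conditional expectation of \<open>H\<close> given \<open>\<phi>\<close>, with
  \<open>g\<close> the mean over a fibre. The norm does not grow, and integrals against functions
  constant on fibres are preserved; the latter is meant for the kernels
  \<open>ker (s x)\<close>.\<close>

lemma fibre_average:
  assumes fin: "\<And>x. emeasure lborel {y \<in> Q. \<phi> y = x} < \<infinity>" and H: "sq_integrable lborel H"
  obtains g where "sq_integrable lborel (\<lambda>y. indicator Q y * g (\<phi> y))"
    "(\<integral>y. (indicator Q y * g (\<phi> y))\<^sup>2 \<partial>lborel) \<le> (\<integral>y. indicator Q y * (H y)\<^sup>2 \<partial>lborel)"
    "\<forall>k \<kappa>. (\<forall>y\<in>Q. k y = \<kappa> (\<phi> y)) \<longrightarrow> sq_integrable lborel k \<longrightarrow>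
      (\<integral>y. k y * (indicator Q y * g (\<phi> y)) \<partial>lborel) = (\<integral>y. indicator Q y * (k y * H y) \<partial>lborel)"
proof -
  have [measurable]: "H \<in> borel_measurable borel" using H by (simp add: sq_integrable_def)
  define B where "B x = {y \<in> Q. \<phi> y = x}" for x
  have [measurable]: "B x \<in> sets borel" for x unfolding B_def by (rule fibre)
  have fin': "emeasure lborel (B x) < \<infinity>" for x unfolding B_def by (rule fin)
  have sqB: "sq_integrable lborel (indicator (B x))" for x
    by (rule sq_integrable_indicator) (use fin' in auto)
  have intB: "integrable lborel (\<lambda>y. indicator (B x) y * H y)" for x
    by (rule sq_integrable_mult[OF sqB H])
  \<comment> \<open>On a null fibre the quotient is 0, which is harmless since the integral of
    \<open>H\<close> over it is 0 too.\<close>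
  define g where "g x = (\<integral>y. indicator (B x) y * H y \<partial>lborel) / measure lborel (B x)" for x
  define K where "K y = indicator Q y * g (\<phi> y)" for y
  have [measurable]: "K \<in> borel_measurable borel"
  proof -
    have "(\<lambda>y. g (\<phi> y)) \<in> borel_measurable (restrict_space lborel Q)"
      by (rule measurable_compose[OF measurable]) simp
    then show ?thesis unfolding K_def[abs_def]
      by (subst (asm) borel_measurable_restrict_space_iff) (auto simp: ac_simps)
  qed
  have KB: "indicator (B x) y * K y = indicator (B x) y * g x" for x y
    by (auto simp: K_def B_def indicator_def)
  have avg: "g x * measure lborel (B x) = (\<integral>y. indicator (B x) y * H y \<partial>lborel)" for x
  proof (cases "measure lborel (B x) = 0")
    case True
    then have "emeasure lborel (B x) = 0" using fin'[of x] by (simp add: emeasure_eq_ennreal_measure less_top)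
    then have "AE y in lborel. y \<notin> B x" by (intro AE_not_in) (auto simp: null_sets_def)
    then have "AE y in lborel. indicator (B x) y * H y = 0"
      by eventually_elim (simp add: indicator_def)
    from integral_eq_zero_AE[OF this] True show ?thesis by simp
  qed (simp add: g_def)
  have sqBH: "integrable lborel (\<lambda>y. indicator (B x) y * (H y)\<^sup>2)" for x
    using integrable_mult_indicator[of "B x" lborel "\<lambda>y. (H y)\<^sup>2"] H by (simp add: sq_integrable_def)
  have jensen: "(g x)\<^sup>2 * measure lborel (B x) \<le> (\<integral>y. indicator (B x) y * (H y)\<^sup>2 \<partial>lborel)" for x
  proof (cases "measure lborel (B x) = 0")
    case False
    then have pos: "0 < measure lborel (B x)" by (simp add: zero_less_measure_iff)
    have sq: "(indicator (B x) y * a)\<^sup>2 = indicator (B x) y * a\<^sup>2" for y and a :: real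
      by (auto simp: indicator_def)
    have "sq_integrable lborel (\<lambda>y. indicator (B x) y * H y)"
      using sqBH by (simp add: sq_integrable_def sq)
    from integral_Cauchy_Schwarz[OF sqB this, of x]
    have "(g x * measure lborel (B x))\<^sup>2 \<le> measure lborel (B x) * (\<integral>y. indicator (B x) y * (H y)\<^sup>2 \<partial>lborel)"
      using sq[of _ 1] by (simp add: avg sq mult.assoc[symmetric] flip: power2_eq_square)
    then have "measure lborel (B x) * ((g x)\<^sup>2 * measure lborel (B x))
        \<le> measure lborel (B x) * (\<integral>y. indicator (B x) y * (H y)\<^sup>2 \<partial>lborel)"
      by (simp add: power2_eq_square algebra_simps)
    with pos show ?thesis by simp
  qed simp
  have fib: "(\<integral>\<^sup>+y. ennreal ((K y)\<^sup>2) * indicator (B x) y \<partial>lborel) \<le> (\<integral>\<^sup>+y. ennreal ((H y)\<^sup>2) * indicator (B x) y \<partial>lborel)" for x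
  proof -
    have "(\<integral>\<^sup>+y. ennreal ((K y)\<^sup>2) * indicator (B x) y \<partial>lborel) = (\<integral>\<^sup>+y. ennreal ((g x)\<^sup>2) * indicator (B x) y \<partial>lborel)"
      by (rule nn_integral_cong) (auto simp: K_def B_def indicator_def)
    also have "\<dots> = ennreal ((g x)\<^sup>2 * measure lborel (B x))"
      using fin'[of x] by (simp add: nn_integral_cmult emeasure_eq_ennreal_measure less_top ennreal_mult)
    also have "\<dots> \<le> ennreal (\<integral>y. indicator (B x) y * (H y)\<^sup>2 \<partial>lborel)"
      by (rule ennreal_leI[OF jensen])
    also have "\<dots> = (\<integral>\<^sup>+y. ennreal (indicator (B x) y * (H y)\<^sup>2) \<partial>lborel)"
      by (rule nn_integral_eq_integral[symmetric, OF sqBH]) simp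
    also have "\<dots> = (\<integral>\<^sup>+y. ennreal ((H y)\<^sup>2) * indicator (B x) y \<partial>lborel)"
      by (rule nn_integral_cong) (auto simp: indicator_def)
    finally show ?thesis .
  qed
  have Q_B: "{y \<in> Q. \<phi> y \<in> UNIV} = Q" by simp
  have "(\<integral>\<^sup>+y. ennreal ((K y)\<^sup>2) * indicator Q y \<partial>lborel) = emeasure (density lborel (\<lambda>y. ennreal ((K y)\<^sup>2))) Q"
    by (rule emeasure_density[symmetric]) auto
  \<comment> \<open>Both sides are written as sums over the fibres by
    \<open>emeasure_preimage\<close> for the weighted measures and compared term by term.\<close>
  also have "\<dots> \<le> emeasure (density lborel (\<lambda>y. ennreal ((H y)\<^sup>2))) Q"
    using emeasure_preimage[of "density lborel (\<lambda>y. ennreal ((K y)\<^sup>2))" UNIV]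
      emeasure_preimage[of "density lborel (\<lambda>y. ennreal ((H y)\<^sup>2))" UNIV] fib
    by (simp add: Q_B B_def[symmetric] emeasure_density nn_integral_mono)
  also have "\<dots> = (\<integral>\<^sup>+y. ennreal ((H y)\<^sup>2) * indicator Q y \<partial>lborel)"
    by (rule emeasure_density) auto
  also have "\<dots> = (\<integral>\<^sup>+y. ennreal (indicator Q y * (H y)\<^sup>2) \<partial>lborel)"
    by (rule nn_integral_cong) (auto simp: indicator_def)
  also have "\<dots> = ennreal (\<integral>y. indicator Q y * (H y)\<^sup>2 \<partial>lborel)"
    using integrable_mult_indicator[of Q lborel "\<lambda>y. (H y)\<^sup>2"] H
    by (intro nn_integral_eq_integral) (auto simp: sq_integrable_def)
  also have "(\<integral>\<^sup>+y. ennreal ((K y)\<^sup>2) * indicator Q y \<partial>lborel) = (\<integral>\<^sup>+y. ennreal ((K y)\<^sup>2) \<partial>lborel)"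
    by (rule nn_integral_cong) (auto simp: K_def indicator_def)
  finally have nn: "(\<integral>\<^sup>+y. ennreal ((K y)\<^sup>2) \<partial>lborel) \<le> ennreal (\<integral>y. indicator Q y * (H y)\<^sup>2 \<partial>lborel)" .
  have Kint: "integrable lborel (\<lambda>y. (K y)\<^sup>2)"
    by (rule integrableI_nonneg) (use le_less_trans[OF nn] in auto)
  then have Ksq: "sq_integrable lborel K" by (simp add: sq_integrable_def)
  have Kle: "(\<integral>y. (K y)\<^sup>2 \<partial>lborel) \<le> (\<integral>y. indicator Q y * (H y)\<^sup>2 \<partial>lborel)"
    using nn by (subst (asm) nn_integral_eq_integral[OF Kint]) (auto simp: ennreal_le_iff integral_nonneg_AE)
  have "(\<integral>y. k y * K y \<partial>lborel) = (\<integral>y. indicator Q y * (k y * H y) \<partial>lborel)"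
    if k: "\<forall>y\<in>Q. k y = \<kappa> (\<phi> y)" and sqk: "sq_integrable lborel k" for k \<kappa>
  proof -
    have i: "integrable lborel (\<lambda>y. k y * K y)" "integrable lborel (\<lambda>y. k y * H y)"
      using sq_integrable_mult sqk H Ksq by blast+
    \<comment> \<open>On the fibre over \<open>x\<close> the factor \<open>k\<close> is the constant
      \<open>\<kappa> x\<close>, and \<open>H - g x\<close> has integral 0 there.\<close>
    have "(\<integral>y. indicator Q y * (k y * H y - k y * K y) \<partial>lborel) = 0"
    proof (rule integral_zero_on_fibres)
      show "integrable lborel (\<lambda>y. k y * H y - k y * K y)" using i by simp
      fix x
      have "(\<integral>y. indicator (B x) y * (k y * H y - k y * K y) \<partial>lborel)
          = (\<integral>y. \<kappa> x * (indicator (B x) y * H y - g x * indicator (B x) y) \<partial>lborel)"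
        by (rule Bochner_Integration.integral_cong) (auto simp: B_def K_def indicator_def k algebra_simps)
      also have "\<dots> = \<kappa> x * ((\<integral>y. indicator (B x) y * H y \<partial>lborel) - g x * measure lborel (B x))"
        using intB fin' by (simp add: less_top)
      finally show "(\<integral>y. indicator {y \<in> Q. \<phi> y = x} y * (k y * H y - k y * K y) \<partial>lborel) = 0"
        unfolding B_def[symmetric] using avg[of x] by simp
    qed
    moreover have "integrable lborel (\<lambda>y. indicator Q y * (k y * H y))"
      using integrable_mult_indicator[of Q lborel, OF _ i(2)] by simp
    moreover have "indicator Q y * (k y * H y - k y * K y) = indicator Q y * (k y * H y) - k y * K y" for y
      by (auto simp: K_def indicator_def)
    ultimately show ?thesis using i by simp
  qed
  then show thesis
    using that[of g] Ksq Kle unfolding K_def by blast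
qed

end

context scale_function
begin

lemma Jp_fibre_finite: "emeasure lborel {y \<in> Jp. phi y = x} < \<infinity>"
  using tendsto_sR(2)[of x] by (simp add: Jp_fibre)

lemma Jm_fibre_finite: "emeasure lborel {y \<in> Jm. phi y = x} < \<infinity>"
proof (cases "x \<in> I")
  case True
  have "emeasure lborel {y \<in> Jm. phi y = x} \<le> emeasure lborel {sL s x..<s x}"
    by (rule emeasure_mono[OF Jm_fibre(2)[OF True]]) simp
  also have "\<dots> < \<infinity>" using tendsto_sL(2)[OF True] by simp
  finally show ?thesis .
next
  case False
  then have "{y \<in> Jm. phi y = x} = {}" using phi_in by (auto simp: Jm_def)
  then show ?thesis by (simp only: emeasure_empty) simp
qed

lemma s_measurable: "s \<in> borel_measurable (restrict_space borel I)"
  using s_mono by (rule borel_measurable_mono_on_fnc)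

text \<open>An arbitrary derivative \<open>H\<close> in the time-changed variable is replaced by its averages over
  the gaps of the range of \<open>s\<close>.\<close>

lemma repr_of_prim:
  assumes H: "sq_integrable lborel H" and f: "\<And>x. x \<in> I \<Longrightarrow> f x = c + prim H (s x)"
  obtains gc gp gm where "has_repr l r s f (c, gc, gp, gm)"
    "(\<integral>y. (glue gc gp gm y)\<^sup>2 \<partial>lborel) \<le> (\<integral>y. (H y)\<^sup>2 \<partial>lborel)"
proof -
  obtain gp where gp: "sq_integrable lborel (\<lambda>y. indicator Jp y * gp (phi y))"
    "(\<integral>y. (indicator Jp y * gp (phi y))\<^sup>2 \<partial>lborel) \<le> (\<integral>y. indicator Jp y * (H y)\<^sup>2 \<partial>lborel)"
    "\<forall>k \<kappa>. (\<forall>y\<in>Jp. k y = \<kappa> (phi y)) \<longrightarrow> sq_integrable lborel k \<longrightarrow>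
      (\<integral>y. k y * (indicator Jp y * gp (phi y)) \<partial>lborel) = (\<integral>y. indicator Jp y * (k y * H y) \<partial>lborel)"
    by (rule p.fibre_average[OF Jp_fibre_finite H]) (rule that)
  obtain gm where gm: "sq_integrable lborel (\<lambda>y. indicator Jm y * gm (phi y))"
    "(\<integral>y. (indicator Jm y * gm (phi y))\<^sup>2 \<partial>lborel) \<le> (\<integral>y. indicator Jm y * (H y)\<^sup>2 \<partial>lborel)"
    "\<forall>k \<kappa>. (\<forall>y\<in>Jm. k y = \<kappa> (phi y)) \<longrightarrow> sq_integrable lborel k \<longrightarrow>
      (\<integral>y. k y * (indicator Jm y * gm (phi y)) \<partial>lborel) = (\<integral>y. indicator Jm y * (k y * H y) \<partial>lborel)"
    by (rule m.fibre_average[OF Jm_fibre_finite H]) (rule that)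
  have [measurable]: "H \<in> borel_measurable borel" using H by (simp add: sq_integrable_def)
  have HH: "integrable lborel (\<lambda>y. (H y)\<^sup>2)" using H by (simp add: sq_integrable_def)
  \<comment> \<open>No averaging on \<open>Jc\<close>: there \<open>y = s (phi y)\<close>, so
    \<open>H y\<close> is already a function of \<open>phi y\<close>.\<close>
  define gc where "gc x = indicator I x * H (s x)" for x
  have gc_meas: "gc \<in> borel_measurable borel"
  proof -
    have "(\<lambda>x. H (s x)) \<in> borel_measurable (restrict_space borel I)"
      by (rule measurable_compose[OF s_measurable]) simp
    then show ?thesis unfolding gc_def[abs_def]
      using open_I by (subst (asm) borel_measurable_restrict_space_iff) (auto simp: ac_simps)
  qed
  have gc_eq: "indicator Jc y * gc (phi y) = indicator Jc y * H y" for y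
    using phi_in[of y] by (auto simp: gc_def Jc_def indicator_def)
  have [simp]: "(indicator A y * a)\<^sup>2 = indicator A y * a\<^sup>2" for A and y a :: real
    by (auto simp: indicator_def)
  have intA: "integrable lborel (\<lambda>y. indicator A y * (H y)\<^sup>2)" if "A \<in> sets borel" for A
    using integrable_mult_indicator[of A lborel, OF _ HH] that by simp
  have "indicator Jc y * (gc (phi y))\<^sup>2 = indicator Jc y * (H y)\<^sup>2" for y
    using arg_cong[OF gc_eq[of y], of "\<lambda>a. a\<^sup>2"] by simp
  then have "integrable lborel (\<lambda>y. indicator Jc y * (gc (phi y))\<^sup>2)"
    using intA[OF Jc_borel] by (simp only:)
  moreover have mc: "gc \<in> borel_measurable (mu_c l r s)"
    using gc_meas by (simp cong: measurable_cong_sets)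
  ultimately have Lc: "L2 (mu_c l r s) gc"
    unfolding L2_def
    using transport(3)[OF Jc_borel phi_measurable_Jc mu_c_eq borel_measurable_power[OF mc]] by blast
  have Lp: "L2 (mu_dp l r s) gp"
    unfolding L2_def using gp(1)
    by (subst transport(3)[OF p.domain p.measurable mu_dp_eq]) (auto simp: mu_dp_def sq_integrable_def)
  have Lm: "L2 (mu_dm l r s) gm"
    unfolding L2_def using gm(1)
    by (subst transport(3)[OF m.domain m.measurable mu_dm_eq]) (auto simp: mu_dm_def sq_integrable_def)
  have prim_eq: "prim (glue gc gp gm) (s x) = prim H (s x)" if x: "x \<in> I" for x
  proof -
    let ?k = "ker (s x)"
    note i = ker_integrable[OF L2_transport(1)[OF Lc], of "s x"] ker_integrable[OF gp(1), of "s x"]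
      ker_integrable[OF gm(1), of "s x"]
    have iH: "integrable lborel (\<lambda>y. indicator A y * (?k y * H y))" if "A \<in> sets borel" for A
      using integrable_mult_indicator[of A lborel, OF _ ker_integrable[OF H, of "s x"]] that by simp
    have "prim (glue gc gp gm) (s x) = (\<integral>y. ?k y * (indicator Jc y * gc (phi y)) \<partial>lborel)
        + (\<integral>y. ?k y * (indicator Jp y * gp (phi y)) \<partial>lborel) + (\<integral>y. ?k y * (indicator Jm y * gm (phi y)) \<partial>lborel)"
      unfolding prim_def glue_def using i by (simp add: distrib_left)
    \<comment> \<open>The kernel of a level in the range of \<open>s\<close> is constant on each
      fibre, so it does not notice the averaging.\<close>
    also have "(\<integral>y. ?k y * (indicator Jp y * gp (phi y)) \<partial>lborel) = (\<integral>y. indicator Jp y * (?k y * H y) \<partial>lborel)"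
      by (rule gp(3)[rule_format, OF ker_phi_Jp[OF x] ker_sq_integrable])
    also have "(\<integral>y. ?k y * (indicator Jm y * gm (phi y)) \<partial>lborel) = (\<integral>y. indicator Jm y * (?k y * H y) \<partial>lborel)"
      by (rule gm(3)[rule_format, OF ker_phi_Jm[OF x] ker_sq_integrable])
    also have "(\<integral>y. ?k y * (indicator Jc y * gc (phi y)) \<partial>lborel) = (\<integral>y. indicator Jc y * (?k y * H y) \<partial>lborel)"
      by (simp add: gc_eq ac_simps)
    also have "(\<integral>y. indicator Jc y * (?k y * H y) \<partial>lborel) + (\<integral>y. indicator Jp y * (?k y * H y) \<partial>lborel)
        + (\<integral>y. indicator Jm y * (?k y * H y) \<partial>lborel) = (\<integral>y. indicator J y * (?k y * H y) \<partial>lborel)"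
      unfolding J_partition distrib_right using iH by simp
    also have "\<dots> = prim H (s x)"
      unfolding prim_def using ker_support[OF x]
      by (intro Bochner_Integration.integral_cong) (auto simp: indicator_def)
    finally show ?thesis .
  qed
  have "(glue gc gp gm y)\<^sup>2 = indicator Jc y * (H y)\<^sup>2 + (indicator Jp y * gp (phi y))\<^sup>2 + (indicator Jm y * gm (phi y))\<^sup>2" for y
    using gc_eq[of y] by (auto simp: glue_def indicator_def Jc_def Jp_def Jm_def)
  then have "(\<integral>y. (glue gc gp gm y)\<^sup>2 \<partial>lborel) = (\<integral>y. indicator Jc y * (H y)\<^sup>2 \<partial>lborel)
      + (\<integral>y. (indicator Jp y * gp (phi y))\<^sup>2 \<partial>lborel) + (\<integral>y. (indicator Jm y * gm (phi y))\<^sup>2 \<partial>lborel)"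
    using intA[OF Jc_borel] gp(1) gm(1) by (simp add: sq_integrable_def)
  also have "\<dots> \<le> (\<integral>y. indicator Jc y * (H y)\<^sup>2 \<partial>lborel) + (\<integral>y. indicator Jp y * (H y)\<^sup>2 \<partial>lborel)
      + (\<integral>y. indicator Jm y * (H y)\<^sup>2 \<partial>lborel)"
    using gp(2) gm(2) by linarith
  also have "\<dots> = (\<integral>y. indicator J y * (H y)\<^sup>2 \<partial>lborel)"
    unfolding J_partition distrib_right using intA by simp
  also have "\<dots> \<le> (\<integral>y. (H y)\<^sup>2 \<partial>lborel)"
    by (rule integral_mono[OF intA HH]) (auto simp: indicator_def)
  finally have "(\<integral>y. (glue gc gp gm y)\<^sup>2 \<partial>lborel) \<le> (\<integral>y. (H y)\<^sup>2 \<partial>lborel)" .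
  then show thesis
    using f prim_eq Lc Lp Lm by (intro that[of gc gp gm]) (simp_all add: has_repr_iff)
qed

lemma glue_Jp: "y \<in> Jp \<Longrightarrow> glue gc gp gm y = gp (phi y)"
  and glue_Jm: "y \<in> Jm \<Longrightarrow> glue gc gp gm y = gm (phi y)"
  by (auto simp: glue_def indicator_def Jc_def Jp_def Jm_def)

text \<open>The primitive vanishes on the range of \<open>s\<close> and, by continuity, at all
  one-sided limits. On each half of a gap the glued function is a constant whose product with the
  length is 0. What remains is \<open>gc\<close>, all of whose integrals over \<open>(a,b]\<close>
  against \<open>mu_c\<close> vanish.\<close>

lemma repr_zero:
  assumes L: "L2 (mu_c l r s) gc" "L2 (mu_dp l r s) gp" "L2 (mu_dm l r s) gm"
    and z: "\<And>x. x \<in> I \<Longrightarrow> c + prim (glue gc gp gm) (s x) = 0"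
  shows "c = 0" "AE y in lborel. glue gc gp gm y = 0"
proof -
  define G where "G = glue gc gp gm"
  have G: "sq_integrable lborel G" unfolding G_def using L by (rule glue_sq_integrable)
  show c: "c = 0" using z[of 0] by (simp add: s0)
  have pz: "prim G (s x) = 0" if "x \<in> I" for x using z[OF that] c by (simp add: G_def)
  have cont: "isCont (prim G) y" for y
    using prim_continuous[OF G] by (simp add: continuous_on_eq_continuous_at)
  have ev: "\<forall>\<^sub>F w in at x. w \<in> I" if "x \<in> I" for x
    using open_I that by (simp add: eventually_at_topological) blast
  have pR: "prim G (sR s x) = 0" if x: "x \<in> I" for x
  proof (rule tendsto_unique)
    show "((\<lambda>w. prim G (s w)) \<longlongrightarrow> prim G (sR s x)) (at_right x)"
      by (rule isCont_tendsto_compose[OF cont tendsto_sR(1)[OF x]])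
    show "((\<lambda>w. prim G (s w)) \<longlongrightarrow> 0) (at_right x)"
      by (rule tendsto_eventually)
        (use ev[OF x] pz in \<open>auto simp: eventually_at_filter elim!: eventually_mono\<close>)
  qed simp
  have pL: "prim G (sL s x) = 0" if x: "x \<in> I" for x
  proof (rule tendsto_unique)
    show "((\<lambda>w. prim G (s w)) \<longlongrightarrow> prim G (sL s x)) (at_left x)"
      by (rule isCont_tendsto_compose[OF cont tendsto_sL(1)[OF x]])
    show "((\<lambda>w. prim G (s w)) \<longlongrightarrow> 0) (at_left x)"
      by (rule tendsto_eventually)
        (use ev[OF x] pz in \<open>auto simp: eventually_at_filter elim!: eventually_mono\<close>)
  qed simp
  have gp0: "gp (phi y) = 0" if y: "y \<in> Jp" for y
  proof -
    let ?x = "phi y"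
    have yJ: "y \<in> J" "s ?x < y" using y by (auto simp: Jp_def)
    note x = phi_in[OF yJ(1)]
    have "G w = gp ?x" if "w \<in> {s ?x<..sR s ?x}" for w
    proof -
      have "w \<in> {y' \<in> Jp. phi y' = ?x}" using that x by (simp add: Jp_fibre)
      then show ?thesis by (simp add: G_def glue_Jp)
    qed
    then have "(\<integral>w. indicator {s ?x<..sR s ?x} w * G w \<partial>lborel) = (\<integral>w. gp ?x * indicator {s ?x<..sR s ?x} w \<partial>lborel)"
      by (intro Bochner_Integration.integral_cong) (auto simp: indicator_def)
    then have "gp ?x * (sR s ?x - s ?x) = 0"
      using prim_diff[OF G tendsto_sR(2)[OF x]] pR[OF x] pz[OF x] tendsto_sR(2)[OF x] by simp
    then show ?thesis using phi_bounds[OF yJ(1)] yJ(2) by simp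
  qed
  have gm0: "gm (phi y) = 0" if y: "y \<in> Jm" for y
  proof -
    let ?x = "phi y"
    have yJ: "y \<in> J" "y < s ?x" using y by (auto simp: Jm_def)
    note x = phi_in[OF yJ(1)]
    have Gw: "G w = gm ?x" if "w \<in> {sL s ?x<..<s ?x}" for w
    proof -
      have "w \<in> {y' \<in> Jm. phi y' = ?x}" using that Jm_fibre(1)[OF x] by blast
      then show ?thesis by (simp add: G_def glue_Jm)
    qed
    have "AE w in lborel. w \<noteq> s ?x" by (rule AE_lborel_singleton)
    then have "AE w in lborel. indicator {sL s ?x<..s ?x} w * G w = gm ?x * indicator {sL s ?x<..s ?x} w"
      by eventually_elim (auto simp: indicator_def Gw)
    then have "(\<integral>w. indicator {sL s ?x<..s ?x} w * G w \<partial>lborel) = (\<integral>w. gm ?x * indicator {sL s ?x<..s ?x} w \<partial>lborel)"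
      using G by (intro integral_cong_AE) (auto simp: sq_integrable_def)
    then have "gm ?x * (s ?x - sL s ?x) = 0"
      using prim_diff[OF G tendsto_sL(2)[OF x]] pL[OF x] pz[OF x] tendsto_sL(2)[OF x] by simp
    then show ?thesis using phi_bounds[OF yJ(1)] yJ(2) by simp
  qed
  have Gc: "G y = indicator Jc y * gc (phi y)" for y
    using gp0[of y] gm0[of y] by (auto simp: G_def glue_def indicator_def)
  note [measurable] = L(1)[unfolded L2_def, THEN conjunct1]
  have zero: "(\<integral>x. indicator {a<..b} x * gc x \<partial>mu_c l r s) = 0 \<and>
      integrable (mu_c l r s) (\<lambda>x. indicator {a<..b} x * gc x)" if ab: "a \<in> I" "b \<in> I" "a \<le> b" for a b
  proof -
    have m: "(\<lambda>x. indicator {a<..b} x * gc x) \<in> borel_measurable (mu_c l r s)" by measurable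
    have eq: "indicator Jc y * (indicator {a<..b} (phi y) * gc (phi y)) = indicator {s a<..s b} y * G y" for y
      using Jc_iff[OF ab(1), of y] Jc_iff[OF ab(2), of y] by (auto simp: Gc indicator_def)
    have "(\<integral>y. indicator {s a<..s b} y * G y \<partial>lborel) = 0"
      using prim_diff[OF G mono[OF ab]] pz ab by simp
    moreover have "integrable lborel (\<lambda>y. indicator {s a<..s b} y * G y)"
      by (rule sq_integrable_mult[OF sq_integrable_interval G])
    ultimately show ?thesis
      unfolding transport(2)[OF Jc_borel phi_measurable_Jc mu_c_eq m]
        transport(3)[OF Jc_borel phi_measurable_Jc mu_c_eq m] eq by simp
  qed
  \<comment> \<open>\<open>ennreal\<close> truncates at 0, so \<open>P\<close> and \<open>N\<close>
    are the positive and the negative part of \<open>gc\<close> times \<open>mu_c\<close>.\<close>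
  define P where "P = density (mu_c l r s) (\<lambda>x. ennreal (gc x))"
  define N where "N = density (mu_c l r s) (\<lambda>x. ennreal (- gc x))"
  have muI: "AE x in mu_c l r s. x \<in> I"
  proof -
    have "AE y in restrict_space lborel Jc. phi y \<in> I"
      using phi_in by (intro AE_I2) (auto simp: space_restrict_space Jc_def)
    then show ?thesis unfolding mu_c_eq using open_I
      by (subst AE_distr_iff[OF phi_measurable_Jc]) auto
  qed
  have "P = N"
  proof (rule measure_eqI_intv[where l=l and r=r])
    show "l < r" using lr by (rule less_trans)
    have "emeasure (density (mu_c l r s) h) (- I) = 0" if [measurable]: "h \<in> borel_measurable borel" for h :: "real \<Rightarrow> ennreal"
    proof -
      have "emeasure (density (mu_c l r s) h) (- I) = (\<integral>\<^sup>+x. h x * indicator (- I) x \<partial>mu_c l r s)"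
        using open_I by (intro emeasure_density) auto
      also have "\<dots> = (\<integral>\<^sup>+x. 0 \<partial>mu_c l r s)"
        by (rule nn_integral_cong_AE) (use muI in eventually_elim, simp)
      finally show ?thesis by simp
    qed
    then show "emeasure P (- I) = 0" "emeasure N (- I) = 0" unfolding P_def N_def by auto
    fix a b assume ab: "a \<in> I" "b \<in> I" "a \<le> b"
    let ?F = "\<lambda>x. indicator {a<..b} x * gc x"
    have eP: "emeasure P {a<..b} = (\<integral>\<^sup>+x. ennreal (?F x) \<partial>mu_c l r s)"
      unfolding P_def by (subst emeasure_density) (auto intro!: nn_integral_cong simp: indicator_def)
    have eN: "emeasure N {a<..b} = (\<integral>\<^sup>+x. ennreal (- ?F x) \<partial>mu_c l r s)"
      unfolding N_def by (subst emeasure_density) (auto intro!: nn_integral_cong simp: indicator_def)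
    have "integrable (mu_c l r s) ?F" using zero[OF ab] by simp
    then have fin: "emeasure P {a<..b} \<noteq> \<infinity>" "emeasure N {a<..b} \<noteq> \<infinity>"
      unfolding eP eN real_integrable_def by auto
    have "enn2real (emeasure P {a<..b}) = enn2real (emeasure N {a<..b})"
      using real_lebesgue_integral_def[OF conjunct2[OF zero[OF ab]]] conjunct1[OF zero[OF ab]]
      unfolding eP eN by linarith
    with fin show "emeasure P {a<..b} = emeasure N {a<..b}" "emeasure P {a<..b} < \<infinity>"
      by (metis ennreal_enn2real infinity_ennreal_def less_top) (use fin in \<open>simp add: less_top\<close>)
  qed (simp_all add: P_def N_def)
  have "AE x in mu_c l r s. gc x = 0"
  proof -
    \<comment> \<open>Where \<open>h\<close> is positive, the truncated density of the right-hand
      measure is 0.\<close>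
    have half: "AE x in mu_c l r s. h x \<le> 0"
      if [measurable]: "h \<in> borel_measurable borel"
        and eq: "density (mu_c l r s) (\<lambda>x. ennreal (h x)) = density (mu_c l r s) (\<lambda>x. ennreal (- h x))" for h
    proof -
      let ?A = "{x. 0 < h x}"
      have [measurable]: "?A \<in> sets borel" by measurable
      have "(\<integral>\<^sup>+x. ennreal (h x) * indicator ?A x \<partial>mu_c l r s) = emeasure (density (mu_c l r s) (\<lambda>x. ennreal (h x))) ?A"
        by (rule emeasure_density[symmetric]) auto
      also have "\<dots> = (\<integral>\<^sup>+x. ennreal (- h x) * indicator ?A x \<partial>mu_c l r s)"
        unfolding eq by (rule emeasure_density) auto
      also have "\<dots> = (\<integral>\<^sup>+x. 0 \<partial>mu_c l r s)"
        by (rule nn_integral_cong) (auto simp: indicator_def ennreal_neg)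
      finally have "AE x in mu_c l r s. ennreal (h x) * indicator ?A x = 0"
        by (subst nn_integral_0_iff_AE[symmetric]) auto
      then show ?thesis by eventually_elim (auto simp: indicator_def ennreal_eq_0_iff split: if_splits)
    qed
    have m: "gc \<in> borel_measurable borel" using L(1) by (simp add: L2_def cong: measurable_cong_sets)
    have "AE x in mu_c l r s. gc x \<le> 0" "AE x in mu_c l r s. - gc x \<le> 0"
      using half[of gc] half[of "\<lambda>x. - gc x"] \<open>P = N\<close> m by (auto simp: P_def N_def)
    then show ?thesis by eventually_elim simp
  qed
  then have "(\<integral>x. gc x * gc x \<partial>mu_c l r s) = 0"
    by (intro integral_eq_zero_AE) (auto elim!: eventually_mono)
  moreover have m: "(\<lambda>x. gc x * gc x) \<in> borel_measurable (mu_c l r s)" by measurable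
  moreover have "indicator Jc y * (gc (phi y) * gc (phi y)) = (G y)\<^sup>2" for y
    by (auto simp: Gc indicator_def power2_eq_square)
  ultimately have "(\<integral>y. (G y)\<^sup>2 \<partial>lborel) = 0"
    unfolding transport(2)[OF Jc_borel phi_measurable_Jc mu_c_eq m] by simp
  then have "AE y in lborel. (G y)\<^sup>2 = 0"
    using G by (subst (asm) integral_nonneg_eq_0_iff_AE) (auto simp: sq_integrable_def)
  then show "AE y in lborel. glue gc gp gm y = 0" by (auto simp: G_def)
qed

section \<open>Additive constant, derivative and form of a represented function\<close>

lemma L2_lin:
  assumes "L2 \<mu> f" "L2 \<mu> g"
  shows "L2 \<mu> (\<lambda>x. a * f x + b * g x)"
  using assms unfolding L2_iff_sq_integrable by (intro sq_integrable_add sq_integrable_scale)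

lemma glue_lin:
  "glue (\<lambda>x. a * fc x + b * gc x) (\<lambda>x. a * fp x + b * gp x) (\<lambda>x. a * fm x + b * gm x) y
    = a * glue fc fp fm y + b * glue gc gp gm y"
  by (simp add: glue_def algebra_simps)

lemma prim_lin:
  assumes "sq_integrable lborel G" "sq_integrable lborel H"
  shows "prim (\<lambda>y. a * G y + b * H y) z = a * prim G z + b * prim H z"
  by (simp add: prim_add[OF sq_integrable_scale[OF assms(1)] sq_integrable_scale[OF assms(2)]] prim_scale)

lemma has_repr_lin:
  assumes f: "has_repr l r s f (c, fc, fp, fm)" and g: "has_repr l r s g (d, gc, gp, gm)"
    and h: "\<And>x. x \<in> I \<Longrightarrow> h x = a * f x + b * g x"
  shows "has_repr l r s h (a * c + b * d, \<lambda>x. a * fc x + b * gc x, \<lambda>x. a * fp x + b * gp x, \<lambda>x. a * fm x + b * gm x)"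
  using f g unfolding has_repr_iff glue_lin[abs_def]
  by (auto simp: h L2_lin prim_lin glue_sq_integrable algebra_simps)

lemma repr_unique:
  assumes f: "has_repr l r s f (c, fc, fp, fm)" and g: "has_repr l r s f (d, gc, gp, gm)"
  shows "c = d" "AE y in lborel. glue fc fp fm y = glue gc gp gm y"
proof -
  have h: "has_repr l r s (\<lambda>x. 0) (1 * c + (-1) * d, \<lambda>x. 1 * fc x + (-1) * gc x,
      \<lambda>x. 1 * fp x + (-1) * gp x, \<lambda>x. 1 * fm x + (-1) * gm x)"
    by (rule has_repr_lin[OF f g]) simp
  note * = h[unfolded has_repr_iff]
  have "1 * c + (-1) * d = 0 \<and>
    (AE y in lborel. glue (\<lambda>x. 1 * fc x + (-1) * gc x) (\<lambda>x. 1 * fp x + (-1) * gp x) (\<lambda>x. 1 * fm x + (-1) * gm x) y = 0)"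
    (is "?c = 0 \<and> (AE y in lborel. ?G y = 0)")
  proof -
    have z: "?c + prim ?G (s x) = 0" if "x \<in> I" for x
      using *[THEN conjunct2, THEN conjunct2, THEN conjunct2, rule_format, OF that] by (rule sym)
    show ?thesis
      using repr_zero[OF *[THEN conjunct1] *[THEN conjunct2, THEN conjunct1]
          *[THEN conjunct2, THEN conjunct2, THEN conjunct1] z] by (rule conjI)
  qed
  then show "c = d" "AE y in lborel. glue fc fp fm y = glue gc gp gm y"
    unfolding glue_lin by auto
qed

definition base :: "(real \<Rightarrow> real) \<Rightarrow> real" where
  "base f = fst (repr l r s f)"

text \<open>Depends on the choice made by \<open>repr\<close>, but only on a null set, by
  \<open>der_unique\<close>.\<close>

definition der :: "(real \<Rightarrow> real) \<Rightarrow> real \<Rightarrow> real" where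
  "der f = (case repr l r s f of (_, gc, gp, gm) \<Rightarrow> glue gc gp gm)"

lemma has_repr_repr: "f \<in> S_space l r s \<Longrightarrow> has_repr l r s f (repr l r s f)"
  unfolding S_space_def repr_def by (auto intro: someI)

lemma
  assumes "f \<in> S_space l r s"
  shows der_sq_integrable: "sq_integrable lborel (der f)"
    and S_space_eq: "\<And>x. x \<in> I \<Longrightarrow> f x = base f + prim (der f) (s x)"
  using has_repr_repr[OF assms]
  by (cases "repr l r s f"; auto simp: has_repr_iff der_def base_def glue_sq_integrable)+

lemma der_unique:
  assumes "has_repr l r s f (c, gc, gp, gm)"
  shows "base f = c" "AE y in lborel. der f y = glue gc gp gm y"
proof -
  obtain d fc fp fm where r: "repr l r s f = (d, fc, fp, fm)" by (cases "repr l r s f") auto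
  have "f \<in> S_space l r s" using assms by (auto simp: S_space_def)
  from has_repr_repr[OF this] repr_unique[OF _ assms]
  show "base f = c" "AE y in lborel. der f y = glue gc gp gm y"
    by (auto simp: r der_def base_def)
qed

lemma
  assumes f: "f \<in> S_space l r s" and g: "g \<in> S_space l r s"
    and h: "\<And>x. x \<in> I \<Longrightarrow> h x = a * f x + b * g x"
  shows S_space_lin: "h \<in> S_space l r s"
    and der_lin: "AE y in lborel. der h y = a * der f y + b * der g y"
    and base_lin: "base h = a * base f + b * base g"
proof -
  obtain c fc fp fm where rf: "repr l r s f = (c, fc, fp, fm)" by (cases "repr l r s f") auto
  obtain d gc gp gm where rg: "repr l r s g = (d, gc, gp, gm)" by (cases "repr l r s g") auto
  have hr: "has_repr l r s h (a * c + b * d, \<lambda>x. a * fc x + b * gc x, \<lambda>x. a * fp x + b * gp x, \<lambda>x. a * fm x + b * gm x)"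
    by (rule has_repr_lin[OF _ _ h])
      (use has_repr_repr[OF f] has_repr_repr[OF g] rf rg in auto)
  then show "h \<in> S_space l r s" by (auto simp: S_space_def)
  from der_unique[OF hr] show "AE y in lborel. der h y = a * der f y + b * der g y" "base h = a * base f + b * base g"
    by (auto simp: glue_lin base_def der_def rf rg)
qed

lemma E_form_eq:
  assumes f: "f \<in> S_space l r s" and g: "g \<in> S_space l r s"
  shows "E_form l r s f g = (\<integral>y. der f y * der g y \<partial>lborel) / 2"
  using has_repr_repr[OF f] has_repr_repr[OF g]
  by (cases "repr l r s f"; cases "repr l r s g")
    (auto simp: E_form_def der_def has_repr_iff integral_glue[symmetric])

text \<open>\<open>H\<close> may vary inside the gaps, so it is a competitor for the derivative used
  by the form and gives an upper bound. It is applied to derivatives that are not known to be glued: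
  one from Radon--Nikodym, and differences with a mean square limit.\<close>

lemma S_space_of_prim:
  assumes H: "sq_integrable lborel H" and f: "\<And>x. x \<in> I \<Longrightarrow> f x = c + prim H (s x)"
  shows "f \<in> S_space l r s" "E_form l r s f f \<le> (\<integral>y. (H y)\<^sup>2 \<partial>lborel) / 2"
proof -
  obtain gc gp gm where hr: "has_repr l r s f (c, gc, gp, gm)"
    and le: "(\<integral>y. (glue gc gp gm y)\<^sup>2 \<partial>lborel) \<le> (\<integral>y. (H y)\<^sup>2 \<partial>lborel)"
    by (rule repr_of_prim[OF H f])
  show S: "f \<in> S_space l r s" using hr by (auto simp: S_space_def)
  have gl: "sq_integrable lborel (glue gc gp gm)" using hr by (auto simp: has_repr_iff glue_sq_integrable)
  have "E_form l r s f f = (\<integral>y. (der f y)\<^sup>2 \<partial>lborel) / 2"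
    by (simp add: E_form_eq[OF S S] power2_eq_square)
  also have "(\<integral>y. (der f y)\<^sup>2 \<partial>lborel) = (\<integral>y. (glue gc gp gm y)\<^sup>2 \<partial>lborel)"
    using der_unique(2)[OF hr] gl der_sq_integrable[OF S]
    by (intro integral_cong_AE) (auto simp: sq_integrable_def)
  finally show "E_form l r s f f \<le> (\<integral>y. (H y)\<^sup>2 \<partial>lborel) / 2" using le by simp
qed

lemma E_form_lin:
  assumes f: "f \<in> S_space l r s" and g: "g \<in> S_space l r s" and k: "k \<in> S_space l r s"
    and h: "\<And>x. x \<in> I \<Longrightarrow> h x = a * f x + b * g x"
  shows "E_form l r s h k = a * E_form l r s f k + b * E_form l r s g k"
proof -
  note hS = S_space_lin[OF f g h]
  note [measurable] = der_sq_integrable[unfolded sq_integrable_def, THEN conjunct1, OF f]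
    der_sq_integrable[unfolded sq_integrable_def, THEN conjunct1, OF g]
    der_sq_integrable[unfolded sq_integrable_def, THEN conjunct1, OF hS]
    der_sq_integrable[unfolded sq_integrable_def, THEN conjunct1, OF k]
  have "(\<integral>y. der h y * der k y \<partial>lborel) = (\<integral>y. a * (der f y * der k y) + b * (der g y * der k y) \<partial>lborel)"
    using der_lin[OF f g h]
    by (intro integral_cong_AE) (measurable, auto elim!: eventually_mono simp: algebra_simps)
  then show ?thesis
    using sq_integrable_mult[OF der_sq_integrable[OF f] der_sq_integrable[OF k]]
      sq_integrable_mult[OF der_sq_integrable[OF g] der_sq_integrable[OF k]]
    by (simp add: E_form_eq f g k hS field_simps)
qed

lemma E_form_zero:
  assumes f: "f \<in> S_space l r s" and "\<And>x. x \<in> I \<Longrightarrow> f x = 0"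
  shows "E_form l r s f f = 0"
proof -
  have "f x = 0 * f x + 0 * f x" if "x \<in> I" for x using assms(2)[OF that] by simp
  from E_form_lin[OF f f f this] show ?thesis by simp
qed

end

section \<open>Boundary values, the form domain and the unit contraction\<close>

context scale_function
begin

text \<open>The points at which \<open>s\<close> has a finite value or limit. They include
  \<open>I0\<close> and also the approachable ends outside it, where functions of the domain must
  vanish.\<close>

definition I_appr :: "ereal set" where
  "I_appr = {y \<in> {l..r}. (y = l \<longrightarrow> approachable_l l r s) \<and> (y = r \<longrightarrow> approachable_r l r s)}"

text \<open>At an end that is not approachable \<open>real_of_ereal\<close> replaces an infinite
  value by the default 0, so the evaluation lemmas ask for a point of \<open>I_appr\<close>.\<close>

definition s_ext :: "ereal \<Rightarrow> real" where
  "s_ext y = (if y = l then real_of_ereal (s_bot l r s) else if y = r then real_of_ereal (s_top l r s)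
    else s (real_of_ereal y))"

lemma l_less_r: "l < r"
  using lr by (rule less_trans)

lemma end_points_distinct [simp]: "l \<noteq> r" "r \<noteq> l"
  using l_less_r by auto

lemma in_I_iff: "x \<in> I \<longleftrightarrow> l < ereal x \<and> ereal x < r"
  by (simp add: intv_def)

lemma interior_cases:
  assumes "l < y" "y < r"
  obtains x where "y = ereal x" "x \<in> I"
  using assms by (cases y) (auto simp: in_I_iff)

text \<open>The pulled-back filter treats a finite and an infinite end alike.\<close>

lemma eventually_right_end:
  "b < r \<Longrightarrow> \<forall>\<^sub>F w in filtercomap ereal (at_left r). b < ereal w \<and> ereal w < r"
  unfolding eventually_filtercomap
  by (intro exI[of _ "\<lambda>y. b < y \<and> y < r"]) (auto simp: eventually_at_left intro!: exI[of _ b])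

lemma eventually_left_end:
  "l < b \<Longrightarrow> \<forall>\<^sub>F w in filtercomap ereal (at_right l). l < ereal w \<and> ereal w < b"
  unfolding eventually_filtercomap
  by (intro exI[of _ "\<lambda>y. l < y \<and> y < b"]) (auto simp: eventually_at_right intro!: exI[of _ b])

lemma right_end_nontrivial: "filtercomap ereal (at_left r) \<noteq> bot"
proof (rule filtercomap_neq_bot)
  fix P assume "eventually P (at_left r)"
  then obtain b where "b < r" "\<And>y. b < y \<Longrightarrow> y < r \<Longrightarrow> P y"
    using eventually_at_left[OF lr(2)] by blast
  then show "\<exists>x. P (ereal x)" using ereal_dense2[of b r] by blast
qed

lemma left_end_nontrivial: "filtercomap ereal (at_right l) \<noteq> bot"
proof (rule filtercomap_neq_bot)
  fix P assume "eventually P (at_right l)"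
  then obtain b where "l < b" "\<And>y. l < y \<Longrightarrow> y < b \<Longrightarrow> P y"
    using eventually_at_right[OF lr(1)] by blast
  then show "\<exists>x. P (ereal x)" using ereal_dense2[of l b] by blast
qed

lemma s_tendsto_right_end:
  assumes "approachable_r l r s"
  shows "(s \<longlongrightarrow> real_of_ereal (s_top l r s)) (filtercomap ereal (at_left r))"
proof -
  have "ereal (s 0) \<le> s_top l r s" unfolding s_top_def by (rule SUP_upper) simp
  with assms obtain S where S: "s_top l r s = ereal S"
    unfolding approachable_r_def by (cases "s_top l r s") auto
  show ?thesis unfolding S real_of_ereal.simps
  proof (rule order_tendstoI)
    fix a assume "a < S"
    then have "ereal a < s_top l r s" by (simp add: S)
    then obtain x where x: "x \<in> I" "a < s x" unfolding s_top_def less_SUP_iff by auto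
    then have "ereal x < r" by (simp add: in_I_iff)
    from eventually_right_end[OF this]
    show "\<forall>\<^sub>F w in filtercomap ereal (at_left r). a < s w"
    proof eventually_elim
      case (elim w)
      then have "w \<in> I" using x(1) by (auto simp: in_I_iff intro: less_trans[of l "ereal x"])
      then show ?case using mono[OF x(1), of w] elim x(2) by simp
    qed
  next
    fix a assume "S < a"
    have "s w < a" if "w \<in> I" for w
    proof -
      have "ereal (s w) \<le> s_top l r s" unfolding s_top_def using that by (rule SUP_upper)
      then show ?thesis using \<open>S < a\<close> by (simp add: S)
    qed
    then show "\<forall>\<^sub>F w in filtercomap ereal (at_left r). s w < a"
      using eventually_right_end[OF l_less_r] by (auto simp: in_I_iff elim!: eventually_mono)
  qed
qed

lemma s_tendsto_left_end:
  assumes "approachable_l l r s"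
  shows "(s \<longlongrightarrow> real_of_ereal (s_bot l r s)) (filtercomap ereal (at_right l))"
proof -
  have "s_bot l r s \<le> ereal (s 0)" unfolding s_bot_def by (rule INF_lower) simp
  with assms obtain S where S: "s_bot l r s = ereal S"
    unfolding approachable_l_def by (cases "s_bot l r s") auto
  show ?thesis unfolding S real_of_ereal.simps
  proof (rule order_tendstoI)
    fix a assume "S < a"
    then have "s_bot l r s < ereal a" by (simp add: S)
    then obtain x where x: "x \<in> I" "s x < a" unfolding s_bot_def INF_less_iff by auto
    then have "l < ereal x" by (simp add: in_I_iff)
    from eventually_left_end[OF this]
    show "\<forall>\<^sub>F w in filtercomap ereal (at_right l). s w < a"
    proof eventually_elim
      case (elim w)
      then have "w \<in> I" using x(1) less_trans[of "ereal w" "ereal x" r] by (auto simp: in_I_iff)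
      then show ?case using mono[OF _ x(1), of w] elim x(2) by simp
    qed
  next
    fix a assume "a < S"
    have "a < s w" if "w \<in> I" for w
    proof -
      have "s_bot l r s \<le> ereal (s w)" unfolding s_bot_def using that by (rule INF_lower)
      then show ?thesis using \<open>a < S\<close> by (simp add: S)
    qed
    then show "\<forall>\<^sub>F w in filtercomap ereal (at_right l). a < s w"
      using eventually_left_end[OF l_less_r] by (auto simp: in_I_iff elim!: eventually_mono)
  qed
qed

lemma ext_interior: "x \<in> I \<Longrightarrow> ext l r f (ereal x) = f x"
  by (auto simp: ext_def in_I_iff)

text \<open>Continuity of \<open>h\<close> turns the boundary limit into an evaluation at
  \<open>s_ext y\<close>, so that identities between functions on \<open>(l,r)\<close> extend to the
  approachable ends.\<close>

lemma ext_eq: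
  assumes h: "\<And>z. isCont h z" and f: "\<And>x. x \<in> I \<Longrightarrow> f x = h (s x)" and y: "y \<in> I_appr"
  shows "ext l r f y = h (s_ext y)"
proof -
  consider "y = l" "approachable_l l r s" | "y = r" "approachable_r l r s" | x where "y = ereal x" "x \<in> I"
  proof (cases "y = l \<or> y = r")
    case True
    then show thesis using y that(1,2) by (auto simp: I_appr_def)
  next
    case False
    then have "l < y" "y < r" using y by (auto simp: I_appr_def)
    then show thesis using that(3) by (rule interior_cases)
  qed
  then show ?thesis
  proof cases
    case 1
    have "((\<lambda>w. h (s w)) \<longlongrightarrow> h (s_ext l)) (filtercomap ereal (at_right l))"
      using isCont_tendsto_compose[OF h s_tendsto_left_end[OF 1(2)]] by (simp add: s_ext_def)
    then have "(f \<longlongrightarrow> h (s_ext l)) (filtercomap ereal (at_right l))"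
      by (rule Lim_transform_eventually)
        (use eventually_left_end[OF l_less_r] f in \<open>auto simp: in_I_iff elim!: eventually_mono\<close>)
    from tendsto_Lim[OF left_end_nontrivial this] show ?thesis using 1 by (simp add: ext_def)
  next
    case 2
    have "((\<lambda>w. h (s w)) \<longlongrightarrow> h (s_ext r)) (filtercomap ereal (at_left r))"
      using isCont_tendsto_compose[OF h s_tendsto_right_end[OF 2(2)]] l_less_r by (simp add: s_ext_def)
    then have "(f \<longlongrightarrow> h (s_ext r)) (filtercomap ereal (at_left r))"
      by (rule Lim_transform_eventually)
        (use eventually_right_end[OF l_less_r] f in \<open>auto simp: in_I_iff elim!: eventually_mono\<close>)
    from tendsto_Lim[OF right_end_nontrivial this] show ?thesis using 2 l_less_r by (simp add: ext_def)
  next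
    case 3
    then show ?thesis using f ext_interior[of x f] by (auto simp: s_ext_def in_I_iff)
  qed
qed

lemma isCont_prim: "sq_integrable lborel G \<Longrightarrow> isCont (prim G) z"
  using prim_continuous[of G] by (simp add: continuous_on_eq_continuous_at)

lemma ext_prim:
  assumes "sq_integrable lborel G" "\<And>x. x \<in> I \<Longrightarrow> f x = c + prim G (s x)" "y \<in> I_appr"
  shows "ext l r f y = c + prim G (s_ext y)"
  using assms by (intro ext_eq[where h="\<lambda>z. c + prim G z"]) (auto intro!: continuous_intros isCont_prim)

lemma ext_S_space:
  assumes "f \<in> S_space l r s" "y \<in> I_appr"
  shows "ext l r f y = base f + prim (der f) (s_ext y)"
  using der_sq_integrable[OF assms(1)] S_space_eq[OF assms(1)] assms(2) by (rule ext_prim)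

lemma ext_lin:
  assumes f: "f \<in> S_space l r s" and g: "g \<in> S_space l r s"
    and h: "\<And>x. x \<in> I \<Longrightarrow> h x = a * f x + b * g x" and y: "y \<in> I_appr"
  shows "ext l r h y = a * ext l r f y + b * ext l r g y"
  unfolding ext_S_space[OF f y] ext_S_space[OF g y]
  by (rule ext_eq[where h="\<lambda>z. a * (base f + prim (der f) z) + b * (base g + prim (der g) z)", OF _ _ y])
    (auto intro!: continuous_intros isCont_prim der_sq_integrable f g simp: h S_space_eq[OF f] S_space_eq[OF g])

lemma ext_measurable:
  assumes f: "f \<in> S_space l r s"
  shows "ext l r f \<in> borel_measurable borel"
proof -
  let ?h = "\<lambda>z. base f + prim (der f) z"
  have "?h \<in> borel_measurable borel"
    by (intro borel_measurable_continuous_onI continuous_intros prim_continuous der_sq_integrable f)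
  then have "(\<lambda>x. ?h (s x)) \<in> borel_measurable (restrict_space borel I)"
    by (rule measurable_compose[OF s_measurable])
  then have [measurable]: "(\<lambda>x. indicator I x * ?h (s x)) \<in> borel_measurable borel"
    using open_I by (subst (asm) borel_measurable_restrict_space_iff) (auto simp: ac_simps)
  \<comment> \<open>The ends contribute two constants, whatever \<open>Lim\<close> returns there in
    the absence of a limit.\<close>
  have "ext l r f = (\<lambda>y. if y = l then ext l r f l else if y = r then ext l r f r
      else if l < y \<and> y < r then indicator I (real_of_ereal y) * ?h (s (real_of_ereal y)) else 0)"
  proof
    fix y
    show "ext l r f y = (if y = l then ext l r f l else if y = r then ext l r f r
      else if l < y \<and> y < r then indicator I (real_of_ereal y) * ?h (s (real_of_ereal y)) else 0)"
    proof (cases "l < y \<and> y < r")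
      case True
      then obtain x where "y = ereal x" "x \<in> I" using interior_cases by blast
      with True show ?thesis using S_space_eq[OF f] by (auto simp: ext_interior)
    qed (auto simp: ext_def)
  qed
  also have "\<dots> \<in> borel_measurable borel" by measurable
  finally show ?thesis .
qed

end

section \<open>The form domain and the contraction property\<close>

locale dirichlet_setting = scale_function +
  fixes m :: "ereal measure"
  assumes nonconst: "\<exists>x\<in>intv l r. \<exists>y\<in>intv l r. s x \<noteq> s y"
    and m_sets [simp, measurable_cong]: "sets m = sets borel"
    and m_loc_fin: "\<And>a b. l < ereal a \<Longrightarrow> ereal b < r \<Longrightarrow> emeasure m {ereal a..ereal b} < \<infinity>"
    and DK: "cond_DK l r s m"
    and DM: "cond_DM l r s m"
begin

abbreviation "K0 \<equiv> I0 l r s m"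
abbreviation "M \<equiv> m0 l r s m"
abbreviation "F \<equiv> F_space l r s m"
abbreviation "S \<equiv> S_space l r s"
abbreviation "E \<equiv> E_form l r s"

lemma K0_borel [measurable]: "K0 \<in> sets borel"
proof -
  have "finite ({j. j = l \<and> \<not> reflecting_l l r s m} \<union> {j. j = r \<and> \<not> reflecting_r l r s m})" by simp
  then have "{j. j = l \<and> \<not> reflecting_l l r s m} \<union> {j. j = r \<and> \<not> reflecting_r l r s m} \<in> sets borel"
    by (intro borel_closed finite_imp_closed)
  then show ?thesis unfolding I0_def by (intro sets.Diff) auto
qed

lemma K0_iff: "y \<in> K0 \<longleftrightarrow> l \<le> y \<and> y \<le> r \<and> (y = l \<longrightarrow> reflecting_l l r s m) \<and> (y = r \<longrightarrow> reflecting_r l r s m)"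
  by (auto simp: I0_def)

lemma K0_I_appr: "y \<in> K0 \<Longrightarrow> y \<in> I_appr"
  by (auto simp: K0_iff I_appr_def reflecting_l_def reflecting_r_def regular_l_def regular_r_def)

lemma interior_K0: "l < y \<Longrightarrow> y < r \<Longrightarrow> y \<in> K0"
  by (auto simp: K0_iff)

lemma sets_M [simp, measurable_cong]: "sets M = sets borel"
  by (simp add: m0_def)

lemma AE_M_iff: "(AE y in M. P y) \<longleftrightarrow> (AE y in m. y \<in> K0 \<longrightarrow> P y)"
proof -
  have "(AE y in M. P y) \<longleftrightarrow> (AE y in m. 0 < (indicator K0 y :: ennreal) \<longrightarrow> P y)"
    unfolding m0_def by (rule AE_density) measurable
  also have "\<dots> \<longleftrightarrow> (AE y in m. y \<in> K0 \<longrightarrow> P y)"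
    by (rule AE_cong) (simp add: indicator_def)
  finally show ?thesis .
qed

lemma AE_M_I: "(\<And>y. y \<in> K0 \<Longrightarrow> P y) \<Longrightarrow> AE y in M. P y"
  by (simp add: AE_M_iff)

lemma F_iff:
  "f \<in> F \<longleftrightarrow> f \<in> S \<and> sq_integrable M (ext l r f) \<and> (\<forall>j\<in>I_appr - K0. ext l r f j = 0)"
proof -
  have "(\<forall>j\<in>I_appr - K0. ext l r f j = 0) \<longleftrightarrow>
      (l \<notin> K0 \<and> approachable_l l r s \<longrightarrow> ext l r f l = 0) \<and> (r \<notin> K0 \<and> approachable_r l r s \<longrightarrow> ext l r f r = 0)"
    using l_less_r by (auto simp: I_appr_def K0_iff)
  then show ?thesis unfolding F_space_def sq_integrable_def by auto
qed

lemma F_S: "f \<in> F \<Longrightarrow> f \<in> S"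
  by (simp add: F_iff)

lemma F_lin:
  assumes f: "f \<in> F" and g: "g \<in> F" and h: "\<And>x. x \<in> I \<Longrightarrow> h x = a * f x + b * g x"
  shows "h \<in> F"
proof -
  have fS: "f \<in> S" and gS: "g \<in> S" using f g by (auto simp: F_iff)
  note hS = S_space_lin[OF fS gS h]
  have ex: "ext l r h y = a * ext l r f y + b * ext l r g y" if "y \<in> I_appr" for y
    by (rule ext_lin[OF fS gS h that])
  have "sq_integrable M (\<lambda>y. a * ext l r f y + b * ext l r g y)"
    using f g by (intro sq_integrable_add sq_integrable_scale) (auto simp: F_iff)
  then have "sq_integrable M (ext l r h)"
    by (rule sq_integrable_bound(1))
      (use ext_measurable[OF hS] ex K0_I_appr in \<open>auto intro!: AE_M_I cong: measurable_cong_sets\<close>)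
  then show ?thesis using f g hS ex by (auto simp: F_iff)
qed

lemma E_nonneg: "f \<in> S \<Longrightarrow> 0 \<le> E f f"
  by (simp add: E_form_eq)

lemma E_self: "f \<in> S \<Longrightarrow> (\<integral>y. (der f y)\<^sup>2 \<partial>lborel) = 2 * E f f"
  by (simp add: E_form_eq power2_eq_square)

lemma markov:
  assumes f: "f \<in> F"
  defines "g \<equiv> \<lambda>x. min 1 (max 0 (f x))"
  shows "g \<in> F" "\<And>y. y \<in> I_appr \<Longrightarrow> ext l r g y = min 1 (max 0 (ext l r f y))" "E g g \<le> E f f"
proof -
  have fS: "f \<in> S" using f by (simp add: F_iff)
  define h where "h z = base f + prim (der f) z" for z
  define u where "u z = min 1 (max 0 (h z))" for z
  have "\<bar>u b - u a\<bar> \<le> \<bar>prim (der f) b - prim (der f) a\<bar>" for a b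
    by (auto simp: u_def h_def min_def max_def)
  from primitive_of_dominated_increments[OF der_sq_integrable[OF fS] this]
  obtain K where K: "sq_integrable lborel K" "AE y in lborel. \<bar>K y\<bar> \<le> \<bar>der f y\<bar>"
    and uK: "\<And>z. u z = u 0 + prim K z" by blast
  have gu: "g x = u 0 + prim K (s x)" if "x \<in> I" for x
    using S_space_eq[OF fS that] uK[of "s x"] by (simp add: g_def u_def h_def)
  note gS = S_space_of_prim[OF K(1) gu]
  \<comment> \<open>On half a gap \<open>h\<close> is affine but its truncation need not be, so
    \<open>K\<close> is in general not the derivative that enters the form; an inequality
    suffices.\<close>
  have "E g g \<le> (\<integral>y. (K y)\<^sup>2 \<partial>lborel) / 2" by (rule gS(2))
  also have "\<dots> \<le> (\<integral>y. (der f y)\<^sup>2 \<partial>lborel) / 2"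
    using sq_integrable_bound(2)[OF der_sq_integrable[OF fS] _ K(2)] K(1) by (simp add: sq_integrable_def)
  finally show "E g g \<le> E f f" by (simp add: E_self[OF fS])
  show ex: "ext l r g y = min 1 (max 0 (ext l r f y))" if y: "y \<in> I_appr" for y
    using ext_prim[OF K(1) gu y] uK[of "s_ext y"] ext_S_space[OF fS y] by (simp add: u_def h_def)
  have "sq_integrable M (ext l r f)" using f by (simp add: F_iff)
  then have "sq_integrable M (ext l r g)"
    by (rule sq_integrable_bound(1))
      (use ext_measurable[OF gS(1)] ex K0_I_appr in \<open>auto intro!: AE_M_I cong: measurable_cong_sets\<close>)
  then show "g \<in> F" using gS(1) ex f by (auto simp: F_iff)
qed

end

section \<open>Classes vanishing almost everywhere\<close>

text \<open>\<open>d\<close> is the infimum of the complement to the right of \<open>x\<close>. With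
  the mirror image this yields the two ends of the component of an open set around
  \<open>x\<close>.\<close>

lemma first_exit_right:
  fixes W :: "ereal set"
  assumes "open W" "x \<in> W" "x < z" "z \<notin> W"
  obtains d where "x < d" "d \<le> z" "{x..<d} \<subseteq> W" "d \<notin> W"
proof -
  let ?B = "{b. x < b \<and> b \<notin> W}"
  have ex: "\<exists>e>a. {a..<e} \<subseteq> W" if "a \<in> W" "a < z" for a
    using open_right[OF assms(1) that] by blast
  have stay: "e \<le> Inf ?B" if "a < e" "{a..<e} \<subseteq> W" "a \<in> W" "a < z" "\<And>b. b \<in> ?B \<Longrightarrow> a \<le> b" for a e
  proof (rule Inf_greatest)
    fix b assume "b \<in> ?B"
    with that show "e \<le> b" by (metis atLeastLessThan_iff linorder_not_le mem_Collect_eq subsetD)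
  qed
  have z: "Inf ?B \<le> z" using assms by (intro Inf_lower) auto
  obtain e where e: "x < e" "{x..<e} \<subseteq> W" using ex assms by blast
  have "e \<le> Inf ?B" by (rule stay[OF e assms(2,3)]) auto
  with e(1) have x: "x < Inf ?B" by (rule less_le_trans)
  have "{x..<Inf ?B} \<subseteq> W"
  proof
    fix y assume y: "y \<in> {x..<Inf ?B}"
    show "y \<in> W"
    proof (rule ccontr)
      assume "y \<notin> W"
      with y assms(2) have "x < y" by (cases "x = y") auto
      with \<open>y \<notin> W\<close> have "Inf ?B \<le> y" by (intro Inf_lower) auto
      with y show False by auto
    qed
  qed
  moreover have "Inf ?B \<notin> W"
  proof
    assume W: "Inf ?B \<in> W"
    then have "Inf ?B < z" using z assms(4) by (cases "Inf ?B = z") auto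
    with ex W obtain e where e: "Inf ?B < e" "{Inf ?B..<e} \<subseteq> W" by blast
    have "e \<le> Inf ?B"
      by (rule stay[OF e W \<open>Inf ?B < z\<close>]) (rule Inf_lower)
    with e(1) show False by simp
  qed
  ultimately show thesis using that x z by blast
qed

lemma first_exit_left:
  fixes W :: "ereal set"
  assumes "open W" "x \<in> W" "z < x" "z \<notin> W"
  obtains c where "c < x" "z \<le> c" "{c<..x} \<subseteq> W" "c \<notin> W"
proof -
  have "open (uminus -` W)"
    by (rule open_vimage[OF assms(1)]) (intro continuous_intros)
  then obtain d where d: "- x < d" "d \<le> - z" "{- x..<d} \<subseteq> uminus -` W" "d \<notin> uminus -` W"
    using first_exit_right[of "uminus -` W" "- x" "- z"] assms by (auto simp: ereal_minus_less_minus)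
  show thesis
  proof (rule that[of "- d"])
    show "- d < x" using d(1) by (simp add: ereal_uminus_less_reorder)
    show "z \<le> - d" using d(2) by (metis ereal_minus_le_minus ereal_uminus_uminus)
    show "- d \<notin> W" using d(4) by simp
    show "{- d<..x} \<subseteq> W"
    proof
      fix y assume "y \<in> {- d<..x}"
      then have "- y \<in> {- x..<d}" by (auto simp: ereal_uminus_less_reorder)
      with d(3) show "y \<in> W" by fastforce
    qed
  qed
qed

context dirichlet_setting
begin

text \<open>The union of the constancy intervals, without the ends of \<open>I\<close>.\<close>

definition "W = Ucon l r s - {l, r}"

lemma W_E:
  assumes "y \<in> W"
  obtains V where "open V" "y \<in> V" "V \<subseteq> W"
    "\<forall>a\<in>I. \<forall>b\<in>I. ereal a \<in> V \<longrightarrow> ereal b \<in> V \<longrightarrow> s a = s b"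
proof -
  obtain V where V: "open V" "y \<in> V" "\<forall>a\<in>I. \<forall>b\<in>I. ereal a \<in> V \<longrightarrow> ereal b \<in> V \<longrightarrow> s a = s b"
    and y: "l < y" "y < r"
    using assms by (auto simp: W_def Ucon_def less_le)
  show thesis
  proof (rule that[of "V \<inter> {l<..<r}"])
    show "V \<inter> {l<..<r} \<subseteq> W" using V(1,3) unfolding W_def Ucon_def by fastforce
    show "\<forall>a\<in>I. \<forall>b\<in>I. ereal a \<in> V \<inter> {l<..<r} \<longrightarrow> ereal b \<in> V \<inter> {l<..<r} \<longrightarrow> s a = s b"
      using V(3) by blast
  qed (use V(1,2) y in auto)
qed

lemma W_interior: "y \<in> W \<Longrightarrow> l < y \<and> y < r"
  by (auto simp: W_def Ucon_def less_le)

lemma open_W: "open W"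
  by (subst open_subopen) (meson W_E)

lemma const_on_W:
  assumes "{c<..<d} \<subseteq> W" "c < ereal a" "ereal a < d" "c < ereal b" "ereal b < d"
  shows "s a = s b"
proof (rule connected_local_const[where A="einterval c d" and f=s])
  show "connected (einterval c d)"
    by (rule convex_connected) (auto simp: is_interval_convex_1[symmetric] is_interval_1 einterval_iff
        intro: less_le_trans le_less_trans simp flip: ereal_less_eq(3))
  show "\<forall>x\<in>einterval c d. \<forall>\<^sub>F y in at x within einterval c d. s x = s y"
  proof
    fix x assume "x \<in> einterval c d"
    then have "ereal x \<in> W" using assms(1) by (auto simp: einterval_iff)
    then obtain V where V: "open V" "ereal x \<in> V" "V \<subseteq> W"
      "\<forall>a\<in>I. \<forall>b\<in>I. ereal a \<in> V \<longrightarrow> ereal b \<in> V \<longrightarrow> s a = s b" by (rule W_E)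
    have VI: "w \<in> I" if "ereal w \<in> V" for w
      using that V(3) W_interior by (auto simp: in_I_iff)
    have "open (ereal -` V)" using V(1) by (rule open_ereal_vimage)
    then have "\<forall>\<^sub>F y in nhds x. y \<in> ereal -` V" using V(2) by (intro eventually_nhds_in_open) auto
    then have "\<forall>\<^sub>F y in nhds x. s x = s y"
    proof eventually_elim
      case (elim y)
      then show ?case using V(2) by (intro V(4)[rule_format] VI) auto
    qed
    then show "\<forall>\<^sub>F y in at x within einterval c d. s x = s y"
      unfolding eventually_at_filter by (rule eventually_mono) simp
  qed
qed (use assms in \<open>auto simp: einterval_iff\<close>)

lemma off_W_charged:
  assumes "x \<in> I" "ereal x \<notin> W" "open V" "ereal x \<in> V"
  shows "emeasure m V > 0"
proof -
  have "ereal x \<in> {l..r} - Ucon l r s" using assms by (auto simp: W_def in_I_iff)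
  then show ?thesis using DM assms(3,4) unfolding cond_DM_def msupp_def by blast
qed

lemma exists_off_W: "\<exists>x\<in>I. ereal x \<notin> W"
proof (rule ccontr)
  assume "\<not> ?thesis"
  then have "{l<..<r} \<subseteq> W" using interior_cases by fastforce
  then have "s a = s b" if "a \<in> I" "b \<in> I" for a b
    using const_on_W that by (auto simp: in_I_iff)
  with nonconst show False by blast
qed

lemma zero_on_charged:
  assumes z: "AE y in M. ext l r f y = 0" and A: "A \<in> sets borel" "A \<subseteq> K0" "emeasure m A > 0"
  obtains y where "y \<in> A" "ext l r f y = 0"
proof (rule ccontr)
  assume *: "\<not> thesis"
  have "AE y in m. y \<in> K0 \<longrightarrow> ext l r f y = 0" using z by (simp add: AE_M_iff)
  then have "AE y in m. y \<notin> A"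
    by eventually_elim (use A(2) that * in blast)
  then have "emeasure m A = 0" using A(1) by (subst (asm) AE_iff_null_sets[symmetric]) auto
  with A(3) show False by simp
qed

text \<open>The support condition yields zeros close to \<open>x\<close>, but not on a prescribed
  side of it; a conclusion about \<open>f x\<close> itself therefore needs continuity of
  \<open>s\<close> at \<open>x\<close>.\<close>

lemma zero_near_off_W:
  assumes z: "AE y in M. ext l r f y = 0" and x: "x \<in> I" "ereal x \<notin> W" and ab: "a < x" "x < b"
  obtains w where "a < w" "w < b" "w \<in> I" "f w = 0"
proof -
  let ?V = "{max l (ereal a)<..<min r (ereal b)}"
  have "emeasure m ?V > 0"
    by (rule off_W_charged[OF x]) (use x ab in \<open>auto simp: in_I_iff\<close>)
  moreover have "?V \<subseteq> K0" using interior_K0 by auto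
  ultimately obtain y where y: "y \<in> ?V" "ext l r f y = 0"
    using zero_on_charged[OF z, of ?V] by auto
  then obtain w where w: "y = ereal w" "w \<in> I" using interior_cases[of y] by auto
  show thesis using that[of w] y w by (auto simp: ext_interior)
qed

lemma vanishing_class:
  assumes f: "f \<in> S" and z: "AE y in M. ext l r f y = 0" and x: "x \<in> I"
  shows "f x = 0"
proof -
  define h where "h z = base f + prim (der f) z" for z
  have h: "isCont h z" for z
    unfolding h_def by (intro continuous_intros isCont_prim der_sq_integrable f)
  have fh: "f w = h (s w)" if "w \<in> I" for w using S_space_eq[OF f that] by (simp add: h_def)
  have evI: "\<forall>\<^sub>F w in at w0 within A. w \<in> I" if "w0 \<in> I" for w0 A
    using open_I that by (auto simp: eventually_at_topological)
  have zero_point: "h (s w) = 0" if w: "w \<in> I" "ereal w \<notin> W" and nj: "w \<notin> Djump l r s" for w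
  proof (rule ccontr)
    assume nz: "h (s w) \<noteq> 0"
    have "sR s w = s w" "sL s w = s w" using nj w(1) by (auto simp: Djump_def Dp_def Dm_def)
    then have "isCont s w"
      using tendsto_sR(1)[OF w(1)] tendsto_sL(1)[OF w(1)] by (simp add: isCont_def filterlim_split_at)
    then have "isCont (\<lambda>w. h (s w)) w" by (intro isCont_o2[OF _ h])
    then have "\<forall>\<^sub>F v in nhds w. h (s v) \<noteq> 0"
      using nz tendsto_imp_eventually_ne[OF iffD1[OF tendsto_at_iff_tendsto_nhds[of "\<lambda>w. h (s w)" w]]]
      by (simp add: isCont_def)
    then obtain e where e: "e > 0" "\<And>v. dist v w < e \<Longrightarrow> h (s v) \<noteq> 0"
      unfolding eventually_nhds_metric by auto
    obtain v where "w - e < v" "v < w + e" "v \<in> I" "f v = 0"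
      using zero_near_off_W[OF z w, of "w - e" "w + e"] e(1) by auto
    then show False using e(2)[of v] fh[of v] by (auto simp: dist_real_def)
  qed
  \<comment> \<open>\<open>s\<close> is constant on a component, so one zero of \<open>h\<close> at
    its value is enough. If the component is not isolated, one of its ends is an interior point
    without jump, and \<open>zero_point\<close> applies; otherwise \<open>DM\<close> charges
    \<open>Icd\<close> and \<open>DK\<close> places its ends in \<open>K0\<close>.\<close>
  have comp: "h (s a) = 0" if comp: "component l r s c d" and a: "c < ereal a" "ereal a < d" for c d a
  proof -
    have cd: "c < d" "{c<..<d} \<subseteq> W" "c \<notin> W" "d \<notin> W" using comp by (auto simp: component_def W_def)
    \<comment> \<open>\<open>component\<close> does not say that its ends are in
      \<open>[l,r]\<close>; this follows as \<open>W\<close> lies strictly inside.\<close>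
    have lc: "l \<le> c"
    proof (rule ccontr)
      assume "\<not> l \<le> c"
      then have "c < min l d" using cd(1) by simp
      then obtain y where "c < y" "y < min l d" using dense by blast
      then have "y \<in> W" "y < l" using cd(2) by auto
      then show False using W_interior[of y] by auto
    qed
    have dr: "d \<le> r"
    proof (rule ccontr)
      assume "\<not> d \<le> r"
      then have "max c r < d" using cd(1) by simp
      then obtain y where "max c r < y" "y < d" using dense by blast
      then have "y \<in> W" "r < y" using cd(2) by auto
      then show False using W_interior[of y] by auto
    qed
    have mem: "w \<in> I" if "c < ereal w" "ereal w < d" for w
      using that lc dr by (auto simp: in_I_iff)
    have const: "s w = s a" if "c < ereal w" "ereal w < d" for w
      by (rule const_on_W[OF cd(2) that a])
    have left_val: "s w = s a" if w: "w \<in> I" "c = ereal w" "sR s w = s w" for w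
    proof -
      have "\<forall>\<^sub>F v in at_right w. s v = s a"
        unfolding eventually_at_right_field
      proof (intro exI[of _ a] conjI allI impI)
        show "w < a" using a(1) w(2) by simp
        show "s v = s a" if "w < v" "v < a" for v
          using that a(2) w(2) less_trans[of "ereal v" "ereal a" d] by (intro const) auto
      qed
      then have "(s \<longlongrightarrow> s a) (at_right w)" by (rule tendsto_eventually)
      from tendsto_unique[OF _ tendsto_sR(1)[OF w(1)] this] w(3) show ?thesis by simp
    qed
    have right_val: "s w = s a" if w: "w \<in> I" "d = ereal w" "sL s w = s w" for w
    proof -
      have "\<forall>\<^sub>F v in at_left w. s v = s a"
        unfolding eventually_at_left_field
      proof (intro exI[of _ a] conjI allI impI)
        show "a < w" using a(2) w(2) by simp
        show "s v = s a" if "a < v" "v < w" for v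
          using that a(1) w(2) less_trans[of c "ereal a" "ereal v"] by (intro const) auto
      qed
      then have "(s \<longlongrightarrow> s a) (at_left w)" by (rule tendsto_eventually)
      from tendsto_unique[OF _ tendsto_sL(1)[OF w(1)] this] w(3) show ?thesis by simp
    qed
    have c_int: "\<exists>w. c = ereal w \<and> w \<in> I" if "c \<noteq> l"
      using that lc cd(1) dr interior_cases[of c] by (metis le_neq_trans less_le_trans)
    have d_int: "\<exists>w. d = ereal w \<and> w \<in> I" if "d \<noteq> r"
      using that lc cd(1) dr interior_cases[of d] by (metis le_neq_trans le_less_trans)
    show ?thesis
    proof (cases "isolated l r s c d")
      case False
      with comp consider "c \<notin> ereal ` Djump l r s \<union> {l, r}" | "d \<notin> ereal ` Djump l r s \<union> {l, r}"
        by (auto simp: isolated_def)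
      then show ?thesis
      proof cases
        case 1
        then obtain w where w: "c = ereal w" "w \<in> I" "w \<notin> Djump l r s" using c_int by auto
        then have "s w = s a" by (intro left_val) (auto simp: Djump_def Dp_def)
        with zero_point[OF w(2) _ w(3)] w(1) cd(3) show ?thesis by simp
      next
        case 2
        then obtain w where w: "d = ereal w" "w \<in> I" "w \<notin> Djump l r s" using d_int by auto
        then have "s w = s a" by (intro right_val) (auto simp: Djump_def Dm_def)
        with zero_point[OF w(2) _ w(3)] w(1) cd(4) show ?thesis by simp
      qed
    next
      case iso: True
      have K: "c \<in> K0" "d \<in> K0"
      proof -
        have "c = l \<Longrightarrow> reflecting_l l r s m" "d = r \<Longrightarrow> reflecting_r l r s m"
          using DK iso unfolding cond_DK_def by blast+
        then show "c \<in> K0" "d \<in> K0" using lc dr cd(1) l_less_r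
          by (auto simp: K0_iff intro: order_trans less_imp_le dest: less_le_trans le_less_trans)
      qed
      have sub: "Icd l r s c d \<subseteq> K0"
        using K interior_K0 lc dr unfolding Icd_def by (auto split: if_splits intro: le_less_trans less_le_trans)
      have "emeasure m (Icd l r s c d) > 0" using DM iso unfolding cond_DM_def by blast
      moreover have "Icd l r s c d \<in> sets borel" unfolding Icd_def by auto
      ultimately obtain y where y: "y \<in> Icd l r s c d" "ext l r f y = 0"
        using zero_on_charged[OF z _ sub] by blast
      \<comment> \<open>\<open>Icd\<close> contains an end only if \<open>s\<close> has no jump
        there towards the component, so the value of \<open>s\<close> at this end is that of the
        component.\<close>
      consider "c < y" "y < d" | "y = c" "c \<notin> ereal ` Dp l r s" | "y = d" "d \<notin> ereal ` Dm l r s"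
        using y(1) unfolding Icd_def by (auto split: if_splits)
      then show ?thesis
      proof cases
        case 1
        then have "l < y" "y < r" using lc dr by (auto intro: le_less_trans less_le_trans)
        then obtain w where w: "y = ereal w" "w \<in> I" by (rule interior_cases)
        then show ?thesis using y(2) 1 const[of w] fh[of w] by (simp add: ext_interior)
      next
        case 2
        show ?thesis
        proof (cases "c = l")
          case True
          have "\<forall>\<^sub>F w in filtercomap ereal (at_right l). f w = h (s a)"
            using eventually_left_end[OF cd(1)[unfolded True]]
          proof eventually_elim
            case (elim w)
            then show ?case using const[of w] mem[of w] fh[of w] True by simp
          qed
          then have "(f \<longlongrightarrow> h (s a)) (filtercomap ereal (at_right l))" by (rule tendsto_eventually)
          from tendsto_Lim[OF left_end_nontrivial this] show ?thesis
            using y(2) 2(1) True by (simp add: ext_def)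
        next
          case False
          then obtain w where w: "c = ereal w" "w \<in> I" using c_int by auto
          then have "s w = s a" using 2 by (intro left_val) (auto simp: Dp_def)
          then show ?thesis using y(2) 2(1) w fh[of w] by (simp add: ext_interior)
        qed
      next
        case 3
        show ?thesis
        proof (cases "d = r")
          case True
          have "\<forall>\<^sub>F w in filtercomap ereal (at_left r). f w = h (s a)"
            using eventually_right_end[OF cd(1)[unfolded True]]
          proof eventually_elim
            case (elim w)
            then show ?case using const[of w] mem[of w] fh[of w] True by simp
          qed
          then have "(f \<longlongrightarrow> h (s a)) (filtercomap ereal (at_left r))" by (rule tendsto_eventually)
          from tendsto_Lim[OF right_end_nontrivial this] show ?thesis
            using y(2) 3(1) True by (simp add: ext_def)
        next
          case False
          then obtain w where w: "d = ereal w" "w \<in> I" using d_int by auto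
          then have "s w = s a" using 3 by (intro right_val) (auto simp: Dm_def)
          then show ?thesis using y(2) 3(1) w fh[of w] by (simp add: ext_interior)
        qed
      qed
    qed
  qed
  have on_W: "h (s w) = 0" if w: "ereal w \<in> W" for w
  proof -
    have lw: "l < ereal w" "ereal w < r" using W_interior[OF w] by auto
    have "l \<notin> W" "r \<notin> W" by (auto simp: W_def)
    then obtain c d where c: "c < ereal w" "{c<..ereal w} \<subseteq> W" "c \<notin> W"
      and d: "ereal w < d" "{ereal w..<d} \<subseteq> W" "d \<notin> W"
      using first_exit_left[OF open_W w lw(1)] first_exit_right[OF open_W w lw(2)] by metis
    have "{c<..<d} \<subseteq> W"
    proof
      fix y assume "y \<in> {c<..<d}"
      then show "y \<in> W" using c(2) d(2) by (cases "y \<le> ereal w") auto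
    qed
    then have "component l r s c d"
      using c d less_trans[OF c(1) d(1)] unfolding component_def W_def by auto
    then show ?thesis by (rule comp[OF _ c(1) d(1)])
  qed
  have at_sR: "h (sR s w) = 0" if w: "w \<in> I" for w
  proof (rule ccontr)
    assume "h (sR s w) \<noteq> 0"
    then have "\<forall>\<^sub>F v in at_right w. h (s v) \<noteq> 0"
      by (rule tendsto_imp_eventually_ne[OF isCont_tendsto_compose[OF h tendsto_sR(1)[OF w]]])
    with evI[OF w] have "\<forall>\<^sub>F v in at_right w. v \<in> I \<and> h (s v) \<noteq> 0" by (rule eventually_conj)
    then obtain b where b: "w < b" "\<And>v. w < v \<Longrightarrow> v < b \<Longrightarrow> v \<in> I \<and> h (s v) \<noteq> 0"
      by (auto simp: eventually_at_right_field)
    \<comment> \<open>A small neighbourhood of \<open>v\<close> stays to the right of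
      \<open>w\<close>. If \<open>v\<close> is off \<open>W\<close>, the two-sided statement applied
      at \<open>v\<close> thus gives a zero on the right of \<open>w\<close>.\<close>
    obtain v where v: "w < v" "v < b" using dense[OF b(1)] by auto
    show False
    proof (cases "ereal v \<in> W")
      case True
      then show False using on_W b(2)[OF v] by auto
    next
      case False
      obtain v' where "w < v'" "v' < b" "v' \<in> I" "f v' = 0"
        using zero_near_off_W[OF z _ False v] b(2)[OF v] by auto
      then show False using b(2)[of v'] fh[of v'] by auto
    qed
  qed
  have at_sL: "h (sL s w) = 0" if w: "w \<in> I" for w
  proof (rule ccontr)
    assume "h (sL s w) \<noteq> 0"
    then have "\<forall>\<^sub>F v in at_left w. h (s v) \<noteq> 0"
      by (rule tendsto_imp_eventually_ne[OF isCont_tendsto_compose[OF h tendsto_sL(1)[OF w]]])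
    with evI[OF w] have "\<forall>\<^sub>F v in at_left w. v \<in> I \<and> h (s v) \<noteq> 0" by (rule eventually_conj)
    then obtain b where b: "b < w" "\<And>v. b < v \<Longrightarrow> v < w \<Longrightarrow> v \<in> I \<and> h (s v) \<noteq> 0"
      by (auto simp: eventually_at_left_field)
    obtain v where v: "b < v" "v < w" using dense[OF b(1)] by auto
    show False
    proof (cases "ereal v \<in> W")
      case True
      then show False using on_W b(2)[OF v] by auto
    next
      case False
      obtain v' where "b < v'" "v' < w" "v' \<in> I" "f v' = 0"
        using zero_near_off_W[OF z _ False v] b(2)[OF v] by auto
      then show False using b(2)[of v'] fh[of v'] by auto
    qed
  qed
  show ?thesis
  proof (cases "x \<in> D0 l r s")
    case True
    then have "emeasure m {ereal x} > 0" using DM by (simp add: cond_DM_def)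
    moreover have "{ereal x} \<subseteq> K0" using x interior_K0 by (auto simp: in_I_iff)
    ultimately obtain y where "y \<in> {ereal x}" "ext l r f y = 0"
      using zero_on_charged[OF z, of "{ereal x}"] by auto
    then show ?thesis using ext_interior[OF x, of f] by simp
  next
    case False
    then have "s x = sR s x \<or> s x = sL s x" using x by (auto simp: D0_def Dp_def Dm_def)
    then show ?thesis using at_sR[OF x] at_sL[OF x] fh[OF x] by auto
  qed
qed

section \<open>Completeness\<close>

text \<open>As \<open>s\<close> is not constant, there is an interior point off \<open>W\<close>,
  and \<open>DM\<close> puts it in the support; a compact neighbourhood has positive and finite
  mass. The form is blind to additive constants, and on this set the mean square norm detects them
  because \<open>s\<close> is bounded there.\<close>

lemma compact_charged:
  obtains A C where "A \<in> sets borel" "A \<subseteq> K0" "0 < emeasure m A" "emeasure m A < \<infinity>"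
    "\<forall>y\<in>A. \<bar>s_ext y\<bar> \<le> C"
proof -
  obtain x where x: "x \<in> I" "ereal x \<notin> W" using exists_off_W by blast
  obtain a where a: "a \<in> I" "a < x" using I_left[OF x(1)] .
  obtain b where b: "b \<in> I" "x < b" using I_right[OF x(1)] .
  let ?A = "{ereal a..ereal b}"
  have "0 < emeasure m {ereal a<..<ereal b}"
    using a b by (intro off_W_charged[OF x]) auto
  also have "\<dots> \<le> emeasure m ?A" by (rule emeasure_mono) auto
  finally have "0 < emeasure m ?A" .
  moreover have "emeasure m ?A < \<infinity>" using a b by (intro m_loc_fin) (auto simp: in_I_iff)
  moreover have int: "l < y" "y < r" if "y \<in> ?A" for y
    using that a(1) b(1) by (auto simp: in_I_iff intro: less_le_trans le_less_trans)
  then have "?A \<subseteq> K0" using interior_K0 by blast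
  moreover have "\<bar>s_ext y\<bar> \<le> max \<bar>s a\<bar> \<bar>s b\<bar>" if y: "y \<in> ?A" for y
  proof -
    obtain w where w: "y = ereal w" "w \<in> I" using int[OF y] by (rule interior_cases)
    then have "s a \<le> s w" "s w \<le> s b" using y a(1) b(1) by (auto intro!: mono)
    moreover have "s_ext y = s w" using w by (auto simp: s_ext_def in_I_iff)
    ultimately show ?thesis by auto
  qed
  ultimately show thesis using that[of ?A "max \<bar>s a\<bar> \<bar>s b\<bar>"] by auto
qed

lemma form_complete:
  assumes u: "\<And>n. u n \<in> F"
    and cau: "\<And>e. e > 0 \<Longrightarrow> \<exists>N. \<forall>n\<ge>N. \<forall>k\<ge>N. E (\<lambda>x. u n x - u k x) (\<lambda>x. u n x - u k x)
      + (\<integral>y. (ext l r (\<lambda>x. u n x - u k x) y)\<^sup>2 \<partial>M) < e"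
  obtains f where "f \<in> F" "(\<lambda>n. E (\<lambda>x. u n x - f x) (\<lambda>x. u n x - f x)
      + (\<integral>y. (ext l r (\<lambda>x. u n x - f x) y)\<^sup>2 \<partial>M)) \<longlonglongrightarrow> 0"
proof -
  have uS: "u n \<in> S" for n using u by (rule F_S)
  define D where "D n k = (\<lambda>x. u n x - u k x)" for n k
  have D: "D n k x = 1 * u n x + (-1) * u k x" for n k x by (simp add: D_def)
  have DS: "D n k \<in> S" for n k by (rule S_space_lin[OF uS uS D])
  have DF: "D n k \<in> F" for n k by (rule F_lin[OF u u D])
  have Dext: "ext l r (D n k) y = ext l r (u n) y - ext l r (u k) y" if "y \<in> I_appr" for n k y
    using ext_lin[OF uS uS D that] by simp
  have derD: "(\<integral>y. (der (u n) y - der (u k) y)\<^sup>2 \<partial>lborel) = 2 * E (D n k) (D n k)" for n k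
  proof -
    have [measurable]: "\<And>n. der (u n) \<in> borel_measurable borel" "der (D n k) \<in> borel_measurable borel"
      using der_sq_integrable[OF uS] der_sq_integrable[OF DS] by (auto simp: sq_integrable_def)
    have "(\<integral>y. (der (u n) y - der (u k) y)\<^sup>2 \<partial>lborel) = (\<integral>y. (der (D n k) y)\<^sup>2 \<partial>lborel)"
      using der_lin[OF uS uS D, of n k] by (intro integral_cong_AE) auto
    then show ?thesis by (simp add: E_self[OF DS])
  qed
  have cE: "\<exists>N. \<forall>n\<ge>N. \<forall>k\<ge>N. E (D n k) (D n k) < e \<and> (\<integral>y. (ext l r (D n k) y)\<^sup>2 \<partial>M) < e" if e: "e > 0" for e
  proof -
    obtain N where N: "\<forall>n\<ge>N. \<forall>k\<ge>N. E (D n k) (D n k) + (\<integral>y. (ext l r (D n k) y)\<^sup>2 \<partial>M) < e"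
      using cau[OF e] unfolding D_def by blast
    have "E (D n k) (D n k) < e \<and> (\<integral>y. (ext l r (D n k) y)\<^sup>2 \<partial>M) < e" if "n \<ge> N" "k \<ge> N" for n k
    proof -
      have "0 \<le> (\<integral>y. (ext l r (D n k) y)\<^sup>2 \<partial>M)" by simp
      moreover have "E (D n k) (D n k) + (\<integral>y. (ext l r (D n k) y)\<^sup>2 \<partial>M) < e" using N that by blast
      ultimately show ?thesis using E_nonneg[OF DS[of n k]] by linarith
    qed
    then show ?thesis by blast
  qed
  have "\<exists>N. \<forall>n\<ge>N. \<forall>k\<ge>N. (\<integral>y. (der (u n) y - der (u k) y)\<^sup>2 \<partial>lborel) < e" if "e > 0" for e
    using cE[of "e/2"] that unfolding derD by (auto simp: field_simps) 
  from mean_square_complete[OF der_sq_integrable[OF uS] this]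
  obtain G where G: "sq_integrable lborel G"
    and derG: "(\<lambda>n. \<integral>y. (der (u n) y - G y)\<^sup>2 \<partial>lborel) \<longlonglongrightarrow> 0" by blast
  obtain A C where A: "A \<in> sets borel" "A \<subseteq> K0" "0 < emeasure m A" "emeasure m A < \<infinity>"
    and C: "\<forall>y\<in>A. \<bar>s_ext y\<bar> \<le> C" by (rule compact_charged)
  have mA: "emeasure M A = emeasure m A"
  proof -
    have "emeasure M A = (\<integral>\<^sup>+y. indicator K0 y * indicator A y \<partial>m)"
      unfolding m0_def using A(1) by (intro emeasure_density) auto
    also have "\<dots> = (\<integral>\<^sup>+y. indicator A y \<partial>m)"
      using A(2) by (intro nn_integral_cong) (auto simp: indicator_def)
    finally show ?thesis using A(1) by simp
  qed
  define \<alpha> where "\<alpha> = measure M A"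
  have \<alpha>: "\<alpha> > 0" unfolding \<alpha>_def measure_def mA using A(3,4) by (simp add: enn2real_positive_iff)
  have intA: "integrable M (indicator A :: ereal \<Rightarrow> real)" using A mA by (intro integrable_real_indicator) auto
  have "A \<noteq> {}" using A(3) by auto
  then have C0: "0 \<le> C" using C by (metis abs_ge_zero all_not_in_conv order_trans)
  have base_diff: "(base (u n) - base (u k))\<^sup>2 * \<alpha>
      \<le> 2 * (\<integral>y. (ext l r (D n k) y)\<^sup>2 \<partial>M) + 4 * C * E (D n k) (D n k) * \<alpha>" for n k
  proof -
    let ?b = "base (u n) - base (u k)" and ?E = "E (D n k) (D n k)"
    \<comment> \<open>The constant is the function minus its primitive part \<open>p\<close>. Use
      \<open>(p - q)^2 \<le> 2 p^2 + 2 q^2\<close>; the primitive has square at most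
      \<open>2 C\<close> times the energy, whence the factor \<open>4 C\<close>.\<close>
    have ptw: "?b\<^sup>2 * indicator A y \<le> 2 * (ext l r (D n k) y)\<^sup>2 + 4 * C * ?E * indicator A y" for y
    proof (cases "y \<in> A")
      case True
      let ?p = "prim (der (D n k)) (s_ext y)"
      have "?p\<^sup>2 \<le> \<bar>s_ext y\<bar> * (2 * ?E)"
        using prim_diff_bound[OF der_sq_integrable[OF DS], of n k "s_ext y" 0] by (simp add: E_self[OF DS])
      also have "\<dots> \<le> C * (2 * ?E)" using bspec[OF C True] E_nonneg[OF DS[of n k]] by (intro mult_right_mono) auto
      finally have p: "?p\<^sup>2 \<le> C * (2 * ?E)" .
      have "ext l r (D n k) y = ?b + ?p"
        using ext_S_space[OF DS, of y n k] base_lin[OF uS uS D, of n k] True A(2) K0_I_appr by auto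
      then have "?b = ext l r (D n k) y - ?p" by simp
      moreover have "(p - q)\<^sup>2 \<le> 2 * p\<^sup>2 + 2 * q\<^sup>2" for p q :: real
        using zero_le_power2[of "p + q"] by (simp add: power2_eq_square algebra_simps)
      ultimately have "?b\<^sup>2 \<le> 2 * (ext l r (D n k) y)\<^sup>2 + 2 * ?p\<^sup>2" by (simp only:)
      with p True show ?thesis by simp
    qed simp
    have i1: "integrable M (\<lambda>y. (ext l r (D n k) y)\<^sup>2)" using DF[of n k] by (simp add: F_iff sq_integrable_def)
    have "(\<integral>y. ?b\<^sup>2 * indicator A y \<partial>M) \<le> (\<integral>y. 2 * (ext l r (D n k) y)\<^sup>2 + 4 * C * ?E * indicator A y \<partial>M)"
      using intA i1 ptw by (intro integral_mono) auto
    also have "\<dots> = 2 * (\<integral>y. (ext l r (D n k) y)\<^sup>2 \<partial>M) + 4 * C * ?E * \<alpha>"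
      using intA i1 A(1) by (simp add: \<alpha>_def)
    finally show ?thesis using A(1) by (simp add: \<alpha>_def)
  qed
  have "Cauchy (\<lambda>n. base (u n))"
  proof (rule metric_CauchyI)
    fix e :: real assume e: "e > 0"
    \<comment> \<open>Chosen so that the bound from \<open>base_diff\<close>,
      \<open>(2 + 4 * C * \<alpha>) * \<delta>\<close>, becomes
      \<open>e^2 * \<alpha>\<close>.\<close>
    define \<delta> where "\<delta> = e\<^sup>2 * \<alpha> / (2 + 4 * C * \<alpha>)"
    have den: "2 + 4 * C * \<alpha> > 0" using C0 \<alpha> by (simp add: add_pos_nonneg)
    have "\<delta> > 0" unfolding \<delta>_def using e \<alpha> den by simp
    from cE[OF this] obtain N where N: "\<forall>n\<ge>N. \<forall>k\<ge>N. E (D n k) (D n k) < \<delta> \<and> (\<integral>y. (ext l r (D n k) y)\<^sup>2 \<partial>M) < \<delta>"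
      by blast
    have "dist (base (u n)) (base (u k)) < e" if nk: "n \<ge> N" "k \<ge> N" for n k
    proof -
      have "(base (u n) - base (u k))\<^sup>2 * \<alpha> \<le> 2 * (\<integral>y. (ext l r (D n k) y)\<^sup>2 \<partial>M) + 4 * C * E (D n k) (D n k) * \<alpha>"
        by (rule base_diff)
      also have "\<dots> < 2 * \<delta> + 4 * C * \<delta> * \<alpha>"
      proof (rule add_less_le_mono)
        show "4 * C * E (D n k) (D n k) * \<alpha> \<le> 4 * C * \<delta> * \<alpha>"
          using N nk C0 \<alpha> by (intro mult_right_mono mult_left_mono) (auto intro: less_imp_le)
      qed (use N nk in auto)
      also have "\<dots> = (2 + 4 * C * \<alpha>) * \<delta>" by (simp add: algebra_simps)
      also have "\<dots> = e\<^sup>2 * \<alpha>" using den by (simp add: \<delta>_def)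
      finally have "(base (u n) - base (u k))\<^sup>2 < e\<^sup>2" using \<alpha> by simp
      then have "\<bar>base (u n) - base (u k)\<bar>\<^sup>2 < e\<^sup>2" by simp
      from power2_less_imp_less[OF this] show ?thesis using e by (simp add: dist_real_def)
    qed
    then show "\<exists>N. \<forall>n\<ge>N. \<forall>k\<ge>N. dist (base (u n)) (base (u k)) < e" by blast
  qed
  then obtain c where c: "(\<lambda>n. base (u n)) \<longlonglongrightarrow> c" using Cauchy_convergent convergent_def by blast
  \<comment> \<open>\<open>G\<close> is not shown to be constant in the gaps; any derivative gives
    an element of \<open>S\<close>.\<close>
  define f where "f x = c + prim G (s x)" for x
  have fS: "f \<in> S" by (rule S_space_of_prim(1)[OF G]) (simp add: f_def)
  have fext: "ext l r f y = c + prim G (s_ext y)" if "y \<in> I_appr" for y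
    by (rule ext_prim[OF G _ that]) (simp add: f_def)
  have dG: "sq_integrable lborel (\<lambda>y. der (u n) y - G y)" for n
    by (rule sq_integrable_diff[OF der_sq_integrable[OF uS] G])
  \<comment> \<open>Convergence at every point of \<open>I_appr\<close>, not merely almost
    everywhere: the boundary condition at approachable ends outside \<open>K0\<close>, invisible to
    \<open>M\<close>, passes to the limit in this way.\<close>
  have lim: "(\<lambda>n. ext l r (u n) y) \<longlonglongrightarrow> ext l r f y" if y: "y \<in> I_appr" for y
  proof -
    have "(\<lambda>n. prim (der (u n)) (s_ext y) - prim G (s_ext y)) \<longlonglongrightarrow> 0"
    proof (rule tendsto_rabs_zero_cancel, rule tendsto_sandwich[OF _ _ tendsto_const])
      show "\<forall>\<^sub>F n in sequentially. \<bar>prim (der (u n)) (s_ext y) - prim G (s_ext y)\<bar>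
          \<le> sqrt (\<bar>s_ext y\<bar> * (\<integral>y. (der (u n) y - G y)\<^sup>2 \<partial>lborel))"
      proof (rule always_eventually, rule allI)
        fix n
        have "(prim (der (u n)) (s_ext y) - prim G (s_ext y))\<^sup>2 \<le> \<bar>s_ext y\<bar> * (\<integral>y. (der (u n) y - G y)\<^sup>2 \<partial>lborel)"
          using prim_diff_bound[OF dG[of n], of "s_ext y" 0] prim_diff_fun[OF der_sq_integrable[OF uS[of n]] G] by simp
        then show "\<bar>prim (der (u n)) (s_ext y) - prim G (s_ext y)\<bar>
          \<le> sqrt (\<bar>s_ext y\<bar> * (\<integral>y. (der (u n) y - G y)\<^sup>2 \<partial>lborel))" by (intro real_le_rsqrt) simp
      qed
      show "(\<lambda>n. sqrt (\<bar>s_ext y\<bar> * (\<integral>y. (der (u n) y - G y)\<^sup>2 \<partial>lborel))) \<longlonglongrightarrow> 0"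
        using tendsto_real_sqrt[OF tendsto_mult_right_zero[OF derG, of "\<bar>s_ext y\<bar>"]] by simp
    qed simp
    then have "(\<lambda>n. prim (der (u n)) (s_ext y)) \<longlonglongrightarrow> prim G (s_ext y)" by (simp add: LIM_zero_iff)
    from tendsto_add[OF c this] show ?thesis by (simp add: ext_S_space[OF uS y] fext[OF y])
  qed
  have ms: "sq_integrable M (ext l r f)" "(\<lambda>n. \<integral>y. (ext l r (u n) y - ext l r f y)\<^sup>2 \<partial>M) \<longlonglongrightarrow> 0"
  proof -
    have sq: "sq_integrable M (ext l r (u n))" for n using u[of n] by (simp add: F_iff)
    have fm: "ext l r f \<in> borel_measurable M" using ext_measurable[OF fS] by (simp cong: measurable_cong_sets)
    have cauM: "\<exists>N. \<forall>n\<ge>N. \<forall>k\<ge>N. (\<integral>y. (ext l r (u n) y - ext l r (u k) y)\<^sup>2 \<partial>M) < e" if "e > 0" for e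
    proof -
      have [measurable]: "ext l r (u n) \<in> borel_measurable M" "ext l r (D n k) \<in> borel_measurable M" for n k
        using sq DF by (auto simp: sq_integrable_def F_iff)
      have "(\<integral>y. (ext l r (u n) y - ext l r (u k) y)\<^sup>2 \<partial>M) = (\<integral>y. (ext l r (D n k) y)\<^sup>2 \<partial>M)" for n k
      proof (rule integral_cong_AE)
        show "AE y in M. (ext l r (u n) y - ext l r (u k) y)\<^sup>2 = (ext l r (D n k) y)\<^sup>2"
          by (rule AE_M_I) (simp add: Dext K0_I_appr)
      qed simp_all
      then show ?thesis using cE[OF that] by metis
    qed
    have "AE y in M. (\<lambda>n. ext l r (u (id n)) y) \<longlonglongrightarrow> ext l r f y"
      by (rule AE_M_I) (simp add: lim K0_I_appr)
    from mean_square_limit[OF sq fm cauM _ this] show "sq_integrable M (ext l r f)"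
      "(\<lambda>n. \<integral>y. (ext l r (u n) y - ext l r f y)\<^sup>2 \<partial>M) \<longlonglongrightarrow> 0" by (auto simp: strict_mono_def)
  qed
  have fF: "f \<in> F"
    unfolding F_iff
  proof (intro conjI ballI fS ms(1))
    fix j assume j: "j \<in> I_appr - K0"
    then have "ext l r (u n) j = 0" for n using u[of n] by (simp add: F_iff)
    then show "ext l r f j = 0" using lim[of j] j by (simp add: LIMSEQ_const_iff)
  qed
  have "(\<lambda>n. E (\<lambda>x. u n x - f x) (\<lambda>x. u n x - f x) + (\<integral>y. (ext l r (\<lambda>x. u n x - f x) y)\<^sup>2 \<partial>M)) \<longlonglongrightarrow> 0"
  proof (rule tendsto_sandwich[OF _ _ tendsto_const])
    let ?B = "\<lambda>n. (\<integral>y. (der (u n) y - G y)\<^sup>2 \<partial>lborel) / 2 + (\<integral>y. (ext l r (u n) y - ext l r f y)\<^sup>2 \<partial>M)"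
    show "?B \<longlonglongrightarrow> 0"
      using tendsto_add[OF tendsto_divide[OF derG tendsto_const[of 2]] ms(2)] by simp
    have d: "(\<lambda>x. u n x - f x) x = 1 * u n x + (-1) * f x" for n x by simp
    note dS = S_space_lin[OF uS fS d]
    have [measurable]: "ext l r (\<lambda>x. u n x - f x) \<in> borel_measurable borel"
        "ext l r (u n) \<in> borel_measurable borel" "ext l r f \<in> borel_measurable borel" for n
      by (rule ext_measurable dS uS fS)+
    have i: "(\<integral>y. (ext l r (\<lambda>x. u n x - f x) y)\<^sup>2 \<partial>M) = (\<integral>y. (ext l r (u n) y - ext l r f y)\<^sup>2 \<partial>M)" for n
    proof (rule integral_cong_AE)
      show "AE y in M. (ext l r (\<lambda>x. u n x - f x) y)\<^sup>2 = (ext l r (u n) y - ext l r f y)\<^sup>2"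
        using ext_lin[OF uS fS d] by (intro AE_M_I) (simp add: K0_I_appr)
    qed measurable
    have "E (\<lambda>x. u n x - f x) (\<lambda>x. u n x - f x) \<le> (\<integral>y. (der (u n) y - G y)\<^sup>2 \<partial>lborel) / 2" for n
    proof (rule S_space_of_prim(2)[OF dG])
      fix x assume "x \<in> I"
      then show "u n x - f x = (base (u n) - c) + prim (\<lambda>y. der (u n) y - G y) (s x)"
        using S_space_eq[OF uS, of x n] by (simp add: f_def prim_diff_fun[OF der_sq_integrable[OF uS] G])
    qed
    then show "\<forall>\<^sub>F n in sequentially. E (\<lambda>x. u n x - f x) (\<lambda>x. u n x - f x)
        + (\<integral>y. (ext l r (\<lambda>x. u n x - f x) y)\<^sup>2 \<partial>M) \<le> ?B n"
      by (intro always_eventually allI) (simp add: i)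
    show "\<forall>\<^sub>F n in sequentially. 0 \<le> E (\<lambda>x. u n x - f x) (\<lambda>x. u n x - f x)
        + (\<integral>y. (ext l r (\<lambda>x. u n x - f x) y)\<^sup>2 \<partial>M)"
      by (intro always_eventually allI add_nonneg_nonneg E_nonneg dS) simp
  qed
  with fF show thesis by (rule that)
qed

lemma zero_F: "(\<lambda>_. 0) \<in> F"
proof -
  have f: "(\<lambda>_. 0 :: real) x = 0 + prim (\<lambda>_. 0) (s x)" for x by (simp add: prim_def)
  note S = S_space_of_prim(1)[OF sq_integrable_zero f]
  have e: "ext l r (\<lambda>_. 0) y = 0" if "y \<in> I_appr" for y
    using ext_prim[OF sq_integrable_zero f that] by (simp add: prim_def)
  have "sq_integrable M (ext l r (\<lambda>_. 0))"
    by (rule sq_integrable_bound(1)[OF sq_integrable_zero])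
      (use ext_measurable[OF S] e K0_I_appr in \<open>auto intro!: AE_M_I cong: measurable_cong_sets\<close>)
  then show ?thesis using S e by (auto simp: F_iff)
qed

lemma dirichlet_form: "dirichlet_form_wide M (ext l r) F E"
  unfolding dirichlet_form_wide_def
proof (intro conjI ballI allI impI)
    show "(\<lambda>_. 0) \<in> F" by (rule zero_F)
  next
    fix f g assume "f \<in> F" "g \<in> F"
    then show "(\<lambda>x. f x + g x) \<in> F"
      using F_lin[where f=f and g=g and h="\<lambda>x. f x + g x" and a=1 and b=1] by simp
  next
    fix f c assume "f \<in> F"
    then show "(\<lambda>x. c * f x) \<in> F" using F_lin[where f=f and g=f and h="\<lambda>x. c * f x" and a=c and b=0] by simp
  next
    fix f assume "f \<in> F"
    then show "ext l r f \<in> borel_measurable M" "integrable M (\<lambda>y. (ext l r f y)\<^sup>2)"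
      by (auto simp: F_iff sq_integrable_def)
  next
    fix f g assume "f \<in> F" "g \<in> F"
    then show "AE y in M. ext l r (\<lambda>x. f x + g x) y = ext l r f y + ext l r g y"
      using ext_lin[where f=f and g=g and h="\<lambda>x. f x + g x" and a=1 and b=1]
      by (intro AE_M_I) (simp add: K0_I_appr F_S)
  next
    fix f c assume "f \<in> F"
    then show "AE y in M. ext l r (\<lambda>x. c * f x) y = c * ext l r f y"
      using ext_lin[where f=f and g=f and h="\<lambda>x. c * f x" and a=c and b=0]
      by (intro AE_M_I) (simp add: K0_I_appr F_S)
  next
    fix f assume "f \<in> F" "AE y in M. ext l r f y = 0"
    then show "E f f = 0" using vanishing_class E_form_zero F_S by blast
  next
    fix f g assume "f \<in> F" "g \<in> F"
    then show "E f g = E g f" by (simp add: E_form_eq F_S mult.commute)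
  next
    fix f g h assume "f \<in> F" "g \<in> F" "h \<in> F"
    then show "E (\<lambda>x. f x + g x) h = E f h + E g h"
      using E_form_lin[where f=f and g=g and k=h and h="\<lambda>x. f x + g x" and a=1 and b=1]
      by (simp add: F_S)
  next
    fix f g c assume "f \<in> F" "g \<in> F"
    then show "E (\<lambda>x. c * f x) g = c * E f g"
      using E_form_lin[where f=f and g=f and k=g and h="\<lambda>x. c * f x" and a=c and b=0]
      by (simp add: F_S)
  next
    fix f assume "f \<in> F"
    then show "E f f \<ge> 0" by (simp add: E_nonneg F_S)
  next
    fix u :: "nat \<Rightarrow> real \<Rightarrow> real"
    assume "\<forall>n. u n \<in> F" and "\<forall>e>0. \<exists>N. \<forall>n\<ge>N. \<forall>k\<ge>N.
            E (\<lambda>x. u n x - u k x) (\<lambda>x. u n x - u k x) + (\<integral>y. (ext l r (\<lambda>x. u n x - u k x) y)\<^sup>2 \<partial>M) < e"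
    then obtain f where "f \<in> F" "(\<lambda>n. E (\<lambda>x. u n x - f x) (\<lambda>x. u n x - f x)
      + (\<integral>y. (ext l r (\<lambda>x. u n x - f x) y)\<^sup>2 \<partial>M)) \<longlonglongrightarrow> 0"
      using form_complete[of u] by blast
    then show "\<exists>f\<in>F. (\<lambda>n. E (\<lambda>x. u n x - f x) (\<lambda>x. u n x - f x)
      + (\<integral>y. (ext l r (\<lambda>x. u n x - f x) y)\<^sup>2 \<partial>M)) \<longlonglongrightarrow> 0" by blast
  next
    fix f assume f: "f \<in> F"
    show "(\<lambda>x. min 1 (max 0 (f x))) \<in> F" by (rule markov(1)[OF f])
    show "AE y in M. ext l r (\<lambda>x. min 1 (max 0 (f x))) y = min 1 (max 0 (ext l r f y))"
      by (intro AE_M_I markov(2)[OF f] K0_I_appr)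
    show "E (\<lambda>x. min 1 (max 0 (f x))) (\<lambda>x. min 1 (max 0 (f x))) \<le> E f f" by (rule markov(3)[OF f])
qed

end

theorem theorem2p4:
  fixes l r :: ereal and s :: "real \<Rightarrow> real" and m :: "ereal measure"
  assumes lr: "l < 0" "0 < r"
    and s_mono: "mono_on (intv l r) s"
    and s_nonconst: "\<exists>x\<in>intv l r. \<exists>y\<in>intv l r. s x \<noteq> s y"
    and s0: "s 0 = 0" and s_cont0: "(s \<longlongrightarrow> 0) (at 0)"
    and m_sets: "sets m = sets borel"
    and m_on_I: "emeasure m (- {l..r}) = 0"
    and m_loc_fin: "\<And>a b. l < ereal a \<Longrightarrow> ereal b < r \<Longrightarrow> emeasure m {ereal a..ereal b} < \<infinity>"
    and m_0: "emeasure m {0} = 0"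
    and DK: "cond_DK l r s m"
    and DM: "cond_DM l r s m"
  shows "dirichlet_form_wide (m0 l r s m) (ext l r) (F_space l r s m) (E_form l r s)"
proof -
  interpret dirichlet_setting l r s m
    by unfold_locales (fact assms)+
  show ?thesis by (rule dirichlet_form)
qed

end
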